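(* Let $r\ge1$ and let $M$ be an arithmetic closed $X_r$-manifold. There exists a sequence $M_i$ of congruence coverings of $M$ with $\mathrm{vol}(M_i)\to\infty$ such that $$\mathrm{sys}_1(M_i)\ \ge\ \frac{4}{3\sqrt{r}}\log(\mathrm{vol}(M_i))-c \qquad\text{for all } i,$$ where $c$ does not depend on $i$.
   Context: $\mathbb{H}$ is the hyperbolic upper half-plane and $X_r=\mathbb{H}^r$ is the product of $r$ copies with the product Riemannian metric, acted on componentwise by $G=\mathrm{PSL}(2,\mathbb{R})^r$. An $X_r$-manifold is a Riemannian manifold locally isometric to $X_r$. Arithmetic $X_r$-manifolds: let $K$ be a totally real number field of degree $d$ with ring of integers $\mathcal{O}_K$, and $A$ a quaternion algebra over $K$ that splits at exactly $r$ real embeddings $\sigma_1,\dots,\sigma_r$ of $K$. There is an algebra morphism $\rho=(\rho_1,\dots,\rho_r):A\otimes_{\mathbb{Q}}\mathbb{R}\to\mathrm{M}_2(\mathbb{R})^r$, surjective with kernel a product of $d-r$ copies of Hamilton's quaternions, satisfying $\mathrm{tr}(\rho_i(\alpha))=\sigma_i(\mathrm{tr}(\alpha))$ for $\alpha\in A$. Choose a basis $1,\iota,j,\kappa$ of $A$ over $K$ with $\iota^2=a$, $j^2=b$, $\iota j=\kappa=-j\iota$, $a,b\in\mathcal{O}_K\setminus\{0\}$, let $\mathcal{Q}=\{\alpha_0+\alpha_1\iota+\alpha_2 j+\alpha_3\kappa\mid\alpha_i\in\mathcal{O}_K\}$, and let $\mathcal{Q}^1$ be the group of elements of $\mathcal{Q}$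 of reduced norm $1$. We write $\rho(\mathcal{Q}^1)$ also for its image in $G$; it is an irreducible lattice, assumed cocompact here. A closed arithmetic $X_r$-orbifold (manifold, if $\Gamma$ is torsion free) is $M=\Gamma\backslash\mathbb{H}^r$, where $\Gamma<G$ is a discrete group commensurable with $\rho(\mathcal{Q}^1)$ for some such data $K,A,\rho,\mathcal{Q}$. Congruence coverings: for a nonzero ideal $I\subset\mathcal{O}_K$ put $\mathcal{Q}^1(I)=\{\alpha_0+\alpha_1\iota+\alpha_2 j+\alpha_3\kappa\in\mathcal{Q}^1\mid\alpha_0-1,\alpha_1,\alpha_2,\alpha_3\in I\}$. If $\Gamma'<\Gamma$ is a finite-index subgroup contained in $\rho(\mathcal{Q}^1)$ and $\Gamma'(I)=\Gamma'\cap\rho(\mathcal{Q}^1(I))$, the finite covering $\Gamma'(I)\backslash\mathbb{H}^r$ of $M$ is called a congruence covering of $M$. $\mathrm{sys}_1(M)$ is the minimal length of a (noncontractible) closed geodesic in $M$, and $\mathrm{vol}$ is Riemannian volume. *)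

theory Defs
  imports
    "HOL-Analysis.Analysis"
    "HOL-Algebra.Product_Groups"
    "HOL-Algebra.Ideal"
    "HOL-Library.Poly_Mapping"
begin

section \<open>Number fields\<close>

abbreviation rat_scale :: "rat \<Rightarrow> 'k::field_char_0 \<Rightarrow> 'k" where
  "rat_scale q x \<equiv> of_rat q * x"

definition number_field :: "'k::field_char_0 itself \<Rightarrow> bool" where
  "number_field _ \<longleftrightarrow> (\<exists>B::'k set. finite B \<and> module.span rat_scale B = UNIV)"

definition degree_field :: "'k::field_char_0 itself \<Rightarrow> nat" where
  "degree_field _ = vector_space.dim rat_scale (UNIV :: 'k set)"

definition field_embedding :: "('k::field \<Rightarrow> 'l::field) \<Rightarrow> bool" where
  "field_embedding \<tau> \<longleftrightarrow> \<tau> 1 = 1 \<and>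
     (\<forall>x y. \<tau> (x + y) = \<tau> x + \<tau> y) \<and> (\<forall>x y. \<tau> (x * y) = \<tau> x * \<tau> y)"

definition totally_real :: "'k::field_char_0 itself \<Rightarrow> bool" where
  "totally_real _ \<longleftrightarrow> (\<forall>\<tau> :: 'k \<Rightarrow> complex. field_embedding \<tau> \<longrightarrow> range \<tau> \<subseteq> \<real>)"

definition ring_of_integers :: "'k::field_char_0 ring" where
  "ring_of_integers = \<lparr>carrier = {x. algebraic_int x}, mult = (*), one = 1, zero = 0, add = (+)\<rparr>"


section \<open>Quaternion algebras\<close>

text \<open>
  The quadruple \<open>(x0, x1, x2, x3)\<close> stands for \<open>x0 + x1 \<iota> + x2 j + x3 \<kappa>\<close> in the quaternion
  algebra with \<open>\<iota>\<^sup>2 = a\<close>, \<open>j\<^sup>2 = b\<close> and \<open>\<iota> j = \<kappa> = - j \<iota>\<close>.  The additive group does not depend on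
  \<open>a\<close> and \<open>b\<close>, so it is the product type; the multiplication takes them as parameters.
\<close>

type_synonym 'k quat = "'k \<times> 'k \<times> 'k \<times> 'k"

fun qmult :: "'k::comm_ring_1 \<Rightarrow> 'k \<Rightarrow> 'k quat \<Rightarrow> 'k quat \<Rightarrow> 'k quat" where
  "qmult a b (x0, x1, x2, x3) (y0, y1, y2, y3) =
    (x0 * y0 + a * (x1 * y1) + b * (x2 * y2) - a * b * (x3 * y3),
     x0 * y1 + x1 * y0 + b * (x3 * y2) - b * (x2 * y3),
     x0 * y2 + x2 * y0 + a * (x1 * y3) - a * (x3 * y1),
     x0 * y3 + x3 * y0 + x1 * y2 - x2 * y1)"

definition qone :: "'k::comm_ring_1 quat" where
  "qone = (1, 0, 0, 0)"

fun qscale :: "'k::comm_ring_1 \<Rightarrow> 'k quat \<Rightarrow> 'k quat" where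
  "qscale c (x0, x1, x2, x3) = (c * x0, c * x1, c * x2, c * x3)"

fun qtr :: "'k::comm_ring_1 quat \<Rightarrow> 'k" where
  "qtr (x0, x1, x2, x3) = 2 * x0"

fun qnrd :: "'k::comm_ring_1 \<Rightarrow> 'k \<Rightarrow> 'k quat \<Rightarrow> 'k" where
  "qnrd a b (x0, x1, x2, x3) = x0\<^sup>2 - a * x1\<^sup>2 - b * x2\<^sup>2 + a * b * x3\<^sup>2"

text \<open>
  Splitting at a real embedding \<open>\<tau>\<close>: extending scalars of the quaternion algebra along \<open>\<tau>\<close> gives
  the real quaternion algebra with parameters \<open>\<tau> a\<close>, \<open>\<tau> b\<close>, which has to be isomorphic to the
  algebra of real 2 by 2 matrices.
\<close>

definition splits_at :: "'k::field_char_0 \<Rightarrow> 'k \<Rightarrow> ('k \<Rightarrow> real) \<Rightarrow> bool" where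
  "splits_at a b \<tau> \<longleftrightarrow> (\<exists>\<phi> :: real quat \<Rightarrow> real^2^2. linear \<phi> \<and> bij \<phi> \<and> \<phi> qone = mat 1 \<and>
     (\<forall>x y. \<phi> (qmult (\<tau> a) (\<tau> b) x y) = \<phi> x ** \<phi> y))"


section \<open>Real extension of scalars\<close>

text \<open>
  The tensor product over the rationals of the quaternion algebra \<open>A\<close> over \<open>K\<close> with the reals:
  formal real linear combinations of elements of \<open>A\<close> (the generator \<open>Poly_Mapping.single x t\<close>
  stands for \<open>x \<otimes> t\<close>) modulo the subspace \<open>tensor_null\<close> spanned by the bilinearity relations.
\<close>

definition tensor_scale :: "real \<Rightarrow> ('k quat \<Rightarrow>\<^sub>0 real) \<Rightarrow> ('k::field_char_0 quat \<Rightarrow>\<^sub>0 real)" where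
  "tensor_scale t u = Poly_Mapping.map (\<lambda>s. t * s) u"

definition tensor_mult :: "'k::field_char_0 \<Rightarrow> 'k \<Rightarrow> ('k quat \<Rightarrow>\<^sub>0 real) \<Rightarrow> ('k quat \<Rightarrow>\<^sub>0 real) \<Rightarrow> ('k quat \<Rightarrow>\<^sub>0 real)"
  where "tensor_mult a b u v =
    (\<Sum>x\<in>Poly_Mapping.keys u. \<Sum>y\<in>Poly_Mapping.keys v.
       Poly_Mapping.single (qmult a b x y) (Poly_Mapping.lookup u x * Poly_Mapping.lookup v y))"

definition tensor_null :: "('k::field_char_0 quat \<Rightarrow>\<^sub>0 real) set" where
  "tensor_null = module.span tensor_scale
    ({Poly_Mapping.single (x + y) 1 - Poly_Mapping.single x 1 - Poly_Mapping.single y 1 | x y. True} \<union>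
     {Poly_Mapping.single (qscale (of_rat q) x) 1 - Poly_Mapping.single x (of_rat q) | q x. True})"

text \<open>The real linear map on the tensor product determined by an additive map on \<open>A\<close>.\<close>

definition tensor_lift :: "('k::field_char_0 quat \<Rightarrow> real^2^2) \<Rightarrow> ('k quat \<Rightarrow>\<^sub>0 real) \<Rightarrow> real^2^2" where
  "tensor_lift f u = (\<Sum>x\<in>Poly_Mapping.keys u. Poly_Mapping.lookup u x *\<^sub>R f x)"

text \<open>
  The subset \<open>N\<close> of formal combinations, taken modulo \<open>tensor_null\<close>, is as a real algebra a product
  of \<open>m\<close> copies of Hamilton's quaternions (only the values \<open>\<Phi> u n\<close> with \<open>n < m\<close> matter).
\<close>

definition product_of_hamiltonians ::
    "'k::field_char_0 \<Rightarrow> 'k \<Rightarrow> ('k quat \<Rightarrow>\<^sub>0 real) set \<Rightarrow> nat \<Rightarrow> bool" where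
  "product_of_hamiltonians a b N m \<longleftrightarrow>
    (\<exists>\<Phi> :: ('k quat \<Rightarrow>\<^sub>0 real) \<Rightarrow> nat \<Rightarrow> real quat.
       (\<forall>u\<in>N. \<forall>v\<in>N. \<forall>n<m. \<Phi> (u + v) n = \<Phi> u n + \<Phi> v n \<and>
                            \<Phi> (tensor_mult a b u v) n = qmult (-1) (-1) (\<Phi> u n) (\<Phi> v n)) \<and>
       (\<forall>t. \<forall>u\<in>N. \<forall>n<m. \<Phi> (tensor_scale t u) n = t *\<^sub>R \<Phi> u n) \<and>
       (\<forall>u\<in>N. (\<forall>n<m. \<Phi> u n = 0) \<longleftrightarrow> u \<in> tensor_null) \<and>
       (\<forall>h. \<exists>u\<in>N. \<forall>n<m. \<Phi> u n = h n))"


section \<open>The group and its action\<close>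

definition SL2R :: "(real^2^2) monoid" where
  "SL2R = \<lparr>carrier = {A. det A = 1}, mult = (**), one = mat 1\<rparr>"

definition PSL2R :: "(real^2^2) set monoid" where
  "PSL2R = SL2R Mod {mat 1, - mat 1}"

text \<open>The number \<open>r\<close> of factors is the cardinality of the index type, hence at least 1.\<close>

type_synonym 'r psl = "'r \<Rightarrow> (real^2^2) set"

definition G :: "'r::finite psl monoid" where
  "G = product_group UNIV (\<lambda>_. PSL2R)"

definition to_psl :: "real^2^2 \<Rightarrow> (real^2^2) set" where
  "to_psl A = {mat 1, - mat 1} #>\<^bsub>SL2R\<^esub> A"

definition finite_index :: "'r::finite psl set \<Rightarrow> 'r psl set \<Rightarrow> bool" where
  "finite_index H \<Gamma> \<longleftrightarrow> finite (rcosets\<^bsub>G\<lparr>carrier := \<Gamma>\<rparr>\<^esub> H)"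

definition commensurable :: "'r::finite psl set \<Rightarrow> 'r psl set \<Rightarrow> bool" where
  "commensurable \<Gamma> \<Delta> \<longleftrightarrow> finite_index (\<Gamma> \<inter> \<Delta>) \<Gamma> \<and> finite_index (\<Gamma> \<inter> \<Delta>) \<Delta>"

text \<open>
  A subgroup is discrete iff the identity is isolated in it; a neighbourhood basis of the identity
  of \<open>G\<close> consists of the tuples all of whose entries have a matrix representative close to \<open>mat 1\<close>.
\<close>

definition discrete_subgroup :: "'r::finite psl set \<Rightarrow> bool" where
  "discrete_subgroup \<Gamma> \<longleftrightarrow> subgroup \<Gamma> G \<and>
    (\<exists>\<epsilon>>0. \<forall>\<gamma>\<in>\<Gamma>. (\<forall>i. \<exists>A\<in>\<gamma> i. dist A (mat 1) < \<epsilon>) \<longrightarrow> \<gamma> = \<one>\<^bsub>G\<^esub>)"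

definition torsion_free :: "'r::finite psl set \<Rightarrow> bool" where
  "torsion_free \<Gamma> \<longleftrightarrow> (\<forall>\<gamma>\<in>\<Gamma>. \<forall>n::nat. n > 0 \<and> \<gamma> [^]\<^bsub>G\<^esub> n = \<one>\<^bsub>G\<^esub> \<longrightarrow> \<gamma> = \<one>\<^bsub>G\<^esub>)"

definition moebius :: "real^2^2 \<Rightarrow> complex \<Rightarrow> complex" where
  "moebius A z = (of_real (A$1$1) * z + of_real (A$1$2)) / (of_real (A$2$1) * z + of_real (A$2$2))"

text \<open>The image is a singleton: both representatives of \<open>\<gamma> i\<close> give the same transformation.\<close>

definition act :: "'r::finite psl \<Rightarrow> complex^'r \<Rightarrow> complex^'r" where
  "act \<gamma> z = (\<chi> i. the_elem ((\<lambda>A. moebius A (z $ i)) ` \<gamma> i))"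


section \<open>The space and its quotients\<close>

definition upper :: "(complex^'r::finite) set" where
  "upper = {z. \<forall>i. Im (z $ i) > 0}"

definition hyp_dist :: "complex \<Rightarrow> complex \<Rightarrow> real" where
  "hyp_dist z w = arcosh (1 + (cmod (z - w))\<^sup>2 / (2 * Im z * Im w))"

text \<open>The distance of the product of the hyperbolic metrics.\<close>

definition upper_dist :: "complex^'r::finite \<Rightarrow> complex^'r \<Rightarrow> real" where
  "upper_dist z w = sqrt (\<Sum>i\<in>UNIV. (hyp_dist (z $ i) (w $ i))\<^sup>2)"

text \<open>The Riemannian volume, with density the product of the \<open>dx dy / y\<^sup>2\<close>.\<close>

definition upper_vol :: "(complex^'r::finite) measure" where
  "upper_vol = density lborel (\<lambda>z. ennreal (indicator upper z * (\<Prod>i\<in>UNIV. 1 / (Im (z $ i))\<^sup>2)))"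

definition orbit_of :: "'r::finite psl set \<Rightarrow> complex^'r \<Rightarrow> (complex^'r) set" where
  "orbit_of \<Gamma> z = (\<lambda>\<gamma>. act \<gamma> z) ` \<Gamma>"

definition quotient_space :: "'r::finite psl set \<Rightarrow> (complex^'r) set set" where
  "quotient_space \<Gamma> = orbit_of \<Gamma> ` upper"

text \<open>
  For a set \<open>U\<close> of orbits, \<open>\<Union>U\<close> is its preimage under the projection \<open>orbit_of \<Gamma>\<close>.
\<close>

definition quotient_topology :: "'r::finite psl set \<Rightarrow> (complex^'r) set topology" where
  "quotient_topology \<Gamma> = topology (\<lambda>U. U \<subseteq> quotient_space \<Gamma> \<and> openin (top_of_set upper) (\<Union>U))"

definition quotient_dist :: "(complex^'r::finite) set \<Rightarrow> (complex^'r) set \<Rightarrow> real" where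
  "quotient_dist P Q = Inf {upper_dist x y | x y. x \<in> P \<and> y \<in> Q}"

definition cocompact :: "'r::finite psl set \<Rightarrow> bool" where
  "cocompact \<Gamma> \<longleftrightarrow> compact_space (quotient_topology \<Gamma>)"

text \<open>
  The Riemannian volume measure of the quotient is the Borel measure for which the projection
  preserves the volume of every Borel set on which it is injective.
\<close>

definition quotient_vol :: "'r::finite psl set \<Rightarrow> (complex^'r) set measure" where
  "quotient_vol \<Gamma> = (THE V. space V = quotient_space \<Gamma> \<and>
     sets V = {B. B \<subseteq> quotient_space \<Gamma> \<and> \<Union>B \<in> sets borel} \<and>
     (\<forall>U \<in> sets borel. U \<subseteq> upper \<and> inj_on (orbit_of \<Gamma>) U \<longrightarrow>
        emeasure V (orbit_of \<Gamma> ` U) = emeasure upper_vol U))"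

definition vol :: "'r::finite psl set \<Rightarrow> real" where
  "vol \<Gamma> = measure (quotient_vol \<Gamma>) (quotient_space \<Gamma>)"

text \<open>
  A closed geodesic of length \<open>l\<close> is given by a unit speed parametrisation with period \<open>l\<close>;
  geodesics are the curves that are locally distance minimising.
\<close>

definition closed_geodesic :: "'r::finite psl set \<Rightarrow> (real \<Rightarrow> (complex^'r) set) \<Rightarrow> real \<Rightarrow> bool" where
  "closed_geodesic \<Gamma> c l \<longleftrightarrow> l > 0 \<and> range c \<subseteq> quotient_space \<Gamma> \<and> (\<forall>t. c (t + l) = c t) \<and>
    (\<forall>t. \<exists>\<epsilon>>0. \<forall>s\<in>{t-\<epsilon><..<t+\<epsilon>}. \<forall>s'\<in>{t-\<epsilon><..<t+\<epsilon>}. quotient_dist (c s) (c s') = \<bar>s - s'\<bar>)"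

definition contractible_loop :: "'r::finite psl set \<Rightarrow> (real \<Rightarrow> (complex^'r) set) \<Rightarrow> real \<Rightarrow> bool" where
  "contractible_loop \<Gamma> c l \<longleftrightarrow>
    (\<exists>p. homotopic_with (\<lambda>h. h 0 = h l) (top_of_set {0..l}) (quotient_topology \<Gamma>) c (\<lambda>_. p))"

definition sys1 :: "'r::finite psl set \<Rightarrow> ereal" where
  "sys1 \<Gamma> = Inf {ereal l | l c. closed_geodesic \<Gamma> c l \<and> \<not> contractible_loop \<Gamma> c l}"


section \<open>Arithmetic manifolds and congruence coverings\<close>

definition Q1 :: "'k::field_char_0 \<Rightarrow> 'k \<Rightarrow> 'k quat set" where
  "Q1 a b = {(x0, x1, x2, x3) | x0 x1 x2 x3.
     {x0, x1, x2, x3} \<subseteq> carrier ring_of_integers \<and> qnrd a b (x0, x1, x2, x3) = 1}"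

definition Q1_cong :: "'k::field_char_0 \<Rightarrow> 'k \<Rightarrow> 'k set \<Rightarrow> 'k quat set" where
  "Q1_cong a b I = {(x0, x1, x2, x3) | x0 x1 x2 x3.
     (x0, x1, x2, x3) \<in> Q1 a b \<and> {x0 - 1, x1, x2, x3} \<subseteq> I}"

definition psl_image :: "('r::finite \<Rightarrow> 'k quat \<Rightarrow> real^2^2) \<Rightarrow> 'k::field_char_0 quat set \<Rightarrow> 'r psl set" where
  "psl_image \<rho> S = (\<lambda>x i. to_psl (\<rho> i x)) ` S"

text \<open>
  The algebra morphism from the tensor product to the matrices is given by its restriction
  \<open>\<rho>\<close> to \<open>A\<close>, a tuple of unital ring homomorphisms; it is recovered as \<open>tensor_lift\<close>.
\<close>

locale arithmetic_data =
  fixes a b :: "'k::field_char_0"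
    and \<sigma> :: "'r::finite \<Rightarrow> 'k \<Rightarrow> real"
    and \<rho> :: "'r \<Rightarrow> 'k quat \<Rightarrow> real^2^2"
  assumes number_field: "number_field TYPE('k)"
    and totally_real: "totally_real TYPE('k)"
    and integral: "a \<in> carrier ring_of_integers" "b \<in> carrier ring_of_integers"
    and nonzero: "a \<noteq> 0" "b \<noteq> 0"
    and inj_embeddings: "inj \<sigma>"
    and split_embeddings: "range \<sigma> = {\<tau>. field_embedding \<tau> \<and> splits_at a b \<tau>}"
    and hom_add: "\<rho> i (x + y) = \<rho> i x + \<rho> i y"
    and hom_mult: "\<rho> i (qmult a b x y) = \<rho> i x ** \<rho> i y"
    and hom_one: "\<rho> i qone = mat 1"
    and surjective: "\<exists>u. \<forall>i. tensor_lift (\<rho> i) u = m i"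
    and kernel: "product_of_hamiltonians a b {u. \<forall>i. tensor_lift (\<rho> i) u = 0}
                   (degree_field TYPE('k) - CARD('r))"
    and trace: "trace (\<rho> i x) = \<sigma> i (qtr x)"
    and cocompact: "cocompact (psl_image \<rho> (Q1 a b))"

text \<open>The quotient by \<open>\<Gamma>\<close> is a closed arithmetic manifold coming from the given data.\<close>

definition closed_arithmetic_manifold ::
    "'k::field_char_0 \<Rightarrow> 'k \<Rightarrow> ('r::finite \<Rightarrow> 'k quat \<Rightarrow> real^2^2) \<Rightarrow> 'r psl set \<Rightarrow> bool" where
  "closed_arithmetic_manifold a b \<rho> \<Gamma> \<longleftrightarrow>
     discrete_subgroup \<Gamma> \<and> torsion_free \<Gamma> \<and> cocompact \<Gamma> \<and>
     commensurable \<Gamma> (psl_image \<rho> (Q1 a b))"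

text \<open>The quotient by \<open>\<Delta>\<close> is a congruence covering of the quotient by \<open>\<Gamma>\<close>.\<close>

definition congruence_covering ::
    "'k::field_char_0 \<Rightarrow> 'k \<Rightarrow> ('r::finite \<Rightarrow> 'k quat \<Rightarrow> real^2^2) \<Rightarrow> 'r psl set \<Rightarrow> 'r psl set \<Rightarrow> bool" where
  "congruence_covering a b \<rho> \<Gamma> \<Delta> \<longleftrightarrow>
     (\<exists>\<Gamma>' I. subgroup \<Gamma>' G \<and> \<Gamma>' \<subseteq> \<Gamma> \<and> finite_index \<Gamma>' \<Gamma> \<and> \<Gamma>' \<subseteq> psl_image \<rho> (Q1 a b) \<and>
        ideal I (ring_of_integers :: 'k ring) \<and> I \<noteq> {0} \<and>
        \<Delta> = \<Gamma>' \<inter> psl_image \<rho> (Q1_cong a b I))"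

end

(*
  The ideals are the powers I = (3^n).  If x in Q^1(I) has reduced trace 2 x0, the norm equation gives
  2 (x0 - 1) in I^2.  Cocompactness excludes x0 = 1 for x distinct from 1, since such an x would be
  unipotent and could be conjugated arbitrarily close to 1.  Hence the norm of 2 (x0 - 1) is at least
  N(I)^2.  At a ramified place this element has absolute value at most 4, and at the i-th split place at
  most 4 exp(l_i / 2), where l_i is the displacement of x in the i-th factor.  So the sum of the l_i is at
  least 4 log N(I) up to a constant, and by Cauchy-Schwarz the displacement in the product is at least
  1 / sqrt r times that.  A closed geodesic lifts to a path joining z to g z, with g = 1 only if the geodesic
  is contractible, so the same bound holds for the systole.
  On the other hand the index of the congruence subgroup is at most a constant times N(I)^3, because
  modulo 3^n an element of norm 1 congruent to 1 modulo 3 is determined by its last three coordinates.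
  The volume tends to infinity because sets of diameter below the displacement embed in the quotient.
*)
theory Submission
  imports Defs "Jordan_Normal_Form.Char_Poly" "HOL-Library.Function_Algebras"
    "HOL-Computational_Algebra.Field_as_Ring"
begin

section \<open>Algebraic integers\<close>

text \<open>The prime 3 is taken because it is odd. For two elements congruent to 1 modulo 3 the sum
  of the first coordinates is 2 modulo 3, a unit at 3, so the norm equation recovers the first
  coordinate; this saves one of four coordinates in the index. The exponent 3 obtained in this way,
  against the 4 of the displacement bound, is the quotient 4/3. From number theory two facts carry
  the proof: a nonzero algebraic integer has absolute norm at least 1, and there are at most 3^(n d)
  residue classes modulo 3^n, with d the degree. The geometry rests on one uniform lower bound for
  displacements, from which freeness, unique lifting, countability and a Borel transversal follow.
  The obstacle is that volume and systole are defined intrinsically: the volume measure is a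
  definite description whose existence and uniqueness must be proved, and geodesics are locally
  isometric maps into a set of orbits. Moreover the image of Q^1 may have torsion; so volume is
  bounded by transporting one compact box with coset representatives, not by multiplying a covolume
  with an index. When some real place is ramified, x0 = 1 is excluded by definiteness of the norm
  there; conjugation towards 1 serves the case where all real places split.\<close>

text \<open>The additive group generated by \<open>B\<close>. The notion is meant for finite
  \<open>B\<close>, a sum over an infinite set being 0.\<close>

definition int_span :: "'a::comm_ring_1 set \<Rightarrow> 'a set" where
  "int_span B = {\<Sum>b\<in>B. of_int (c b) * b | c. True}"

lemma int_spanI: "x = (\<Sum>b\<in>B. of_int (c b) * b) \<Longrightarrow> x \<in> int_span B"
  unfolding int_span_def mem_Collect_eq by (rule exI[of _ c]) simp

lemma int_span_add: "x \<in> int_span B \<Longrightarrow> y \<in> int_span B \<Longrightarrow> x + y \<in> int_span B"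
proof -
  assume "x \<in> int_span B" "y \<in> int_span B"
  then obtain c e where "x = (\<Sum>b\<in>B. of_int (c b) * b)" "y = (\<Sum>b\<in>B. of_int (e b) * b)"
    unfolding int_span_def by blast
  then have "x + y = (\<Sum>b\<in>B. of_int (c b + e b) * b)"
    by (simp add: sum.distrib distrib_right)
  then show ?thesis by (rule int_spanI[where c = "\<lambda>b. c b + e b"])
qed

lemma int_span_scale: "x \<in> int_span B \<Longrightarrow> of_int k * x \<in> int_span B"
proof -
  assume "x \<in> int_span B"
  then obtain c where "x = (\<Sum>b\<in>B. of_int (c b) * b)" by (auto simp: int_span_def)
  then have "of_int k * x = (\<Sum>b\<in>B. of_int (k * c b) * b)"
    by (simp add: sum_distrib_left mult.assoc)
  then show ?thesis by (rule int_spanI[where c = "\<lambda>b. k * c b"])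
qed

lemma int_span_0: "0 \<in> int_span B"
  unfolding int_span_def by (rule CollectI) (rule exI[of _ "\<lambda>_. 0"], simp)

lemma int_span_sum: "(\<And>i. i \<in> I \<Longrightarrow> f i \<in> int_span B) \<Longrightarrow> sum f I \<in> int_span B"
  by (induction I rule: infinite_finite_induct) (auto intro: int_span_add int_span_0)

lemma int_span_base: "finite B \<Longrightarrow> b \<in> B \<Longrightarrow> b \<in> int_span B"
proof -
  assume "finite B" "b \<in> B"
  have "(\<Sum>x\<in>B. of_int (if x = b then 1 else 0) * x) = (\<Sum>x\<in>B. if x = b then x else 0)"
    by (rule sum.cong) auto
  also have "\<dots> = b" using \<open>finite B\<close> \<open>b \<in> B\<close> by (simp add: sum.delta)
  finally have "b = (\<Sum>x\<in>B. of_int (if x = b then 1 else 0) * x)" by simp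
  then show ?thesis by (rule int_spanI[where c = "\<lambda>x. if x = b then 1 else 0"])
qed

lemma int_span_stable:
  assumes "\<And>b. b \<in> B \<Longrightarrow> x * b \<in> int_span B" "y \<in> int_span B"
  shows "x * y \<in> int_span B"
proof -
  obtain c where c: "y = (\<Sum>b\<in>B. of_int (c b) * b)" using assms(2) by (auto simp: int_span_def)
  have "x * y = (\<Sum>b\<in>B. of_int (c b) * (x * b))" by (simp add: c sum_distrib_left algebra_simps)
  then show ?thesis using assms(1) by (auto intro!: int_span_sum int_span_scale)
qed

text \<open>The Cayley--Hamilton argument: \<open>x\<close> is an eigenvalue of an integer matrix.\<close>

lemma algebraic_int_if_stable:
  fixes x :: "'a::field_char_0"
  assumes "finite B" "b0 \<in> B" "b0 \<noteq> 0" and stable: "\<And>b. b \<in> B \<Longrightarrow> x * b \<in> int_span B"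
  shows "algebraic_int x"
proof -
  define n where "n = card B"
  obtain h where h: "bij_betw h {0..<n} B"
    using ex_bij_betw_nat_finite[OF \<open>finite B\<close>] n_def by blast
  have "\<forall>b\<in>B. \<exists>c. x * b = (\<Sum>b'\<in>B. of_int (c b') * b')"
    using stable by (auto simp: int_span_def)
  then obtain c where c: "\<And>b. b \<in> B \<Longrightarrow> x * b = (\<Sum>b'\<in>B. of_int (c b b') * b')"
    by metis
  \<comment> \<open>Row \<open>i\<close> holds the coordinates of \<open>x * h i\<close> in the
    generators, so the list of generators itself is an eigenvector for \<open>x\<close>; it is
    nonzero because of \<open>b0\<close>.\<close>
  define A :: "int mat" where "A = mat n n (\<lambda>(i,j). c (h i) (h j))"
  define A' :: "'a mat" where "A' = map_mat of_int A"
  define v where "v = vec n h"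
  have A: "A \<in> carrier_mat n n" "A' \<in> carrier_mat n n" by (auto simp: A_def A'_def)
  have "A' *\<^sub>v v = x \<cdot>\<^sub>v v"
  proof (rule eq_vecI)
    fix i assume "i < dim_vec (x \<cdot>\<^sub>v v)"
    then have i: "i < n" by (simp add: v_def)
    then have hi: "h i \<in> B" using h by (auto simp: bij_betw_def)
    have "(A' *\<^sub>v v) $ i = (\<Sum>j = 0..<n. of_int (c (h i) (h j)) * h j)"
      using i by (simp add: A'_def A_def v_def scalar_prod_def)
    also have "\<dots> = (\<Sum>b'\<in>B. of_int (c (h i) b') * b')"
      using sum.reindex_bij_betw[OF h, of "\<lambda>b'. of_int (c (h i) b') * b'"] by simp
    finally show "(A' *\<^sub>v v) $ i = (x \<cdot>\<^sub>v v) $ i" using c[OF hi] i by (simp add: v_def)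
  qed (auto simp: v_def A'_def A_def)
  moreover have "v \<noteq> 0\<^sub>v n"
  proof
    assume v0: "v = 0\<^sub>v n"
    obtain i where i: "i < n" "h i = b0" using h \<open>b0 \<in> B\<close> by (auto simp: bij_betw_def)
    then have "v $ i = b0" by (simp add: v_def)
    then show False using v0 i \<open>b0 \<noteq> 0\<close> by simp
  qed
  ultimately have "eigenvalue A' x"
    unfolding eigenvalue_def eigenvector_def using A by (auto simp: v_def intro!: exI[of _ v])
  then have "poly (char_poly A') x = 0" using eigenvalue_root_char_poly[OF A(2)] by simp
  moreover have "char_poly A' = map_poly of_int (char_poly A)"
    unfolding A'_def by (rule of_int_hom.char_poly_hom[OF A(1)])
  moreover have "lead_coeff (char_poly A) = 1" using degree_monic_char_poly[OF A(1)] by simp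
  ultimately show ?thesis by (subst algebraic_int_altdef_ipoly) (intro exI[of _ "char_poly A"], simp)
qed

text \<open>A monic annihilating polynomial solved for its leading term. Positivity of
  \<open>n\<close> puts 1 among the monomials with exponents below \<open>n\<close>.\<close>

lemma algebraic_int_power_reduce:
  fixes x :: "'a::field_char_0"
  assumes "algebraic_int x"
  obtains n and c :: "nat \<Rightarrow> int" where "n > 0" "x ^ n = (\<Sum>i<n. of_int (c i) * x ^ i)"
proof -
  obtain p where p: "poly (map_poly of_int p) x = 0" "lead_coeff p = 1"
    using assms algebraic_int_altdef_ipoly by blast
  have d: "degree (map_poly of_int p :: 'a poly) = degree p" by simp
  have "0 < degree p"
  proof (rule ccontr)
    assume "\<not> 0 < degree p"
    then obtain a where "p = [:a:]" by (auto elim: degree_eq_zeroE)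
    then show False using p by simp
  qed
  moreover have "(\<Sum>i<degree p. of_int (coeff p i) * x ^ i) + x ^ degree p = 0"
  proof -
    have "0 = (\<Sum>i\<le>degree p. of_int (coeff p i) * x ^ i)"
      using p(1) by (simp add: poly_altdef d coeff_map_poly)
    also have "\<dots> = (\<Sum>i<degree p. of_int (coeff p i) * x ^ i) + of_int (lead_coeff p) * x ^ degree p"
      by (simp only: lessThan_Suc_atMost[symmetric] sum.lessThan_Suc)
    finally show ?thesis using p(2) by simp
  qed
  then have "x ^ degree p = - (\<Sum>i<degree p. of_int (coeff p i) * x ^ i)"
    by (metis add.commute eq_neg_iff_add_eq_0)
  then have "x ^ degree p = (\<Sum>i<degree p. of_int (- coeff p i) * x ^ i)"
    by (simp add: sum_negf)
  ultimately show ?thesis by (rule that)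
qed

text \<open>The monomials \<open>x ^ i * y ^ j\<close> with exponents below the degrees of the two
  monic relations generate a group stable under multiplication by \<open>x\<close> and by
  \<open>y\<close>, hence by \<open>x + y\<close> and \<open>x * y\<close>. It contains 1, so
  \<open>algebraic_int_if_stable\<close> applies.\<close>

lemma
  fixes x y :: "'a::field_char_0"
  assumes "algebraic_int x" "algebraic_int y"
  shows algebraic_int_add: "algebraic_int (x + y)" and algebraic_int_mult: "algebraic_int (x * y)"
proof -
  obtain m c where m: "m > 0" "x ^ m = (\<Sum>i<m. of_int (c i :: int) * x ^ i)"
    using algebraic_int_power_reduce[OF assms(1)] by metis
  obtain n e where n: "n > 0" "y ^ n = (\<Sum>i<n. of_int (e i :: int) * y ^ i)"
    using algebraic_int_power_reduce[OF assms(2)] by metis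
  define B where "B = {x ^ i * y ^ j | i j. i < m \<and> j < n}"
  have "B = (\<lambda>(i,j). x ^ i * y ^ j) ` ({..<m} \<times> {..<n})" by (auto simp: B_def)
  then have fin: "finite B" by simp
  have one: "1 \<in> B" unfolding B_def using m(1) n(1) by (auto intro!: exI[of _ 0])
  have in_B: "x ^ i * y ^ j \<in> int_span B" if "i < m" "j < n" for i j
    using that by (intro int_span_base[OF fin]) (auto simp: B_def)
  have X: "x * b \<in> int_span B" if b: "b \<in> B" for b
  proof -
    obtain i j where ij: "i < m" "j < n" "b = x ^ i * y ^ j" using b unfolding B_def by blast
    show ?thesis
    proof (cases "Suc i < m")
      case True then show ?thesis using in_B[OF True ij(2)] ij(3) by (simp add: mult.assoc)
    next
      case False
      \<comment> \<open>The exponent overflows only here, and the monic relation for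
        \<open>x\<close> brings it back below \<open>m\<close>.\<close>
      then have "Suc i = m" using ij by simp
      then have "x * b = x ^ m * y ^ j" using ij(3) by (auto simp: mult.assoc)
      also have "\<dots> = (\<Sum>i<m. of_int (c i) * (x ^ i * y ^ j))"
        by (simp add: m(2) sum_distrib_right mult.assoc)
      also have "\<dots> \<in> int_span B" using ij by (auto intro!: int_span_sum int_span_scale in_B)
      finally show ?thesis .
    qed
  qed
  have Y: "y * b \<in> int_span B" if b: "b \<in> B" for b
  proof -
    obtain i j where ij: "i < m" "j < n" "b = x ^ i * y ^ j" using b unfolding B_def by blast
    show ?thesis
    proof (cases "Suc j < n")
      case True then show ?thesis using in_B[OF ij(1) True] ij(3) by (simp add: algebra_simps)
    next
      case False
      then have "Suc j = n" using ij by simp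
      then have "y * b = x ^ i * y ^ n" using ij(3) by (auto simp: algebra_simps)
      also have "\<dots> = (\<Sum>j<n. of_int (e j) * (x ^ i * y ^ j))"
        by (simp add: n(2) sum_distrib_left algebra_simps)
      also have "\<dots> \<in> int_span B" using ij by (auto intro!: int_span_sum int_span_scale in_B)
      finally show ?thesis .
    qed
  qed
  show "algebraic_int (x + y)"
    by (rule algebraic_int_if_stable[OF fin one]) (auto simp: distrib_right intro: int_span_add X Y)
  show "algebraic_int (x * y)"
    by (rule algebraic_int_if_stable[OF fin one])
       (auto simp: mult.assoc intro: int_span_stable[OF X] Y)
qed

lemma algebraic_int_of_int [simp]: "algebraic_int (of_int k :: 'a::field_char_0)"
  by (rule int_imp_algebraic_int) simp

lemma algebraic_int_1 [simp]: "algebraic_int (1 :: 'a::field_char_0)"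
  using algebraic_int_of_int[of 1] by simp

lemma algebraic_int_numeral [simp]: "algebraic_int (numeral k :: 'a::field_char_0)"
  using algebraic_int_of_int[of "numeral k"] by simp

lemma algebraic_int_diff:
  "algebraic_int x \<Longrightarrow> algebraic_int y \<Longrightarrow> algebraic_int (x - y :: 'a::field_char_0)"
  using algebraic_int_add[of x "- y"] by simp

lemma algebraic_int_power: "algebraic_int x \<Longrightarrow> algebraic_int (x ^ n :: 'a::field_char_0)"
  by (induction n) (auto intro: algebraic_int_mult)

lemma algebraic_int_prod:
  "(\<And>i. i \<in> I \<Longrightarrow> algebraic_int (f i)) \<Longrightarrow> algebraic_int (prod f I :: 'a::field_char_0)"
  by (induction I rule: infinite_finite_induct) (auto intro: algebraic_int_mult)

lemma algebraic_int_sum: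
  "(\<And>i. i \<in> I \<Longrightarrow> algebraic_int (f i)) \<Longrightarrow> algebraic_int (sum f I :: 'a::field_char_0)"
  by (induction I rule: infinite_finite_induct) (auto intro: algebraic_int_add)

section \<open>Field embeddings\<close>

lemma
  fixes \<tau> :: "'k::field_char_0 \<Rightarrow> 'l::field_char_0"
  assumes "field_embedding \<tau>"
  shows field_embedding_1: "\<tau> 1 = 1"
    and field_embedding_add: "\<tau> (x + y) = \<tau> x + \<tau> y"
    and field_embedding_mult: "\<tau> (x * y) = \<tau> x * \<tau> y"
    and field_embedding_0: "\<tau> 0 = 0"
    and field_embedding_diff: "\<tau> (x - y) = \<tau> x - \<tau> y"
    and field_embedding_power: "\<tau> (x ^ n) = \<tau> x ^ n"
    and field_embedding_eq_0: "\<tau> x = 0 \<longleftrightarrow> x = 0"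
    and field_embedding_of_int: "\<tau> (of_int k) = of_int k"
    and field_embedding_numeral: "\<tau> (numeral m) = numeral m"
    and field_embedding_of_rat: "\<tau> (of_rat q) = of_rat q"
    and field_embedding_sum: "\<tau> (sum f I) = (\<Sum>i\<in>I. \<tau> (f i))"
proof -
  show 1: "\<tau> 1 = 1" and add: "\<tau> (x + y) = \<tau> x + \<tau> y" and mult: "\<tau> (x * y) = \<tau> x * \<tau> y" for x y
    using assms by (auto simp: field_embedding_def)
  show 0: "\<tau> 0 = 0" using add[of 0 0] by simp
  have um: "\<tau> (- x) = - \<tau> x" for x using add[of x "- x"] 0 by (simp add: eq_neg_iff_add_eq_0 add.commute)
  show diff: "\<tau> (x - y) = \<tau> x - \<tau> y" for x y using add[of x "- y"] um by simp
  show "\<tau> (x ^ n) = \<tau> x ^ n" by (induction n) (auto simp: 1 mult)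
  show z: "\<tau> x = 0 \<longleftrightarrow> x = 0" for x
    using mult[of x "inverse x"] 0 1 by (cases "x = 0") auto
  have of_nat: "\<tau> (of_nat n) = of_nat n" for n by (induction n) (auto simp: 0 1 add)
  show of_int: "\<tau> (of_int k) = of_int k" for k by (cases k) (auto simp: of_nat um add 1 diff)
  show "\<tau> (numeral m) = numeral m" using of_nat[of "numeral m"] by simp
  show "\<tau> (of_rat q) = of_rat q"
  proof -
    obtain a b where q: "q = of_int a / of_int b" "b \<noteq> 0" 
      by (cases q) (auto simp: Fract_of_int_quotient)
    have "\<tau> (of_rat q) * of_int b = \<tau> (of_rat q * of_int b)" by (simp add: mult of_int)
    also have "of_rat q * of_int b = (of_int a :: 'k)" using q by (simp add: of_rat_divide)
    finally have "\<tau> (of_rat q) = of_int a / of_int b" using q(2) by (simp add: of_int field_simps)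
    then show ?thesis by (simp add: q of_rat_divide)
  qed
  show "\<tau> (sum f I) = (\<Sum>i\<in>I. \<tau> (f i))"
    by (induction I rule: infinite_finite_induct) (auto simp: 0 add)
qed

text \<open>Embeddings fix the integers, so they carry roots of an integer polynomial to roots of
  the same polynomial.\<close>

lemma algebraic_int_embedding:
  fixes \<tau> :: "'k::field_char_0 \<Rightarrow> 'l::field_char_0"
  assumes "field_embedding \<tau>" "algebraic_int x"
  shows "algebraic_int (\<tau> x)"
proof -
  obtain p where p: "poly (map_poly of_int p) x = 0" "lead_coeff p = 1"
    using assms algebraic_int_altdef_ipoly by blast
  have "poly (map_poly of_int p) (\<tau> x) = \<tau> (poly (map_poly of_int p) x)"
    by (simp add: poly_altdef coeff_map_poly field_embedding_sum[OF assms(1)]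
        field_embedding_mult[OF assms(1)] field_embedding_power[OF assms(1)] field_embedding_of_int[OF assms(1)])
  then show ?thesis using p field_embedding_0[OF assms(1)] by (subst algebraic_int_altdef_ipoly) auto
qed

section \<open>The number of embeddings of a number field and the integrality of the norm\<close>

interpretation ratvs: vector_space "\<lambda>q (x::'k::field_char_0). of_rat q * x"
  by unfold_locales (simp_all add: of_rat_add of_rat_mult algebra_simps)

text \<open>Complex functions on the field, with pointwise operations: embeddings and rational
  linear functionals are compared as vectors of this space.\<close>

interpretation funvs: vector_space "\<lambda>(c::complex) (f::'k \<Rightarrow> complex) x. c * f x"
  by unfold_locales (simp_all add: fun_eq_iff algebra_simps)

interpretation rat_poly_hom: map_poly_idom_hom "of_rat :: rat \<Rightarrow> 'a::field_char_0" ..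

lemma sum_fun_apply: "(\<Sum>i\<in>I. f i) x = (\<Sum>i\<in>I. f i x)"
  for f :: "'i \<Rightarrow> 'b \<Rightarrow> 'c::comm_monoid_add"
  by (induction I rule: infinite_finite_induct) auto

lemma number_field_basis:
  assumes "number_field TYPE('k::field_char_0)"
  obtains B :: "'k::field_char_0 set" where "finite B" "ratvs.independent B" "ratvs.span B = UNIV"
    "card B = degree_field TYPE('k)"
proof -
  obtain S :: "'k set" where S: "finite S" "ratvs.span S = UNIV"
    using assms unfolding number_field_def by blast
  obtain B :: "'k set" where B: "ratvs.independent B" "UNIV \<subseteq> ratvs.span B" "card B = ratvs.dim (UNIV :: 'k set)"
    using ratvs.basis_exists[of "UNIV :: 'k set"] by metis
  have "finite B" using ratvs.independent_span_bound[OF S(1) B(1)] S(2) by auto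
  then show ?thesis using that B by (auto simp: degree_field_def)
qed

text \<open>These functionals form the complex dual of the field, of dimension the degree. The
  embeddings turn out to be a basis of it, which gives their number.\<close>

definition rat_linear :: "('k::field_char_0 \<Rightarrow> complex) \<Rightarrow> bool" where
  "rat_linear \<phi> \<longleftrightarrow> (\<forall>x y. \<phi> (x + y) = \<phi> x + \<phi> y) \<and> (\<forall>q x. \<phi> (of_rat q * x) = of_rat q * \<phi> x)"

lemma rat_linear_sum: "rat_linear \<phi> \<Longrightarrow> \<phi> (sum f I) = (\<Sum>i\<in>I. \<phi> (f i))"
proof (induction I rule: infinite_finite_induct)
  have "\<phi> 0 = 0" if "rat_linear \<phi>" using that by (metis add_cancel_left_left add_0 rat_linear_def)
  case empty then show ?case using \<open>rat_linear \<phi> \<Longrightarrow> \<phi> 0 = 0\<close> by simp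
next
  have "\<phi> 0 = 0" if "rat_linear \<phi>" using that by (metis add_cancel_left_left add_0 rat_linear_def)
  case (infinite A) then show ?case using \<open>rat_linear \<phi> \<Longrightarrow> \<phi> 0 = 0\<close> by simp
next
  case (insert x F) then show ?case by (simp add: rat_linear_def)
qed

text \<open>A rational polynomial of minimal degree annihilating \<open>w\<close> is coprime to its derivative.\<close>

lemma rat_poly_separable:
  fixes w :: "'k::field_char_0"
  assumes "number_field TYPE('k)"
  obtains F :: "rat poly" where "F \<noteq> 0" "poly (map_poly of_rat F) w = 0"
    "rsquarefree (map_poly of_rat F :: complex poly)"
proof -
  obtain B :: "'k set" where B: "finite B" "ratvs.span B = UNIV"
    using number_field_basis[OF assms] by metis
  define Z where "Z = {f :: rat poly. f \<noteq> 0 \<and> poly (map_poly of_rat f) w = 0}"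
  have "\<exists>f. f \<in> Z"
  \<comment> \<open>Distinct powers are infinitely many vectors in a finite-dimensional space, hence
    dependent. Coinciding powers already give the relation \<open>w ^ i = w ^ j\<close>.\<close>
  proof (cases "inj (\<lambda>i::nat. w ^ i)")
    case True
    then have "infinite (range (\<lambda>i::nat. w ^ i))" using finite_imageD by auto
    then have "ratvs.dependent (range (\<lambda>i::nat. w ^ i))"
      using ratvs.independent_span_bound[OF B(1)] B(2) by auto
    then obtain t u where t: "finite t" "t \<subseteq> range (\<lambda>i::nat. w ^ i)"
      "(\<Sum>v\<in>t. of_rat (u v) * v) = 0" "\<exists>v\<in>t. u v \<noteq> (0::rat)"
      unfolding ratvs.dependent_explicit by blast
    define J where "J = (\<lambda>i::nat. w ^ i) -` t"
    have J: "finite J" using t(1) True unfolding J_def by (rule finite_vimageI)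
    have tJ: "t = (\<lambda>i. w ^ i) ` J" using t(2) by (auto simp: J_def)
    have injJ: "inj_on (\<lambda>i. w ^ i) J" using True by (rule inj_on_subset) simp
    define f where "f = (\<Sum>j\<in>J. monom (u (w ^ j)) j)"
    have cf: "coeff f i = (if i \<in> J then u (w ^ i) else 0)" for i
      using J by (simp add: f_def coeff_sum sum.delta)
    obtain i where i: "i \<in> J" "u (w ^ i) \<noteq> 0" using t(4) tJ by auto
    then have "f \<noteq> 0" using cf[of i] by auto
    moreover have "map_poly of_rat f = (\<Sum>j\<in>J. monom (of_rat (u (w ^ j)) :: 'k) j)"
      using J by (intro poly_eqI) (simp add: coeff_map_poly cf coeff_sum sum.delta)
    then have "poly (map_poly of_rat f) w = (\<Sum>j\<in>J. of_rat (u (w ^ j)) * w ^ j)"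
      by (simp add: poly_sum poly_monom)
    then have "poly (map_poly of_rat f) w = 0"
      using t(3) by (simp add: tJ sum.reindex[OF injJ])
    ultimately show ?thesis by (auto simp: Z_def)
  next
    case False
    then obtain i j :: nat where ij: "i \<noteq> j" "w ^ i = w ^ j" by (auto simp: inj_def)
    define f :: "rat poly" where "f = monom 1 i - monom 1 j"
    have "coeff f i \<noteq> 0" using ij by (simp add: f_def)
    then have "f \<noteq> 0" by auto
    moreover have "map_poly of_rat f = (monom 1 i - monom 1 j :: 'k poly)"
      by (intro poly_eqI) (simp add: coeff_map_poly f_def of_rat_diff)
    then have "poly (map_poly of_rat f) w = 0"
      using ij by (simp add: poly_monom)
    ultimately show ?thesis by (auto simp: Z_def)
  qed
  then obtain f where f: "f \<in> Z" "\<And>g. g \<in> Z \<Longrightarrow> degree f \<le> degree g"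
    using arg_min_nat_lemma[of "\<lambda>f. f \<in> Z" _ degree] by metis
  have f0: "f \<noteq> 0" "poly (map_poly of_rat f) w = 0" using f by (auto simp: Z_def)
  have degf: "degree f > 0"
  proof (rule ccontr)
    assume "\<not> degree f > 0"
    then obtain a where "f = [:a:]" by (auto elim: degree_eq_zeroE)
    then show False using f0 by auto
  qed
  \<comment> \<open>Write \<open>f = g * h\<close>. The factor \<open>g\<close> has smaller degree
    than \<open>f\<close> and so does not vanish at \<open>w\<close>; then \<open>h\<close> does,
    and minimality of \<open>f\<close> leaves no degree for \<open>g\<close>.\<close>
  define g where "g = gcd f (pderiv f)"
  have "pderiv f \<noteq> 0" using degf by (simp add: pderiv_eq_0_iff)
  have "g dvd f" "g dvd pderiv f" by (auto simp: g_def)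
  then obtain h where h: "f = g * h" by (auto elim: dvdE)
  have "degree g \<le> degree (pderiv f)" using \<open>g dvd pderiv f\<close> \<open>pderiv f \<noteq> 0\<close> by (rule dvd_imp_degree_le)
  then have dg: "degree g < degree f" using degf by (simp add: degree_pderiv)
  have "g \<noteq> 0" "h \<noteq> 0" using h f0 by auto
  have "poly (map_poly of_rat g) w \<noteq> 0"
    using f(2)[of g] dg \<open>g \<noteq> 0\<close> by (auto simp: Z_def)
  moreover have "poly (map_poly of_rat g) w * poly (map_poly of_rat h) w = 0"
    using f0(2) by (simp add: h rat_poly_hom.hom_mult)
  ultimately have "h \<in> Z" using \<open>h \<noteq> 0\<close> by (auto simp: Z_def)
  then have "degree f \<le> degree h" using f(2) by blast
  then have "degree g = 0" using h \<open>g \<noteq> 0\<close> \<open>h \<noteq> 0\<close> by (simp add: degree_mult_eq)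
  then have "is_unit g" using \<open>g \<noteq> 0\<close> by (simp add: is_unit_iff_degree)
  then have "coprime f (pderiv f)" unfolding g_def by (simp only: is_unit_gcd)
  \<comment> \<open>A Bezout identity over the rationals persists over the complex numbers and
    excludes common roots of the polynomial and its derivative there.\<close>
  then obtain u v where uv: "u * f + v * pderiv f = 1"
    using bezout_coefficients_fst_snd[of f "pderiv f"] by (metis coprime_imp_gcd_eq_1)
  let ?F = "map_poly of_rat f :: complex poly"
  have "\<not> (poly ?F a = 0 \<and> poly (pderiv ?F) a = 0)" for a
  proof
    assume a: "poly ?F a = 0 \<and> poly (pderiv ?F) a = 0"
    have "map_poly of_rat (u * f + v * pderiv f) = (1 :: complex poly)" by (simp add: uv)
    then have "poly (map_poly of_rat u * ?F + map_poly of_rat v * pderiv ?F) a = 1"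
      by (simp add: rat_poly_hom.hom_add rat_poly_hom.hom_mult of_rat_hom.map_poly_pderiv)
    then show False using a by simp
  qed
  then have "rsquarefree ?F" by (simp add: rsquarefree_roots)
  then show ?thesis using that f0 by blast
qed

text \<open>Diagonalisation of the operator sending \<open>f\<close> to
  \<open>\<lambda>x. f (w * x)\<close> on a function killed by a polynomial with distinct roots.
  Applying the operator minus one root \<open>\<beta>\<close> removes that root; the eigencomponents
  of the result are pulled back to \<open>\<phi>\<close> by dividing by \<open>r - \<beta>\<close>,
  and what remains of \<open>\<phi>\<close> is an eigenfunction for \<open>\<beta>\<close>.\<close>

lemma split_eigenfunctions:
  fixes w :: "'k::field_char_0"
  assumes "finite R" "funvs.subspace S" and T: "\<And>f. f \<in> S \<Longrightarrow> (\<lambda>x. f (w * x)) \<in> S"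
    and "\<phi> \<in> S"
    and "\<And>x. (\<Sum>i\<le>degree (\<Prod>r\<in>R. [:- r, 1:]). coeff (\<Prod>r\<in>R. [:- r, 1:]) i * \<phi> (w ^ i * x)) = 0"
  shows "\<exists>\<psi>. \<phi> = (\<Sum>r\<in>R. \<psi> r) \<and> (\<forall>r\<in>R. \<psi> r \<in> S \<and> (\<forall>x. \<psi> r (w * x) = r * \<psi> r x))"
  using assms(1,4,5)
proof (induction R arbitrary: \<phi> rule: finite_induct)
  case empty
  then have "\<phi> = 0" by (auto simp: fun_eq_iff)
  then show ?case by simp
next
  case (insert \<beta> R)
  note sub = funvs.subspace_add[OF \<open>funvs.subspace S\<close>] funvs.subspace_scale[OF \<open>funvs.subspace S\<close>]
    funvs.subspace_diff[OF \<open>funvs.subspace S\<close>] funvs.subspace_sum[OF \<open>funvs.subspace S\<close>]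
  define P where "P = (\<Prod>r\<in>R. [:- r, 1:])"
  define \<psi> where "\<psi> = (\<lambda>x. \<phi> (w * x)) - (\<lambda>x. \<beta> * \<phi> x)"
  have "\<psi> \<in> S" unfolding \<psi>_def using insert.prems(1) by (intro sub T)
  \<comment> \<open>The product gains the factor \<open>X - \<beta>\<close>; comparing coefficients
    turns the relation for \<open>\<phi>\<close> into the relation for \<open>\<psi>\<close> with
    the shorter product.\<close>
  have Q: "(\<Prod>r\<in>insert \<beta> R. [:- r, 1:]) = pCons 0 P - Polynomial.smult \<beta> P"
    using insert.hyps by (simp add: P_def)
  have P0: "P \<noteq> 0" unfolding P_def using insert.hyps(1) by simp
  have dQ: "degree (pCons 0 P - Polynomial.smult \<beta> P) = Suc (degree P)"
  proof -
    have "degree (\<Prod>r\<in>insert \<beta> R. [:- r, 1:]) = card (insert \<beta> R)" "degree P = card R"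
      unfolding P_def by (simp_all add: degree_prod_sum_eq)
    then show ?thesis unfolding Q using insert.hyps by simp
  qed
  have "(\<Sum>i\<le>degree P. coeff P i * \<psi> (w ^ i * x)) = 0" for x
  proof -
    have "0 = (\<Sum>i\<le>Suc (degree P). (coeff (pCons 0 P) i - \<beta> * coeff P i) * \<phi> (w ^ i * x))"
      using insert.prems(2)[of x] unfolding Q dQ by simp
    also have "\<dots> = (\<Sum>i\<le>Suc (degree P). coeff (pCons 0 P) i * \<phi> (w ^ i * x))
        - (\<Sum>i\<le>Suc (degree P). \<beta> * coeff P i * \<phi> (w ^ i * x))"
      by (simp only: left_diff_distrib sum_subtractf)
    also have "(\<Sum>i\<le>Suc (degree P). coeff (pCons 0 P) i * \<phi> (w ^ i * x)) =
        (\<Sum>i\<le>degree P. coeff P i * \<phi> (w * (w ^ i * x)))"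
      by (subst sum.atMost_Suc_shift) (simp add: mult.assoc)
    also have "(\<Sum>i\<le>Suc (degree P). \<beta> * coeff P i * \<phi> (w ^ i * x)) =
        (\<Sum>i\<le>degree P. \<beta> * coeff P i * \<phi> (w ^ i * x))"
      by (simp add: coeff_eq_0)
    finally show ?thesis by (simp add: \<psi>_def sum_subtractf right_diff_distrib algebra_simps)
  qed
  then obtain \<xi> where \<xi>: "\<psi> = (\<Sum>r\<in>R. \<xi> r)" "\<And>r. r \<in> R \<Longrightarrow> \<xi> r \<in> S"
      "\<And>r x. r \<in> R \<Longrightarrow> \<xi> r (w * x) = r * \<xi> r x"
    using insert.IH[OF \<open>\<psi> \<in> S\<close>] unfolding P_def by blast
  define \<eta> where "\<eta> r = (\<lambda>x. 1 / (r - \<beta>) * \<xi> r x)" for r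
  have \<eta>: "\<eta> r \<in> S" "\<eta> r (w * x) = r * \<eta> r x" "\<eta> r (w * x) - \<beta> * \<eta> r x = \<xi> r x" if "r \<in> R" for r x
  proof -
    have "r - \<beta> \<noteq> 0" using that insert.hyps by auto
    then show "\<eta> r (w * x) - \<beta> * \<eta> r x = \<xi> r x" using \<xi>(3)[OF that] by (simp add: \<eta>_def divide_simps) (simp add: algebra_simps)
    show "\<eta> r \<in> S" unfolding \<eta>_def by (intro sub \<xi> that)
    show "\<eta> r (w * x) = r * \<eta> r x" using \<xi>(3)[OF that] by (simp add: \<eta>_def)
  qed
  define \<theta> where "\<theta> = \<phi> - (\<Sum>r\<in>R. \<eta> r)"
  have "\<theta> \<in> S" unfolding \<theta>_def using insert.prems(1) by (intro sub \<eta>)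
  have \<theta>: "\<theta> (w * x) = \<beta> * \<theta> x" for x
  proof -
    have "\<theta> (w * x) - \<beta> * \<theta> x = \<psi> x - (\<Sum>r\<in>R. \<eta> r (w * x) - \<beta> * \<eta> r x)"
      by (simp add: \<theta>_def \<psi>_def sum_fun_apply sum_subtractf sum_distrib_left algebra_simps)
    also have "(\<Sum>r\<in>R. \<eta> r (w * x) - \<beta> * \<eta> r x) = (\<Sum>r\<in>R. \<xi> r x)" by (intro sum.cong refl \<eta>)
    finally show ?thesis by (simp add: \<xi>(1) sum_fun_apply)
  qed
  have "\<phi> = (\<Sum>r\<in>insert \<beta> R. if r = \<beta> then \<theta> else \<eta> r)"
  proof -
    have "(\<Sum>r\<in>R. if r = \<beta> then \<theta> else \<eta> r) = (\<Sum>r\<in>R. \<eta> r)"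
      using insert.hyps by (intro sum.cong) auto
    then show ?thesis using insert.hyps by (simp add: \<theta>_def)
  qed
  then show ?case using \<open>\<theta> \<in> S\<close> \<theta> \<eta>
    by (intro exI[of _ "\<lambda>r. if r = \<beta> then \<theta> else \<eta> r"]) auto
qed

text \<open>The operators of multiplication by the elements of \<open>W\<close> commute and each is
  diagonalisable because its minimal polynomial is separable. Hence they are simultaneously
  diagonalisable, one element at a time.\<close>

lemma eigenfunctions_span:
  fixes W :: "'k::field_char_0 set"
  assumes nf: "number_field TYPE('k)" and "finite W" "rat_linear \<phi>"
  shows "\<phi> \<in> funvs.span {\<psi>. rat_linear \<psi> \<and> (\<forall>w\<in>W. \<exists>r. \<forall>x. \<psi> (w * x) = r * \<psi> x)}"
  using assms(2,3)
proof (induction W rule: finite_induct)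
  case empty
  then show ?case by (auto intro: funvs.span_base)
next
  case (insert w W)
  let ?X = "\<lambda>W. {\<psi>. rat_linear \<psi> \<and> (\<forall>w\<in>W. \<exists>r. \<forall>x. \<psi> (w * x) = r * \<psi> x)}"
  have "?X W \<subseteq> funvs.span (?X (insert w W))"
  proof
    fix \<phi> assume \<phi>: "\<phi> \<in> ?X W"
    then obtain e where e: "\<And>w x. w \<in> W \<Longrightarrow> \<phi> (w * x) = e w * \<phi> x" by simp metis
    \<comment> \<open>The joint eigenspace for the eigenvalues already fixed. By commutativity it is
      stable under multiplication by \<open>w\<close>, so splitting for \<open>w\<close> keeps the
      earlier eigenvalues.\<close>
    define S where "S = {\<psi>. rat_linear \<psi> \<and> (\<forall>w\<in>W. \<forall>x. \<psi> (w * x) = e w * \<psi> x)}"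
    have "funvs.subspace S"
      unfolding S_def by (rule funvs.subspaceI) (auto simp: rat_linear_def algebra_simps)
    have T: "(\<lambda>x. f (w * x)) \<in> S" if "f \<in> S" for f
      using that by (auto simp: S_def rat_linear_def distrib_left mult.left_commute[of w])
    have "\<phi> \<in> S" using \<phi> e by (simp add: S_def)
    obtain F :: "rat poly" where F: "F \<noteq> 0" "poly (map_poly of_rat F) w = 0"
      "rsquarefree (map_poly of_rat F :: complex poly)"
      using rat_poly_separable[OF nf] by metis
    let ?F = "map_poly of_rat F :: complex poly"
    define R where "R = {z. poly ?F z = 0}"
    have "?F \<noteq> 0" using F(1) by simp
    then have finR: "finite R" unfolding R_def by (rule poly_roots_finite)
    let ?P = "\<Prod>r\<in>R. [:- r, 1:]"
    have FP: "?F = Polynomial.smult (lead_coeff ?F) ?P"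
      using complex_poly_decompose_rsquarefree[OF F(3)] by (simp add: R_def)
    have lF: "lead_coeff ?F \<noteq> 0" using \<open>?F \<noteq> 0\<close> by simp
    have dFP: "degree ?P = degree F"
    proof -
      have "degree ?F = degree ?P" by (subst FP) (use lF in simp)
      then show ?thesis by simp
    qed
    have rl: "rat_linear \<phi>" using \<phi> by simp
    have "(\<Sum>i\<le>degree ?P. coeff ?P i * \<phi> (w ^ i * x)) = 0" for x
    proof -
      have "lead_coeff ?F * (\<Sum>i\<le>degree ?P. coeff ?P i * \<phi> (w ^ i * x)) =
          (\<Sum>i\<le>degree F. coeff (Polynomial.smult (lead_coeff ?F) ?P) i * \<phi> (w ^ i * x))"
        unfolding dFP by (simp add: sum_distrib_left mult.assoc)
      also have "\<dots> = (\<Sum>i\<le>degree F. of_rat (coeff F i) * \<phi> (w ^ i * x))"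
        unfolding FP[symmetric] by (simp add: coeff_map_poly)
      also have "\<dots> = (\<Sum>i\<le>degree F. \<phi> (of_rat (coeff F i) * (w ^ i * x)))"
        using rl by (simp add: rat_linear_def)
      also have "\<dots> = \<phi> (\<Sum>i\<le>degree F. of_rat (coeff F i) * (w ^ i * x))"
        using rat_linear_sum[OF rl, of _ "{..degree F}"] by simp
      also have "(\<Sum>i\<le>degree F. of_rat (coeff F i) * (w ^ i * x)) = poly (map_poly of_rat F) w * x"
        by (simp add: poly_altdef coeff_map_poly sum_distrib_right mult.assoc)
      also have "\<phi> \<dots> = 0" using F(2) rat_linear_sum[OF rl, of id "{}"] by simp
      finally show ?thesis using lF by simp
    qed
    then obtain \<psi> where \<psi>: "\<phi> = (\<Sum>r\<in>R. \<psi> r)" "\<forall>r\<in>R. \<psi> r \<in> S \<and> (\<forall>x. \<psi> r (w * x) = r * \<psi> r x)"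
      using split_eigenfunctions[OF finR \<open>funvs.subspace S\<close> T \<open>\<phi> \<in> S\<close>] by blast
    have "\<psi> r \<in> ?X (insert w W)" if "r \<in> R" for r
      using \<psi>(2) that by (auto simp: S_def)
    then show "\<phi> \<in> funvs.span (?X (insert w W))"
      unfolding \<psi>(1) by (intro funvs.span_sum funvs.span_base)
  qed
  then have "funvs.span (?X W) \<subseteq> funvs.span (?X (insert w W))"
    by (intro funvs.span_minimal funvs.subspace_span)
  then show ?case using insert.IH[OF insert.prems] by (rule subsetD)
qed

text \<open>A functional that is an eigenfunction for multiplication by every basis element is one
  for multiplication by every field element, and after normalisation at 1 it is a ring homomorphism.
  Thus the joint eigenfunctions are the multiples of embeddings.\<close>

lemma rat_linear_span_embeddings:
  assumes nf: "number_field TYPE('k::field_char_0)" and "rat_linear (\<phi> :: 'k \<Rightarrow> complex)"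
  shows "\<phi> \<in> funvs.span {\<tau>. field_embedding \<tau>}"
proof -
  obtain B :: "'k set" where B: "finite B" "ratvs.span B = UNIV"
    using number_field_basis[OF nf] by metis
  have "{\<psi>. rat_linear \<psi> \<and> (\<forall>w\<in>B. \<exists>r. \<forall>x. \<psi> (w * x) = r * \<psi> x)}
      \<subseteq> funvs.span {\<tau> :: 'k \<Rightarrow> complex. field_embedding \<tau>}"
  proof
    fix \<psi> :: "'k \<Rightarrow> complex" assume \<psi>: "\<psi> \<in> {\<psi>. rat_linear \<psi> \<and> (\<forall>w\<in>B. \<exists>r. \<forall>x. \<psi> (w * x) = r * \<psi> x)}"
    then have rl: "rat_linear \<psi>" by simp
    have ex: "\<exists>r. \<forall>x. \<psi> (w * x) = r * \<psi> x" for w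
    proof -
      have w: "w \<in> ratvs.span B" by (simp add: B)
      then show ?thesis
      proof (induction rule: ratvs.span_induct_alt)
        case base
        show ?case using rat_linear_sum[OF rl, of id "{}"] by (auto intro!: exI[of _ 0])
      next
        case (step c b y)
        then obtain r where "\<forall>x. \<psi> (y * x) = r * \<psi> x" by blast
        moreover obtain s where "\<forall>x. \<psi> (b * x) = s * \<psi> x" using \<psi> step(1) by blast
        ultimately have "\<forall>x. \<psi> ((of_rat c * b + y) * x) = (of_rat c * s + r) * \<psi> x"
          using rl by (simp add: rat_linear_def distrib_right mult.assoc)
        then show ?case by blast
      qed
    qed
    show "\<psi> \<in> funvs.span {\<tau>. field_embedding \<tau>}"
    proof (cases "\<psi> 1 = 0")
      case True
      have "\<psi> x = 0" for x using ex[of x] True by (metis mult.right_neutral mult_zero_right)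
      then have "\<psi> = 0" by (simp add: fun_eq_iff)
      then show ?thesis by (simp add: funvs.span_zero)
    next
      case False
      \<comment> \<open>Evaluating the eigenvalue equation at 1 shows that the eigenvalue of
        \<open>w\<close> is \<open>\<psi> w / \<psi> 1\<close>.\<close>
      define \<tau> where "\<tau> x = 1 / \<psi> 1 * \<psi> x" for x
      have mult: "\<psi> (w * x) = \<tau> w * \<psi> x" for w x
      proof -
        obtain r where "\<forall>x. \<psi> (w * x) = r * \<psi> x" using ex by blast
        then have "r = \<tau> w" "\<psi> (w * x) = r * \<psi> x" using False by (simp_all add: \<tau>_def) (metis mult.right_neutral nonzero_mult_div_cancel_right)
        then show ?thesis by simp
      qed
      have "field_embedding \<tau>"
        unfolding field_embedding_def using False rl mult
        by (auto simp: \<tau>_def rat_linear_def add_divide_distrib)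
      moreover have "\<psi> = (\<lambda>x. \<psi> 1 * \<tau> x)" using False by (simp add: \<tau>_def fun_eq_iff)
      ultimately show ?thesis by (metis (mono_tags) funvs.span_base funvs.span_scale mem_Collect_eq)
    qed
  qed
  then have "funvs.span {\<psi>. rat_linear \<psi> \<and> (\<forall>w\<in>B. \<exists>r. \<forall>x. \<psi> (w * x) = r * \<psi> x)}
      \<subseteq> funvs.span {\<tau> :: 'k \<Rightarrow> complex. field_embedding \<tau>}"
    by (intro funvs.span_minimal funvs.subspace_span)
  then show ?thesis using eigenfunctions_span[OF nf B(1) assms(2)] by (rule subsetD)
qed

text \<open>Dedekind's argument: from the relation at \<open>y * x\<close> subtract
  \<open>\<sigma> y\<close> times the relation at \<open>x\<close>. This removes
  \<open>\<sigma>\<close> and multiplies the coefficient of \<open>\<tau>\<close> by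
  \<open>\<tau> y - \<sigma> y\<close>, which is nonzero for a suitable \<open>y\<close>.\<close>

lemma dedekind_independence:
  fixes t :: "('k::field_char_0 \<Rightarrow> complex) set"
  assumes "finite t" "\<And>\<tau>. \<tau> \<in> t \<Longrightarrow> field_embedding \<tau>" "\<And>x. (\<Sum>\<tau>\<in>t. u \<tau> * \<tau> x) = 0" "\<tau> \<in> t"
  shows "u \<tau> = 0"
  using assms
proof (induction t arbitrary: u \<tau> rule: finite_induct)
  case empty then show ?case by simp
next
  case (insert \<sigma> t)
  have emb: "field_embedding \<tau>" if "\<tau> \<in> insert \<sigma> t" for \<tau> using that insert.prems by blast
  have rel: "u \<sigma> * \<sigma> x + (\<Sum>\<tau>\<in>t. u \<tau> * \<tau> x) = 0" for x
    using insert.prems(2)[of x] insert.hyps by simp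
  have ut: "u \<tau> = 0" if t: "\<tau> \<in> t" for \<tau>
  proof -
    have "\<tau> \<noteq> \<sigma>" using t insert.hyps by blast
    then obtain y where y: "\<tau> y \<noteq> \<sigma> y" by (meson ext)
    have "(\<Sum>\<tau>\<in>t. (u \<tau> * (\<tau> y - \<sigma> y)) * \<tau> x) = 0" for x
    proof -
      have "(\<Sum>\<tau>\<in>t. (u \<tau> * (\<tau> y - \<sigma> y)) * \<tau> x) = (\<Sum>\<tau>\<in>t. u \<tau> * \<tau> (y * x)) - \<sigma> y * (\<Sum>\<tau>\<in>t. u \<tau> * \<tau> x)"
        using emb by (simp add: sum_distrib_left sum_subtractf[symmetric] field_embedding_mult algebra_simps)
      also have "\<dots> = - (u \<sigma> * \<sigma> (y * x)) + \<sigma> y * (u \<sigma> * \<sigma> x)"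
        using rel[of "y * x"] rel[of x] by (simp add: eq_neg_iff_add_eq_0[symmetric] add.commute)
      also have "\<dots> = 0" using emb by (simp add: field_embedding_mult algebra_simps)
      finally show ?thesis .
    qed
    then have "u \<tau> * (\<tau> y - \<sigma> y) = 0"
      using insert.IH[of "\<lambda>\<tau>. u \<tau> * (\<tau> y - \<sigma> y)" \<tau>] emb t by blast
    then show ?thesis using y by simp
  qed
  moreover have "u \<sigma> = 0" using rel[of 1] ut emb by (simp add: field_embedding_1)
  ultimately show ?case using insert.prems by blast
qed

lemma embeddings_independent:
  "funvs.independent {\<tau> :: 'k::field_char_0 \<Rightarrow> complex. field_embedding \<tau>}"
proof
  assume "funvs.dependent {\<tau> :: 'k \<Rightarrow> complex. field_embedding \<tau>}"
  then obtain t u where t: "finite t" "t \<subseteq> {\<tau> :: 'k \<Rightarrow> complex. field_embedding \<tau>}"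
    "(\<Sum>v\<in>t. (\<lambda>x. u v * v x)) = 0" "\<exists>v\<in>t. u v \<noteq> 0"
    unfolding funvs.dependent_explicit by blast
  have "(\<Sum>v\<in>t. u v * v x) = 0" for x
    using fun_cong[OF t(3), of x] by (simp add: sum_fun_apply)
  then show False using dedekind_independence[OF t(1)] t(2,4) by blast
qed

text \<open>Two independent families that span each other. The embeddings lie in the span of the
  coordinate functionals of a basis; conversely the coordinate functionals are rational linear and
  so lie in the span of the embeddings.\<close>

lemma card_embeddings:
  assumes nf: "number_field TYPE('k::field_char_0)"
  shows "finite {\<tau> :: 'k \<Rightarrow> complex. field_embedding \<tau>}"
    and "card {\<tau> :: 'k \<Rightarrow> complex. field_embedding \<tau>} = degree_field TYPE('k)"
proof -
  let ?E = "{\<tau> :: 'k \<Rightarrow> complex. field_embedding \<tau>}"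
  obtain B :: "'k set" where B: "finite B" "ratvs.independent B" "ratvs.span B = UNIV"
    "card B = degree_field TYPE('k)"
    using number_field_basis[OF nf] by metis
  define co where "co b = (\<lambda>x. of_rat (ratvs.representation B x b) :: complex)" for b
  have rl: "rat_linear (co b)" for b
    using B(2,3) by (simp add: rat_linear_def co_def ratvs.representation_add ratvs.representation_scale
        of_rat_add of_rat_mult)
  have dual: "co b b' = (if b = b' then 1 else 0)" if "b' \<in> B" for b b'
    using that B(2) by (auto simp: co_def ratvs.representation_basis)
  have inj: "inj_on co B"
    by (rule inj_onI) (metis dual zero_neq_one)
  have "?E \<subseteq> funvs.span (co ` B)"
  proof
    fix \<tau> :: "'k \<Rightarrow> complex" assume "\<tau> \<in> ?E"
    then have \<tau>: "field_embedding \<tau>" by simp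
    have eq: "\<tau> x = (\<Sum>b\<in>B. \<tau> b * co b x)" for x
    proof -
      have "x = (\<Sum>b\<in>B. of_rat (ratvs.representation B x b) * b)"
        using ratvs.sum_representation_eq[OF B(2), of x B] B(1,3) by simp
      then have "\<tau> x = \<tau> (\<Sum>b\<in>B. of_rat (ratvs.representation B x b) * b)" by (rule arg_cong)
      then show ?thesis using \<tau>
        by (simp add: field_embedding_sum field_embedding_mult field_embedding_of_rat co_def mult.commute)
    qed
    have "\<tau> = (\<Sum>b\<in>B. (\<lambda>x. \<tau> b * co b x))"
      by (rule ext) (unfold sum_fun_apply, rule eq)
    also have "\<dots> \<in> funvs.span (co ` B)"
      by (intro funvs.span_sum funvs.span_scale funvs.span_base imageI)
    finally show "\<tau> \<in> funvs.span (co ` B)" .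
  qed
  then have 1: "finite ?E \<and> card ?E \<le> card (co ` B)"
    using B(1) by (intro funvs.independent_span_bound embeddings_independent) auto
  have "funvs.independent (co ` B)"
  proof
    assume "funvs.dependent (co ` B)"
    then obtain u where u: "(\<Sum>v\<in>co ` B. (\<lambda>x. u v * v x)) = 0" "\<exists>v\<in>co ` B. u v \<noteq> 0"
      unfolding funvs.dependent_finite[OF finite_imageI[OF B(1)]] by blast
    have "u (co b) = 0" if "b \<in> B" for b
    proof -
      have "0 = (\<Sum>b'\<in>B. u (co b') * co b' b)"
        using fun_cong[OF u(1), of b] by (simp add: sum_fun_apply sum.reindex[OF inj])
      also have "\<dots> = (\<Sum>b'\<in>B. if b' = b then u (co b') else 0)"
        using that by (intro sum.cong) (auto simp: dual)
      finally show ?thesis using that B(1) by simp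
    qed
    then show False using u(2) by auto
  qed
  then have "card (co ` B) \<le> card ?E"
    using rl rat_linear_span_embeddings[OF nf] 1
    by (intro conjunct2[OF funvs.independent_span_bound]) auto
  then show "finite ?E" "card ?E = degree_field TYPE('k)" using 1 B(4) card_image[OF inj] by auto
qed

text \<open>The product is the determinant of multiplication by \<open>w\<close>. With
  \<open>M\<close> the rational matrix of that multiplication and \<open>T\<close> the values of the
  embeddings on the basis, \<open>M * T = T * D\<close> for the diagonal matrix \<open>D\<close> of
  conjugates, and \<open>T\<close> is invertible.\<close>

lemma prod_embeddings_rational:
  fixes w :: "'k::field_char_0"
  assumes nf: "number_field TYPE('k)"
  shows "(\<Prod>\<tau>\<in>{\<tau> :: 'k \<Rightarrow> complex. field_embedding \<tau>}. \<tau> w) \<in> \<rat>"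
proof -
  let ?E = "{\<tau> :: 'k \<Rightarrow> complex. field_embedding \<tau>}"
  define d where "d = degree_field TYPE('k)"
  obtain B :: "'k set" where B: "finite B" "ratvs.independent B" "ratvs.span B = UNIV" "card B = d"
    using number_field_basis[OF nf] d_def by metis
  obtain b where b: "bij_betw b {0..<d} B" using ex_bij_betw_nat_finite[OF B(1)] B(4) by blast
  obtain e where e: "bij_betw e {0..<d} ?E"
    using ex_bij_betw_nat_finite[OF card_embeddings(1)[OF nf]] card_embeddings(2)[OF nf] d_def by metis
  have emb: "field_embedding (e i)" if "i < d" for i using e that by (auto simp: bij_betw_def)
  define M' :: "rat mat" where "M' = mat d d (\<lambda>(j,k). ratvs.representation B (w * b j) (b k))"
  define M :: "complex mat" where "M = map_mat of_rat M'"
  define T :: "complex mat" where "T = mat d d (\<lambda>(j,i). e i (b j))"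
  define D :: "complex mat" where "D = mat d d (\<lambda>(i,j). if i = j then e i w else 0)"
  have car: "M' \<in> carrier_mat d d" "M \<in> carrier_mat d d" "T \<in> carrier_mat d d" "D \<in> carrier_mat d d"
    by (auto simp: M'_def M_def T_def D_def)
  have expand: "e i x = (\<Sum>k = 0..<d. of_rat (ratvs.representation B x (b k)) * e i (b k))" if "i < d" for i x
  proof -
    have "x = (\<Sum>v\<in>B. of_rat (ratvs.representation B x v) * v)"
      using ratvs.sum_representation_eq[OF B(2), of x B] B(1,3) by simp
    also have "\<dots> = (\<Sum>k = 0..<d. of_rat (ratvs.representation B x (b k)) * b k)"
      using sum.reindex_bij_betw[OF b, of "\<lambda>v. of_rat (ratvs.representation B x v) * v"] by simp
    finally have "e i x = e i (\<Sum>k = 0..<d. of_rat (ratvs.representation B x (b k)) * b k)" by (rule arg_cong)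
    then show ?thesis using emb[OF that]
      by (simp add: field_embedding_sum field_embedding_mult field_embedding_of_rat)
  qed
  have "M * T = T * D"
  proof (rule eq_matI)
    fix j i assume "j < dim_row (T * D)" "i < dim_col (T * D)"
    then have ij: "j < d" "i < d" by (simp_all add: T_def D_def)
    have "(M * T) $$ (j, i) = (\<Sum>k = 0..<d. of_rat (ratvs.representation B (w * b j) (b k)) * e i (b k))"
      using ij by (simp add: M_def M'_def T_def scalar_prod_def)
    also have "\<dots> = e i (w * b j)" using expand[OF ij(2), of "w * b j"] by simp
    also have "\<dots> = e i (b j) * e i w" using emb[OF ij(2)] by (simp add: field_embedding_mult)
    also have "\<dots> = (\<Sum>k = 0..<d. if k = i then e k (b j) * e k w else 0)" using ij by (simp add: sum.delta)
    also have "\<dots> = (\<Sum>k = 0..<d. e k (b j) * (if k = i then e k w else 0))" by (intro sum.cong) auto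
    also have "\<dots> = (T * D) $$ (j, i)"
      using ij by (simp add: T_def D_def scalar_prod_def)
    finally show "(M * T) $$ (j, i) = (T * D) $$ (j, i)" .
  qed (auto simp: M_def M'_def T_def D_def)
  then have "det M * det T = det T * det D"
    using car by (metis det_mult)
  \<comment> \<open>A kernel vector is a linear relation between the embeddings on the basis. By
    linearity it holds on the whole field, against Dedekind independence.\<close>
  moreover have "det T \<noteq> 0"
  proof
    assume "det T = 0"
    then obtain v where v: "v \<in> carrier_vec d" "v \<noteq> 0\<^sub>v d" "T *\<^sub>v v = 0\<^sub>v d"
      using det_0_iff_vec_prod_zero[OF car(3)] by blast
    define u where "u \<tau> = v $ (the_inv_into {0..<d} e \<tau>)" for \<tau>
    have u: "u (e i) = v $ i" if "i < d" for i
      using e that by (simp add: u_def bij_betw_def the_inv_into_f_f)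
    have on_basis: "(\<Sum>i = 0..<d. v $ i * e i (b j)) = 0" if "j < d" for j
    proof -
      have "(T *\<^sub>v v) $ j = 0" using v(3) that by simp
      then show ?thesis using that v(1) by (simp add: T_def scalar_prod_def mult.commute)
    qed
    have "(\<Sum>\<tau>\<in>?E. u \<tau> * \<tau> x) = 0" for x
    proof -
      have "(\<Sum>\<tau>\<in>?E. u \<tau> * \<tau> x) = (\<Sum>i = 0..<d. u (e i) * e i x)"
        using sum.reindex_bij_betw[OF e, of "\<lambda>\<tau>. u \<tau> * \<tau> x"] by simp
      also have "\<dots> = (\<Sum>i = 0..<d. \<Sum>k = 0..<d. of_rat (ratvs.representation B x (b k)) * (v $ i * e i (b k)))"
        by (intro sum.cong refl) (subst expand, auto simp: u sum_distrib_left algebra_simps)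
      also have "\<dots> = (\<Sum>k = 0..<d. of_rat (ratvs.representation B x (b k)) * (\<Sum>i = 0..<d. v $ i * e i (b k)))"
        by (subst sum.swap) (simp add: sum_distrib_left)
      also have "\<dots> = 0" by (simp add: on_basis)
      finally show ?thesis .
    qed
    then have "u \<tau> = 0" if "\<tau> \<in> ?E" for \<tau>
      using dedekind_independence[OF card_embeddings(1)[OF nf], of u \<tau>] that by blast
    then have "v $ i = 0" if "i < d" for i using u[OF that] emb[OF that] by simp
    then have "v = 0\<^sub>v d" using v(1) by (intro eq_vecI) auto
    then show False using v(2) by simp
  qed
  ultimately have "det M = det D" by simp
  also have "det D = (\<Prod>i = 0..<d. e i w)"
    by (subst det_upper_triangular[OF _ car(4)]) (auto simp: D_def prod_list_diag_prod)
  also have "\<dots> = (\<Prod>\<tau>\<in>?E. \<tau> w)" using prod.reindex_bij_betw[OF e, of "\<lambda>\<tau>. \<tau> w"] by simp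
  finally have "of_rat (det M') = (\<Prod>\<tau>\<in>?E. \<tau> w)" by (simp add: M_def of_rat_hom.hom_det)
  then show ?thesis by (metis Rats_of_rat)
qed

lemma totally_real_embeddings_bij:
  assumes "totally_real TYPE('k::field_char_0)"
  shows "bij_betw (\<lambda>\<tau> x. complex_of_real (\<tau> x)) {\<tau> :: 'k \<Rightarrow> real. field_embedding \<tau>}
    {\<tau> :: 'k \<Rightarrow> complex. field_embedding \<tau>}"
proof (rule bij_betwI[where g = "\<lambda>\<tau> x. Re (\<tau> x)"])
  show "(\<lambda>\<tau> x. complex_of_real (\<tau> x)) \<in> {\<tau> :: 'k \<Rightarrow> real. field_embedding \<tau>} \<rightarrow> {\<tau>. field_embedding \<tau>}"
    by (auto simp: field_embedding_def)
  have real: "complex_of_real (Re (\<tau> x)) = \<tau> x" if "field_embedding \<tau>" for \<tau> :: "'k \<Rightarrow> complex" and x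
    using assms that unfolding totally_real_def by (meson of_real_Re range_subsetD)
  show "(\<lambda>\<tau> x. Re (\<tau> x)) \<in> {\<tau> :: 'k \<Rightarrow> complex. field_embedding \<tau>} \<rightarrow> {\<tau>. field_embedding \<tau>}"
  proof (intro Pi_I CollectI)
    fix \<tau> :: "'k \<Rightarrow> complex" assume "\<tau> \<in> {\<tau>. field_embedding \<tau>}"
    then have \<tau>: "field_embedding \<tau>" by simp
    have "Re (\<tau> (x * y)) = Re (\<tau> x) * Re (\<tau> y)" for x y
    proof -
      have "complex_of_real (Re (\<tau> (x * y))) = complex_of_real (Re (\<tau> x)) * complex_of_real (Re (\<tau> y))"
        unfolding real[OF \<tau>] using \<tau> by (rule field_embedding_mult)
      then show ?thesis by (metis of_real_eq_iff of_real_mult)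
    qed
    then show "field_embedding (\<lambda>x. Re (\<tau> x))"
      using \<tau> by (simp add: field_embedding_def)
  qed
  show "(\<lambda>x. complex_of_real (Re (\<tau> x))) = \<tau>" if "\<tau> \<in> {\<tau> :: 'k \<Rightarrow> complex. field_embedding \<tau>}" for \<tau>
    using that real by auto
qed auto

text \<open>Under a totally real hypothesis the complex embeddings are the real ones. The norm is
  both rational and an algebraic integer, hence an ordinary integer, and it is nonzero because
  embeddings are injective.\<close>

lemma
  assumes nf: "number_field TYPE('k::field_char_0)" and tr: "totally_real TYPE('k)"
  shows finite_real_embeddings: "finite {\<tau> :: 'k \<Rightarrow> real. field_embedding \<tau>}"
    and card_real_embeddings: "card {\<tau> :: 'k \<Rightarrow> real. field_embedding \<tau>} = degree_field TYPE('k)"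
    and norm_algebraic_int_ge_1:
      "algebraic_int w \<Longrightarrow> w \<noteq> 0 \<Longrightarrow> 1 \<le> (\<Prod>\<tau>\<in>{\<tau> :: 'k \<Rightarrow> real. field_embedding \<tau>}. \<bar>\<tau> w\<bar>)"
proof -
  let ?R = "{\<tau> :: 'k \<Rightarrow> real. field_embedding \<tau>}" and ?E = "{\<tau> :: 'k \<Rightarrow> complex. field_embedding \<tau>}"
  note bij = totally_real_embeddings_bij[OF tr]
  show fin: "finite ?R" using bij_betw_finite[OF bij] card_embeddings(1)[OF nf] by simp
  show "card ?R = degree_field TYPE('k)" using bij_betw_same_card[OF bij] card_embeddings(2)[OF nf] by simp
  assume w: "algebraic_int w" "w \<noteq> 0"
  have eq: "(\<Prod>\<tau>\<in>?E. \<tau> w) = complex_of_real (\<Prod>\<tau>\<in>?R. \<tau> w)"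
    using prod.reindex_bij_betw[OF bij, of "\<lambda>\<tau>. \<tau> w"] by simp
  have "algebraic_int (\<Prod>\<tau>\<in>?E. \<tau> w)"
    by (rule algebraic_int_prod, rule algebraic_int_embedding[OF _ w(1)]) simp
  then have "(\<Prod>\<tau>\<in>?E. \<tau> w) \<in> \<int>"
    using prod_embeddings_rational[OF nf] by (rule rational_algebraic_int_is_int)
  then obtain k :: int where "complex_of_real (\<Prod>\<tau>\<in>?R. \<tau> w) = of_int k" unfolding eq by (auto elim: Ints_cases)
  then have k: "(\<Prod>\<tau>\<in>?R. \<tau> w) = of_int k" by (metis of_real_eq_iff of_real_of_int_eq)
  have "(\<Prod>\<tau>\<in>?R. \<tau> w) \<noteq> 0" using fin w(2) by (auto simp: field_embedding_eq_0)
  then have "1 \<le> \<bar>k\<bar>" using k by auto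
  then have "1 \<le> \<bar>of_int k :: real\<bar>" by linarith
  then show "1 \<le> (\<Prod>\<tau>\<in>?R. \<bar>\<tau> w\<bar>)" by (simp add: k[symmetric] abs_prod)
qed

section \<open>Residues of algebraic integers\<close>

text \<open>Linear independence over the field with three elements of the classes of
  \<open>X\<close> modulo 3 times the ring of integers, expressed with integer lifts of the
  coefficients.\<close>

definition indep3 :: "'k::field_char_0 set \<Rightarrow> bool" where
  "indep3 X \<longleftrightarrow> finite X \<and> (\<forall>x\<in>X. algebraic_int x) \<and>
     (\<forall>c z. algebraic_int z \<and> (\<Sum>x\<in>X. of_int (c x) * x) = 3 * z \<longrightarrow> (\<forall>x\<in>X. (3::int) dvd c x))"

lemma common_denominator:
  assumes "finite t"
  shows "\<exists>N>0. \<exists>k::'a \<Rightarrow> int. \<forall>v\<in>t. of_int N * u v = (of_int (k v) :: rat)"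
  using assms
proof (induction t rule: finite_induct)
  case empty show ?case by (auto intro!: exI[of _ 1])
next
  case (insert x t)
  then obtain N k where N: "N > 0" "\<And>v. v \<in> t \<Longrightarrow> of_int N * u v = of_int (k v :: int)" by blast
  obtain p q where q: "u x = of_int p / of_int q" "q > 0"
    by (cases "u x") (auto simp: Fract_of_int_quotient)
  have "\<forall>v\<in>insert x t. of_int (N * q) * u v = of_int (if v = x then N * p else k v * q)"
  proof
    fix v assume v: "v \<in> insert x t"
    show "of_int (N * q) * u v = of_int (if v = x then N * p else k v * q)"
    proof (cases "v = x")
      case True then show ?thesis using q by simp
    next
      case False
      then have "of_int N * u v = of_int (k v)" using v N(2) by simp
      then show ?thesis using False by (simp add: algebra_simps)
    qed
  qed
  then show ?case using mult_pos_pos[OF N(1) q(2)]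
    by (intro exI[of _ "N * q"] conjI exI[of _ "\<lambda>v. if v = x then N * p else k v * q"])
qed

text \<open>Descent: an integral relation forces all its coefficients to be divisible by 3, and
  dividing by 3 gives another one with smaller sum of absolute values. This bounds the dimension
  modulo 3 by the degree of the field.\<close>

lemma indep3_independent:
  assumes "indep3 X"
  shows "ratvs.independent X"
proof
  have fin: "finite X" using assms by (simp add: indep3_def)
  assume "ratvs.dependent X"
  then obtain u where u: "(\<Sum>v\<in>X. of_rat (u v) * v) = 0" "\<exists>v\<in>X. u v \<noteq> 0"
    unfolding ratvs.dependent_finite[OF fin] by blast
  obtain N and k :: "'a \<Rightarrow> int" where N: "N > 0" "\<And>v. v \<in> X \<Longrightarrow> of_int N * u v = of_int (k v)"
    using common_denominator[OF fin] by blast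
  define rel where "rel c \<longleftrightarrow> (\<Sum>v\<in>X. of_int (c v) * v) = 0 \<and> (\<exists>v\<in>X. c v \<noteq> 0)" for c :: "'a \<Rightarrow> int"
  have "rel k"
  proof -
    have "(\<Sum>v\<in>X. of_int (k v) * v) = (\<Sum>v\<in>X. of_rat (of_int N * u v) * v)" by (simp add: N)
    also have "\<dots> = of_int N * (\<Sum>v\<in>X. of_rat (u v) * v)"
      by (simp add: of_rat_mult sum_distrib_left mult.assoc)
    finally have "(\<Sum>v\<in>X. of_int (k v) * v) = 0" using u(1) by simp
    moreover obtain v where v: "v \<in> X" "u v \<noteq> 0" using u(2) by blast
    then have "k v \<noteq> 0" using N(1) N(2)[of v] by auto
    ultimately show ?thesis using v by (auto simp: rel_def)
  qed
  then obtain c where c: "rel c" "\<And>c'. rel c' \<Longrightarrow> nat (\<Sum>v\<in>X. \<bar>c v\<bar>) \<le> nat (\<Sum>v\<in>X. \<bar>c' v\<bar>)"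
    using arg_min_nat_lemma[of rel k "\<lambda>c. nat (\<Sum>v\<in>X. \<bar>c v\<bar>)"] by blast
  \<comment> \<open>The relation is the instance \<open>z = 0\<close> of the defining
    condition.\<close>
  have "\<forall>v\<in>X. 3 dvd c v"
    using assms c(1) unfolding indep3_def rel_def
    by (metis algebraic_int_0 mult_zero_right)
  then have c3: "c v = 3 * (c v div 3)" if "v \<in> X" for v using that by simp
  have "(\<Sum>v\<in>X. of_int (c v) * v) = 3 * (\<Sum>v\<in>X. of_int (c v div 3) * v)"
    unfolding sum_distrib_left
  proof (rule sum.cong)
    fix v assume "v \<in> X"
    then show "of_int (c v) * v = 3 * (of_int (c v div 3) * v)"
      by (subst c3) (simp_all only: of_int_mult of_int_numeral mult.assoc)
  qed simp
  then have "(\<Sum>v\<in>X. of_int (c v div 3) * v) = 0" using c(1) by (simp add: rel_def)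
  moreover obtain v0 where v0: "v0 \<in> X" "c v0 \<noteq> 0" using c(1) by (auto simp: rel_def)
  then have "c v0 div 3 \<noteq> 0" using c3[OF v0(1)] by auto
  ultimately have "rel (\<lambda>v. c v div 3)" using v0(1) by (auto simp: rel_def)
  then have "nat (\<Sum>v\<in>X. \<bar>c v\<bar>) \<le> nat (\<Sum>v\<in>X. \<bar>c v div 3\<bar>)" by (rule c(2))
  moreover have "(\<Sum>v\<in>X. \<bar>c v div 3\<bar>) < (\<Sum>v\<in>X. \<bar>c v\<bar>)"
  proof (rule sum_strict_mono_ex1[OF fin])
    show "\<forall>v\<in>X. \<bar>c v div 3\<bar> \<le> \<bar>c v\<bar>" by auto
    have "\<bar>c v0 div 3\<bar> < \<bar>c v0\<bar>" using c3[OF v0(1)] v0(2) by linarith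
    then show "\<exists>v\<in>X. \<bar>c v div 3\<bar> < \<bar>c v\<bar>" using v0(1) by blast
  qed
  moreover have "0 \<le> (\<Sum>v\<in>X. \<bar>c v div 3\<bar>)" by (simp add: sum_nonneg)
  ultimately show False by linarith
qed

lemma indep3_maximal:
  assumes nf: "number_field TYPE('k::field_char_0)"
  obtains X :: "'k::field_char_0 set" where "indep3 X" "card X \<le> degree_field TYPE('k)"
    "\<And>Y :: 'k set. indep3 Y \<Longrightarrow> card Y \<le> card X"
proof -
  obtain B :: "'k set" where B: "finite B" "ratvs.span B = UNIV" "card B = degree_field TYPE('k)"
    using number_field_basis[OF nf] by metis
  have bound: "card X \<le> degree_field TYPE('k)" if "indep3 X" for X :: "'k set"
    using ratvs.independent_span_bound[OF B(1) indep3_independent[OF that]] B(2,3) by auto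
  have "indep3 ({} :: 'k set)" by (simp add: indep3_def)
  then obtain X :: "'k set" where "indep3 X" "\<forall>Y :: 'k set. indep3 Y \<longrightarrow> card Y \<le> card X"
    using ex_has_greatest_nat[of indep3 "{} :: 'k set" card "Suc (degree_field TYPE('k))"] bound
    by (auto simp: less_Suc_eq_le)
  then show ?thesis using that bound by blast
qed

text \<open>Adding \<open>x\<close> to a maximal independent set creates a relation modulo 3. Its
  coefficient at \<open>x\<close> is not divisible by 3, since otherwise it would be a relation
  inside \<open>X\<close>, so the relation can be solved for \<open>x\<close>.\<close>

lemma indep3_maximal_generates:
  fixes x :: "'k::field_char_0"
  assumes X: "indep3 X" and max: "\<And>Y :: 'k set. indep3 Y \<Longrightarrow> card Y \<le> card X" and x: "algebraic_int x"
  shows "\<exists>c z. algebraic_int z \<and> x = (\<Sum>v\<in>X. of_int (c v :: int) * v) + 3 * z"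
proof (cases "x \<in> X")
  case True
  have "(\<Sum>v\<in>X. of_int (if v = x then 1 else 0) * v) = (\<Sum>v\<in>X. if v = x then v else 0)"
    by (rule sum.cong) auto
  also have "\<dots> = x" using True X by (simp add: indep3_def sum.delta)
  finally have "x = (\<Sum>v\<in>X. of_int (if v = x then 1 else 0) * v) + 3 * 0" by simp
  then show ?thesis by (intro exI[of _ "\<lambda>v. if v = x then 1 else 0"] exI[of _ 0]) simp
next
  case False
  have fin: "finite X" and XO: "\<And>v. v \<in> X \<Longrightarrow> algebraic_int v" using X by (auto simp: indep3_def)
  have "card (insert x X) = Suc (card X)" using False fin by simp
  then have "\<not> indep3 (insert x X)" using max[of "insert x X"] by auto
  then obtain c :: "'k \<Rightarrow> int" and z v where c: "algebraic_int z"
      "of_int (c x) * x + (\<Sum>v\<in>X. of_int (c v) * v) = 3 * z" "v \<in> insert x X" "\<not> 3 dvd c v"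
    using x fin False XO unfolding indep3_def by (auto simp del: of_int_0)
  have "\<not> 3 dvd c x"
  proof
    assume "3 dvd c x"
    then obtain m where m: "c x = 3 * m" by (elim dvdE)
    have "(\<Sum>v\<in>X. of_int (c v) * v) = 3 * (z - of_int m * x)"
      using c(2) by (simp add: m algebra_simps eq_diff_eq)
    moreover have "algebraic_int (z - of_int m * x)"
      using c(1) x by (intro algebraic_int_diff algebraic_int_mult algebraic_int_of_int)
    ultimately have "\<forall>v\<in>X. 3 dvd c v" using X unfolding indep3_def by blast
    then show False using c(3,4) \<open>3 dvd c x\<close> by auto
  qed
  \<comment> \<open>The number \<open>e\<close>, which is 1 or -1, inverts \<open>c x\<close> modulo
    3.\<close>
  then obtain e m where e: "e * c x = 1 + 3 * (m :: int)"
  proof -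
    have "c x mod 3 = 1 \<or> c x mod 3 = 2" using \<open>\<not> 3 dvd c x\<close> by presburger
    then show ?thesis
    proof
      assume "c x mod 3 = 1"
      then have "1 * c x = 1 + 3 * (c x div 3)" by presburger
      then show ?thesis by (rule that)
    next
      assume "c x mod 3 = 2"
      then have "(-1) * c x = 1 + 3 * (- (c x div 3) - 1)" by presburger
      then show ?thesis by (rule that)
    qed
  qed
  have "x = (\<Sum>v\<in>X. of_int (- e * c v) * v) + 3 * (of_int e * z - of_int m * x)"
  proof -
    have "of_int e * (of_int (c x) * x + (\<Sum>v\<in>X. of_int (c v) * v)) = of_int e * (3 * z)"
      by (rule arg_cong[OF c(2)])
    moreover have "of_int e * (of_int (c x) * x) = x + 3 * of_int m * x"
    proof -
      have "of_int e * (of_int (c x) * x) = of_int (e * c x) * x" by (simp add: mult.assoc)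
      also have "\<dots> = x + 3 * of_int m * x" unfolding e by (simp add: algebra_simps)
      finally show ?thesis .
    qed
    moreover have "(\<Sum>v\<in>X. of_int (- e * c v) * v) = - (of_int e * (\<Sum>v\<in>X. of_int (c v) * v))"
      by (simp add: sum_distrib_left sum_negf mult.assoc)
    ultimately show ?thesis by (simp add: algebra_simps)
  qed
  moreover have "algebraic_int (of_int e * z - of_int m * x)"
    using c(1) x by (intro algebraic_int_diff algebraic_int_mult algebraic_int_of_int)
  ultimately show ?thesis
    by (intro exI[of _ "\<lambda>v. - e * c v"] exI[of _ "of_int e * z - of_int m * x"] conjI)
qed

text \<open>Iterating generation modulo 3 expands every integer to 3-adic precision \<open>n\<close>
  with coefficients over \<open>X\<close>, and these coefficients matter only modulo
  \<open>3 ^ n\<close>. An upper bound on the number of classes is what the index estimate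
  consumes.\<close>

lemma residues_mod_power3:
  assumes nf: "number_field TYPE('k::field_char_0)"
  obtains T :: "'k::field_char_0 set" where "finite T" "card T \<le> 3 ^ (n * degree_field TYPE('k))"
    "\<And>x. algebraic_int x \<Longrightarrow> \<exists>t\<in>T. \<exists>y. algebraic_int y \<and> x - t = 3 ^ n * y"
proof -
  obtain X :: "'k set" where X: "indep3 X" "card X \<le> degree_field TYPE('k)"
    "\<And>Y :: 'k set. indep3 Y \<Longrightarrow> card Y \<le> card X"
    using indep3_maximal[OF nf] by blast
  have fin: "finite X" and XO: "\<And>v. v \<in> X \<Longrightarrow> algebraic_int v" using X by (auto simp: indep3_def)
  have gen: "\<exists>c z. algebraic_int z \<and> x = (\<Sum>v\<in>X. of_int (c v :: int) * v) + 3 ^ n * z"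
    if "algebraic_int x" for x n using that
  proof (induction n)
    case 0 then show ?case by (intro exI[of _ "\<lambda>_. 0"] exI[of _ x]) simp
  next
    case (Suc n)
    then obtain c z where c: "algebraic_int z" "x = (\<Sum>v\<in>X. of_int (c v :: int) * v) + 3 ^ n * z" by blast
    obtain c' z' where c': "algebraic_int z'" "z = (\<Sum>v\<in>X. of_int (c' v :: int) * v) + 3 * z'"
      using indep3_maximal_generates[OF X(1,3) c(1)] by blast
    have "x = (\<Sum>v\<in>X. of_int (c v + 3 ^ n * c' v) * v) + 3 ^ Suc n * z'"
      unfolding c(2) c'(2) by (simp add: sum.distrib sum_distrib_left algebra_simps)
    with c'(1) show ?case
      by (intro exI[of _ "\<lambda>v. c v + 3 ^ n * c' v"] exI[of _ z'] conjI)
  qed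
  define T where "T = (\<lambda>c :: 'k \<Rightarrow> int. \<Sum>v\<in>X. of_int (c v) * v) ` (X \<rightarrow>\<^sub>E {0..<3 ^ n})"
  have finP: "finite (X \<rightarrow>\<^sub>E {0..<3 ^ n :: int})" using fin by (simp add: finite_PiE)
  have "card T \<le> card (X \<rightarrow>\<^sub>E {0..<3 ^ n :: int})" unfolding T_def by (rule card_image_le[OF finP])
  also have "\<dots> = (3 ^ n) ^ card X" using fin by (simp add: card_PiE nat_power_eq)
  also have "\<dots> \<le> (3 ^ n) ^ degree_field TYPE('k)" using X(2) by (intro power_increasing) auto
  also have "\<dots> = 3 ^ (n * degree_field TYPE('k))" by (simp add: power_mult)
  finally have "card T \<le> 3 ^ (n * degree_field TYPE('k))" .
  moreover have "\<exists>t\<in>T. \<exists>y. algebraic_int y \<and> x - t = 3 ^ n * y" if "algebraic_int x" for x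
  proof -
    obtain c z where c: "algebraic_int z" "x = (\<Sum>v\<in>X. of_int (c v :: int) * v) + 3 ^ n * z"
      using gen[OF \<open>algebraic_int x\<close>] by blast
    define c' where "c' = restrict (\<lambda>v. c v mod 3 ^ n) X"
    have "c' \<in> X \<rightarrow>\<^sub>E {0..<3 ^ n}" by (auto simp: c'_def)
    then have "(\<Sum>v\<in>X. of_int (c' v) * v) \<in> T" by (auto simp: T_def)
    moreover have "(\<Sum>v\<in>X. of_int (c v) * v) - (\<Sum>v\<in>X. of_int (c' v) * v) = 3 ^ n * (\<Sum>v\<in>X. of_int (c v div 3 ^ n) * v)"
      unfolding sum_subtractf[symmetric] sum_distrib_left
    proof (rule sum.cong)
      fix v assume "v \<in> X"
      have "c v = 3 ^ n * (c v div 3 ^ n) + c v mod 3 ^ n" by simp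
      then have "(of_int (c v) :: 'k) = 3 ^ n * of_int (c v div 3 ^ n) + of_int (c v mod 3 ^ n)"
        by (metis of_int_add of_int_mult of_int_numeral of_int_power)
      then show "of_int (c v) * v - of_int (c' v) * v = 3 ^ n * (of_int (c v div 3 ^ n) * v)"
        using \<open>v \<in> X\<close> by (simp add: c'_def algebra_simps)
    qed simp
    then have "x - (\<Sum>v\<in>X. of_int (c' v) * v) = 3 ^ n * ((\<Sum>v\<in>X. of_int (c v div 3 ^ n) * v) + z)"
      unfolding c(2) by (simp add: algebra_simps)
    moreover have "algebraic_int ((\<Sum>v\<in>X. of_int (c v div 3 ^ n) * v) + z)"
      using c(1) XO by (intro algebraic_int_add algebraic_int_sum algebraic_int_mult algebraic_int_of_int)
    ultimately show ?thesis by blast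
  qed
  ultimately show ?thesis using that finP unfolding T_def by blast
qed

text \<open>From here on \<open>det\<close>, \<open>mat\<close> and \<open>$\<close> belong to the
  finite Cartesian products \<open>real^2^2\<close>; the matrices of variable dimension served the
  eigenvalue and norm arguments above.\<close>

hide_const (open) Matrix.mat Matrix.vec Matrix.row Matrix.col Determinant.det Matrix.vec_index
hide_type (open) Matrix.vec Matrix.mat
no_notation Matrix.vec_index (infixl "$" 100)
no_notation Matrix.scalar_prod (infix "\<bullet>" 70)
no_notation Matrix.mult_mat_vec (infixl "*\<^sub>v" 70)

section \<open>Moebius transformations and the hyperbolic metric\<close>

definition minv :: "real^2^2 \<Rightarrow> real^2^2" where
  "minv A = vector [vector [A$2$2, - A$1$2], vector [- A$2$1, A$1$1]]"

lemma mat2_eq_iff: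
  "A = B \<longleftrightarrow> A$1$1 = B$1$1 \<and> A$1$2 = B$1$2 \<and> A$2$1 = B$2$1 \<and> A$2$2 = B$2$2"
  for A B :: "real^2^2"
  by (auto simp: Finite_Cartesian_Product.vec_eq_iff forall_2)

lemma mult2_component:
  fixes A B :: "real^2^2"
  shows "(A ** B) $ i $ j = A$i$1 * B$1$j + A$i$2 * B$2$j"
  by (simp add: matrix_matrix_mult_def sum_2)

lemma mat1_component: "(mat 1 :: real^2^2) $ i $ j = (if i = j then 1 else 0)"
  by (simp add: Finite_Cartesian_Product.mat_def)

lemma minv_component:
  "minv A $ 1 $ 1 = A$2$2" "minv A $ 1 $ 2 = - A$1$2" "minv A $ 2 $ 1 = - A$2$1" "minv A $ 2 $ 2 = A$1$1"
  by (simp_all add: minv_def vector_2)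

lemma det_minv: "det (minv A) = det A"
  by (simp add: det_2 minv_component)

lemma minv_mult: "det A = 1 \<Longrightarrow> minv A ** A = mat 1" "det A = 1 \<Longrightarrow> A ** minv A = mat 1"
  by (simp_all add: mat2_eq_iff mult2_component mat1_component minv_component det_2 algebra_simps)

lemma trace2: "trace (A :: real^2^2) = A$1$1 + A$2$2"
  by (simp add: trace_def sum_2)

text \<open>The automorphy factor. The square of its modulus divides the imaginary part, and its
  inverse square is the complex derivative of the transformation.\<close>

definition moebius_denom :: "real^2^2 \<Rightarrow> complex \<Rightarrow> complex" where
  "moebius_denom A z = of_real (A$2$1) * z + of_real (A$2$2)"

lemma moebius_denom_nonzero:
  assumes "det A = 1" "Im z > 0"
  shows "moebius_denom A z \<noteq> 0"
proof
  assume "moebius_denom A z = 0"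
  then have "Im (moebius_denom A z) = 0" "Re (moebius_denom A z) = 0" by simp_all
  then have "A$2$1 = 0" "A$2$2 = 0" using assms(2) by (auto simp: moebius_denom_def)
  then show False using assms(1) by (simp add: det_2)
qed

lemma Im_moebius:
  assumes "det A = 1" "Im z > 0"
  shows "Im (moebius A z) = Im z / (cmod (moebius_denom A z))\<^sup>2"
proof -
  have "Im (moebius A z) = (Im z * (A$1$1 * A$2$2 - A$1$2 * A$2$1)) / (cmod (moebius_denom A z))\<^sup>2"
    unfolding moebius_def moebius_denom_def[symmetric] Im_divide cmod_power2
    by (simp add: moebius_denom_def algebra_simps)
  then show ?thesis using assms(1) by (simp add: det_2)
qed

lemma Im_moebius_pos: "det A = 1 \<Longrightarrow> Im z > 0 \<Longrightarrow> Im (moebius A z) > 0"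
  by (simp add: Im_moebius moebius_denom_nonzero)

lemma moebius_mult:
  assumes "det A = 1" "det B = 1" "Im z > 0"
  shows "moebius (A ** B) z = moebius A (moebius B z)"
proof -
  define d where "d = moebius_denom B z"
  have d: "d \<noteq> 0" using moebius_denom_nonzero[OF assms(2,3)] by (simp add: d_def)
  define n where "n = of_real (B$1$1) * z + of_real (B$1$2)"
  have B: "moebius B z = n / d" by (simp add: moebius_def n_def d_def moebius_denom_def)
  have "moebius A (moebius B z) = (of_real (A$1$1) * n + of_real (A$1$2) * d) / (of_real (A$2$1) * n + of_real (A$2$2) * d)"
  proof -
    have *: "of_real (A$1$1) * (n / d) + of_real (A$1$2) = (of_real (A$1$1) * n + of_real (A$1$2) * d) / d"
      "of_real (A$2$1) * (n / d) + of_real (A$2$2) = (of_real (A$2$1) * n + of_real (A$2$2) * d) / d"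
      using d by (simp_all add: add_divide_distrib)
    have "(p / d) / (q / d) = p / q" for p q using d by simp
    then show ?thesis by (simp only: B moebius_def[of A] *)
  qed
  then show ?thesis
    by (simp add: moebius_def[of "A ** B"] mult2_component n_def d_def moebius_denom_def algebra_simps)
qed

lemma moebius_one: "moebius (mat 1) z = z"
  by (simp add: moebius_def mat1_component)

lemma moebius_uminus: "moebius (- A) z = moebius A z"
proof -
  have "moebius (- A) z = (- (of_real (A$1$1) * z + of_real (A$1$2))) / (- (of_real (A$2$1) * z + of_real (A$2$2)))"
    by (simp add: moebius_def)
  then show ?thesis by (simp only: minus_divide_divide moebius_def)
qed

lemma moebius_diff:
  assumes "det A = 1" "Im z > 0" "Im w > 0"
  shows "moebius A z - moebius A w = (z - w) / (moebius_denom A z * moebius_denom A w)"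
proof -
  have d: "moebius_denom A z \<noteq> 0" "moebius_denom A w \<noteq> 0"
    using moebius_denom_nonzero assms by blast+
  have "complex_of_real (A$1$1 * A$2$2 - A$1$2 * A$2$1) = 1" using assms(1) by (simp add: det_2)
  then have *: "of_real (A$1$1) * of_real (A$2$2) - of_real (A$1$2) * of_real (A$2$1) = (1 :: complex)" by simp
  have "(of_real (A$1$1) * z + of_real (A$1$2)) * moebius_denom A w - (of_real (A$1$1) * w + of_real (A$1$2)) * moebius_denom A z
     = (of_real (A$1$1) * of_real (A$2$2) - of_real (A$1$2) * of_real (A$2$1)) * (z - w)"
    by (simp add: moebius_denom_def algebra_simps)
  then show ?thesis using d unfolding moebius_def moebius_denom_def[symmetric] * by (simp add: diff_frac_eq)
qed

section \<open>The hyperbolic distance and its behaviour under Moebius transformations\<close>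

text \<open>For points of the half-plane this is \<open>2 * (cosh l - 1)\<close>, that is
  \<open>4 * (sinh (l / 2))\<^sup>2\<close>, with \<open>l\<close> the hyperbolic distance. Being
  rational in the coordinates, it makes invariance and displacement estimates algebraic.\<close>

definition hyp_e :: "complex \<Rightarrow> complex \<Rightarrow> real" where
  "hyp_e z w = (cmod (z - w))\<^sup>2 / (Im z * Im w)"

lemma hyp_dist_hyp_e: "hyp_dist z w = arcosh (1 + hyp_e z w / 2)"
  by (simp add: hyp_dist_def hyp_e_def field_simps)

lemma hyp_e_nonneg: "Im z > 0 \<Longrightarrow> Im w > 0 \<Longrightarrow> hyp_e z w \<ge> 0"
  by (simp add: hyp_e_def)

lemma hyp_e_commute: "hyp_e z w = hyp_e w z"
  by (simp add: hyp_e_def norm_minus_commute mult.commute)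

lemma hyp_e_moebius:
  assumes "det A = 1" "Im z > 0" "Im w > 0"
  shows "hyp_e (moebius A z) (moebius A w) = hyp_e z w"
proof -
  have d: "moebius_denom A z \<noteq> 0" "moebius_denom A w \<noteq> 0"
    using moebius_denom_nonzero assms by blast+
  then show ?thesis using assms
    by (simp add: hyp_e_def moebius_diff Im_moebius norm_divide norm_mult power_divide power_mult_distrib)
qed

lemma hyp_dist_moebius:
  "det A = 1 \<Longrightarrow> Im z > 0 \<Longrightarrow> Im w > 0 \<Longrightarrow> hyp_dist (moebius A z) (moebius A w) = hyp_dist z w"
  by (simp add: hyp_dist_hyp_e hyp_e_moebius)

lemma hyp_dist_nonneg: "Im z > 0 \<Longrightarrow> Im w > 0 \<Longrightarrow> hyp_dist z w \<ge> 0"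
  using hyp_e_nonneg by (simp add: hyp_dist_hyp_e arcosh_nonneg_real)

lemma cosh_hyp_dist: "Im z > 0 \<Longrightarrow> Im w > 0 \<Longrightarrow> cosh (hyp_dist z w) = 1 + hyp_e z w / 2"
  using hyp_e_nonneg by (simp add: hyp_dist_hyp_e cosh_arcosh_real)

lemma hyp_dist_commute: "hyp_dist z w = hyp_dist w z"
  by (simp add: hyp_dist_hyp_e hyp_e_commute)

lemma hyp_dist_self: "hyp_dist z z = 0"
  by (simp add: hyp_dist_def)

text \<open>Hyperboloid coordinates centred at \<open>u\<close> turn the inequality into Cauchy--Schwarz in the plane.\<close>

lemma hyp_dist_triangle:
  assumes "Im z > 0" "Im u > 0" "Im w > 0"
  shows "hyp_dist z w \<le> hyp_dist z u + hyp_dist u w"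
proof -
  \<comment> \<open>\<open>X\<close> and \<open>Y\<close> are coordinates after the similarity that
    moves \<open>u\<close> to the imaginary unit.\<close>
  define X where "X v = (Re v - Re u) / Im u" for v
  define Y where "Y v = Im v / Im u" for v
  \<comment> \<open>The point \<open>(c v, s v, t v)\<close> lies on the hyperboloid:
    \<open>c v\<close> is the hyperbolic cosine of the distance to \<open>u\<close>, and
    \<open>(s v, t v)\<close> is a plane vector whose length is the hyperbolic sine.\<close>
  define c where "c v = (X v ^ 2 + Y v ^ 2 + 1) / (2 * Y v)" for v
  define s where "s v = (X v ^ 2 + Y v ^ 2 - 1) / (2 * Y v)" for v
  define t where "t v = X v / Y v" for v
  have Y: "Y v > 0" if "Im v > 0" for v using that assms(2) by (simp add: Y_def)
  have e: "1 + hyp_e v v' / 2 = ((X v - X v')\<^sup>2 + (Y v)\<^sup>2 + (Y v')\<^sup>2) / (2 * Y v * Y v')" if "Im v > 0" "Im v' > 0" for v v'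
  proof -
    have "(X v - X v')\<^sup>2 + (Y v - Y v')\<^sup>2 = (cmod (v - v'))\<^sup>2 / (Im u)\<^sup>2"
      using assms(2) unfolding X_def Y_def diff_divide_distrib[symmetric] cmod_power2
      by (simp add: power_divide add_divide_distrib)
    moreover have "Y v * Y v' = Im v * Im v' / (Im u)\<^sup>2" by (simp add: Y_def power2_eq_square)
    ultimately have "hyp_e v v' = ((X v - X v')\<^sup>2 + (Y v - Y v')\<^sup>2) / (Y v * Y v')"
      using assms(2) by (simp add: hyp_e_def)
    then show ?thesis using Y[OF that(1)] Y[OF that(2)]
      by (simp add: field_simps power2_eq_square)
  qed
  have Xu: "X u = 0" "Y u = 1" using assms(2) by (simp_all add: X_def Y_def)
  have ch: "cosh (hyp_dist v u) = c v" if "Im v > 0" for v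
    using that assms(2) by (simp add: cosh_hyp_dist e Xu c_def add_ac)
  have cs: "c v ^ 2 = 1 + s v ^ 2 + t v ^ 2" if "Im v > 0" for v
  proof -
    define N where "N = X v ^ 2 + Y v ^ 2"
    have "c v ^ 2 = (N - 1)\<^sup>2 / (2 * Y v)\<^sup>2 + 4 * N / (2 * Y v)\<^sup>2"
      unfolding add_divide_distrib[symmetric] c_def N_def[symmetric] power_divide
      by (simp add: power2_eq_square algebra_simps)
    also have "(N - 1)\<^sup>2 / (2 * Y v)\<^sup>2 = s v ^ 2" by (simp add: s_def N_def power_divide)
    also have "4 * N / (2 * Y v)\<^sup>2 = 1 + t v ^ 2"
      using Y[OF that] by (simp add: N_def t_def power_divide power_mult_distrib add_divide_distrib)
    finally show ?thesis by simp
  qed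
  have sh: "sinh (hyp_dist v u) = sqrt (s v ^ 2 + t v ^ 2)" if "Im v > 0" for v
  proof -
    have "sinh (hyp_dist v u) ^ 2 = s v ^ 2 + t v ^ 2"
      using cs[OF that] ch[OF that] by (simp add: sinh_square_eq)
    then show ?thesis using hyp_dist_nonneg[OF that assms(2)] by (metis real_sqrt_unique sinh_real_nonneg_iff)
  qed
  \<comment> \<open>The Minkowski product of the two hyperboloid points; Cauchy-Schwarz for the
    plane parts then leaves the addition formula for \<open>cosh\<close>.\<close>
  have "cosh (hyp_dist z w) = c z * c w - (s z * s w + t z * t w)"
  proof -
    define M N where "M = X z ^ 2 + Y z ^ 2" and "N = X w ^ 2 + Y w ^ 2"
    have "c z * c w - (s z * s w + t z * t w) = ((M + 1) * (N + 1) - (M - 1) * (N - 1)) / (4 * (Y z * Y w)) - X z * X w / (Y z * Y w)"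
    proof -
      have c: "c z = (M + 1) / (2 * Y z)" "c w = (N + 1) / (2 * Y w)"
        and s: "s z = (M - 1) / (2 * Y z)" "s w = (N - 1) / (2 * Y w)"
        by (simp_all add: c_def s_def M_def N_def)
      have eq: "p / (2 * Y z) * (q / (2 * Y w)) = p * q / (4 * (Y z * Y w))" for p q by simp
      show ?thesis unfolding c s t_def eq times_divide_times_eq[of "X z"]
        by (simp only: diff_divide_distrib[of "(M + 1) * (N + 1)"] diff_diff_eq)
    qed
    also have "(M + 1) * (N + 1) - (M - 1) * (N - 1) = 2 * (M + N)" by (simp add: algebra_simps)
    also have "2 * (M + N) / (4 * (Y z * Y w)) - X z * X w / (Y z * Y w) = (M + N - 2 * X z * X w) / (2 * Y z * Y w)"
      using assms(1,3) Y[of z] Y[of w] by (simp add: field_simps)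
    also have "M + N - 2 * X z * X w = (X z - X w)\<^sup>2 + (Y z)\<^sup>2 + (Y w)\<^sup>2"
      by (simp add: M_def N_def power2_eq_square algebra_simps)
    finally show ?thesis using cosh_hyp_dist[OF assms(1,3)] e[OF assms(1,3)] by simp
  qed
  also have "\<dots> \<le> c z * c w + sqrt (s z ^ 2 + t z ^ 2) * sqrt (s w ^ 2 + t w ^ 2)"
  proof -
    have "(s z * s w + t z * t w)\<^sup>2 \<le> (s z ^ 2 + t z ^ 2) * (s w ^ 2 + t w ^ 2)"
    proof -
      have "(s z ^ 2 + t z ^ 2) * (s w ^ 2 + t w ^ 2) - (s z * s w + t z * t w)\<^sup>2 = (s z * t w - t z * s w)\<^sup>2"
        by (simp add: power2_eq_square algebra_simps)
      then show ?thesis by (smt (verit) zero_le_power2)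
    qed
    then have "\<bar>s z * s w + t z * t w\<bar> \<le> sqrt ((s z ^ 2 + t z ^ 2) * (s w ^ 2 + t w ^ 2))"
      by (metis real_sqrt_abs real_sqrt_le_iff)
    then show ?thesis by (simp add: real_sqrt_mult)
  qed
  also have "\<dots> = cosh (hyp_dist z u + hyp_dist u w)"
    using assms by (simp add: cosh_add ch sh hyp_dist_commute[of u w])
  finally show ?thesis
    using hyp_dist_nonneg assms by (subst (asm) cosh_real_nonneg_le_iff) auto
qed

text \<open>The left side is \<open>4 * (cosh (l / 2))\<^sup>2\<close> for the displacement
  \<open>l\<close> of \<open>z\<close>. On the right, \<open>P\<close> is the fixed point polynomial
  at the real part of \<open>z\<close>, and for hyperbolic \<open>A\<close> the last square vanishes
  exactly on the axis. The identity gives both the trace bound and, for trace 2, control of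
  parabolic elements.\<close>

lemma trace_displacement:
  assumes "det A = 1" "Im z > 0"
  defines "P \<equiv> A$2$1 * (Re z)\<^sup>2 + (A$2$2 - A$1$1) * Re z - A$1$2"
  shows "4 + hyp_e z (moebius A z) = (trace A)\<^sup>2 + (P / Im z + A$2$1 * Im z)\<^sup>2"
proof -
  let ?d = "moebius_denom A z"
  have d: "?d \<noteq> 0" using moebius_denom_nonzero assms by blast
  have "z - moebius A z = (z * ?d - (of_real (A$1$1) * z + of_real (A$1$2))) / ?d"
    using d by (simp add: moebius_def moebius_denom_def[symmetric] diff_divide_distrib)
  then have "hyp_e z (moebius A z) = (cmod (z * ?d - (of_real (A$1$1) * z + of_real (A$1$2))))\<^sup>2 / (Im z)\<^sup>2"
    using d assms(1,2) by (simp add: hyp_e_def Im_moebius norm_divide power_divide power2_eq_square)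
  also have "(cmod (z * ?d - (of_real (A$1$1) * z + of_real (A$1$2))))\<^sup>2 =
      (P - A$2$1 * (Im z)\<^sup>2)\<^sup>2 + (Im z)\<^sup>2 * (2 * A$2$1 * Re z + A$2$2 - A$1$1)\<^sup>2"
    unfolding cmod_power2
    by (simp add: P_def moebius_denom_def power2_eq_square algebra_simps)
  finally have e: "hyp_e z (moebius A z) = ((P - A$2$1 * (Im z)\<^sup>2) / Im z)\<^sup>2 + (2 * A$2$1 * Re z + A$2$2 - A$1$1)\<^sup>2"
    using assms(2) by (simp add: add_divide_distrib power_divide)
  have "(2 * A$2$1 * Re z + A$2$2 - A$1$1)\<^sup>2 = (trace A)\<^sup>2 - 4 * det A + 4 * A$2$1 * P"
    by (simp add: P_def det_2 trace2 power2_eq_square algebra_simps)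
  moreover have "((P - A$2$1 * (Im z)\<^sup>2) / Im z)\<^sup>2 = (P / Im z + A$2$1 * Im z)\<^sup>2 - 4 * A$2$1 * P"
  proof -
    have "(P - A$2$1 * (Im z)\<^sup>2) / Im z = P / Im z - A$2$1 * Im z"
      using assms(2) by (simp add: diff_divide_distrib power2_eq_square)
    moreover have "4 * (P / Im z) * (A$2$1 * Im z) = 4 * A$2$1 * P" using assms(2) by simp
    moreover have "(p - q)\<^sup>2 = (p + q)\<^sup>2 - 4 * p * q" for p q :: real
      by (simp add: power2_eq_square algebra_simps)
    ultimately show ?thesis by metis
  qed
  ultimately show ?thesis using e assms(1) by simp
qed

text \<open>The identity above gives a trace of absolute value at most
  \<open>2 * cosh (l / 2)\<close>, hence at most \<open>2 * exp (l / 2)\<close>; the subtracted 2 is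
  absorbed by a second such term, since \<open>l\<close> is nonnegative.\<close>

lemma trace_minus_2_le:
  assumes "det A = 1" "Im z > 0"
  shows "\<bar>trace A - 2\<bar> \<le> 4 * exp (hyp_dist z (moebius A z) / 2)"
proof -
  define l where "l = hyp_dist z (moebius A z)"
  have l: "l \<ge> 0" unfolding l_def using assms Im_moebius_pos hyp_dist_nonneg by blast
  have "(trace A)\<^sup>2 \<le> 4 + hyp_e z (moebius A z)" using trace_displacement[OF assms] by simp
  also have "\<dots> = 2 + 2 * cosh l"
    using cosh_hyp_dist[OF assms(2) Im_moebius_pos[OF assms]] by (simp add: l_def)
  also have "cosh l = 2 * cosh (l / 2) ^ 2 - 1"
    using cosh_double_cosh[of "l / 2"] by simp
  finally have "(trace A)\<^sup>2 \<le> (2 * cosh (l / 2))\<^sup>2" by (simp add: power_mult_distrib)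
  then have "\<bar>trace A\<bar> \<le> 2 * cosh (l / 2)"
    by (rule power2_le_imp_le[of "\<bar>trace A\<bar>", unfolded power2_abs]) simp
  also have "cosh (l / 2) \<le> exp (l / 2)"
  proof -
    have "exp (- (l / 2)) \<le> exp (l / 2)" using l by simp
    then show ?thesis by (simp add: cosh_def)
  qed
  finally have "\<bar>trace A\<bar> \<le> 2 * exp (l / 2)" by simp
  moreover have "1 \<le> exp (l / 2)" using l by simp
  ultimately show ?thesis unfolding l_def[symmetric] by linarith
qed

text \<open>A point at Euclidean distance \<open>t\<close> from \<open>z\<close> has height at most
  \<open>Im z + t\<close>, so \<open>hyp_e\<close> is at least
  \<open>t\<^sup>2 / (Y * (Y + t))\<close>, an increasing function of \<open>t\<close>. The constant
  \<open>k\<close> is its value at \<open>\<epsilon>\<close>.\<close>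

lemma hyp_dist_close:
  assumes "Im z > 0" "\<epsilon> > 0"
  obtains \<delta> where "\<delta> > 0" "\<And>w. Im w > 0 \<Longrightarrow> hyp_dist z w < \<delta> \<Longrightarrow> cmod (z - w) < \<epsilon>"
proof -
  define Y where "Y = Im z"
  define k where "k = \<epsilon>\<^sup>2 / (Y * (Y + \<epsilon>))"
  have k: "k > 0" using assms by (simp add: k_def Y_def)
  have "cmod (z - w) < \<epsilon>" if w: "Im w > 0" "hyp_dist z w < arcosh (1 + k / 2)" for w
  proof (rule ccontr)
    define t where "t = cmod (z - w)"
    assume "\<not> cmod (z - w) < \<epsilon>"
    then have t: "t \<ge> \<epsilon>" by (simp add: t_def)
    have "cosh (hyp_dist z w) < cosh (arcosh (1 + k / 2))"
      using w k hyp_dist_nonneg[OF assms(1) w(1)] by (subst cosh_real_nonneg_less_iff) (auto intro: arcosh_nonneg_real)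
    then have "hyp_e z w < k" using assms w(1) k by (simp add: cosh_hyp_dist cosh_arcosh_real)
    then have "t\<^sup>2 < k * (Y * Im w)"
      using assms w(1) by (simp add: hyp_e_def t_def Y_def pos_divide_less_eq)
    also have "Im w \<le> Y + t"
      using abs_Im_le_cmod[of "z - w"] by (simp add: Y_def t_def)
    then have "k * (Y * Im w) \<le> k * (Y * (Y + t))"
      using k assms(1) by (simp add: Y_def)
    finally have "t\<^sup>2 < k * (Y * (Y + t))" .
    moreover have "k * (Y * (Y + t)) = \<epsilon>\<^sup>2 * (Y + t) / (Y + \<epsilon>)"
      using assms(1) by (simp add: k_def Y_def)
    ultimately have "t\<^sup>2 * (Y + \<epsilon>) < \<epsilon>\<^sup>2 * (Y + t)"
      using assms by (simp add: Y_def pos_less_divide_eq)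
    moreover have "\<epsilon>\<^sup>2 * Y \<le> t\<^sup>2 * Y" using t assms by (intro mult_right_mono power_mono) (auto simp: Y_def)
    moreover have "\<epsilon>\<^sup>2 * t \<le> t\<^sup>2 * \<epsilon>"
      using mult_right_mono[OF t, of "t * \<epsilon>"] t assms(2) by (simp add: power2_eq_square mult_ac)
    ultimately show False by (simp add: distrib_left)
  qed
  moreover have "arcosh (1 + k / 2) > 0" using k by (simp add: arcosh_real_gt_1_iff)
  ultimately show ?thesis using that by blast
qed

section \<open>The group \<open>G\<close> and its action\<close>

lemma SL2R_simps [simp]:
  "carrier SL2R = {A. det A = 1}" "A \<otimes>\<^bsub>SL2R\<^esub> B = A ** B" "\<one>\<^bsub>SL2R\<^esub> = mat 1"
  by (simp_all add: SL2R_def)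

lemma group_SL2R: "group SL2R"
proof (rule groupI)
  fix A assume "A \<in> carrier SL2R"
  then show "\<exists>B\<in>carrier SL2R. B \<otimes>\<^bsub>SL2R\<^esub> A = \<one>\<^bsub>SL2R\<^esub>"
    using minv_mult by (intro bexI[of _ "minv A"]) (auto simp: det_minv)
qed (auto simp: det_mul matrix_mul_assoc)

lemma mat1_uminus_mult: "(- mat 1) ** A = - A" "A ** (- mat 1) = - A" for A :: "real^2^2"
  by (simp_all add: mat2_eq_iff mult2_component mat1_component)

lemma det_uminus2: "det (- A) = det A" for A :: "real^2^2"
  by (simp add: det_2)

lemma to_psl_eq: "to_psl A = {A, - A}"
  by (auto simp: to_psl_def r_coset_def mat1_uminus_mult)

lemma normal_center: "{mat 1, - mat 1} \<lhd> SL2R"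
proof -
  interpret group SL2R by (rule group_SL2R)
  have "subgroup {mat 1, - mat 1} SL2R"
  proof (rule subgroupI)
    fix A assume "A \<in> {mat 1, - mat 1 :: real^2^2}"
    moreover have "inv\<^bsub>SL2R\<^esub> (mat 1) = mat 1" "inv\<^bsub>SL2R\<^esub> (- mat 1) = - mat 1"
      by (rule inv_equality; simp add: mat1_uminus_mult det_uminus2)+
    ultimately show "inv\<^bsub>SL2R\<^esub> A \<in> {mat 1, - mat 1}" by auto
  qed (auto simp: mat1_uminus_mult det_uminus2)
  then show ?thesis
    by (rule normalI) (auto simp: r_coset_def l_coset_def mat1_uminus_mult)
qed

lemma group_PSL2R: "group PSL2R"
  unfolding PSL2R_def using normal.factorgroup_is_group[OF normal_center] .

lemma carrier_PSL2R: "carrier PSL2R = {to_psl A | A. det A = 1}"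
  by (auto simp: PSL2R_def FactGroup_def RCOSETS_def to_psl_def)

lemma PSL2R_mult:
  assumes "det A = 1" "det B = 1"
  shows "to_psl A \<otimes>\<^bsub>PSL2R\<^esub> to_psl B = to_psl (A ** B)"
  using normal.rcos_sum[OF normal_center, of A B] assms
  by (simp add: PSL2R_def FactGroup_def to_psl_def)

lemma PSL2R_one: "\<one>\<^bsub>PSL2R\<^esub> = to_psl (mat 1)"
  by (simp add: PSL2R_def FactGroup_def to_psl_eq)

text \<open>The element of \<open>G\<close> given by a tuple of matrices. Computations in
  \<open>G\<close> are carried out on such representatives.\<close>

definition psl :: "('r::finite \<Rightarrow> real^2^2) \<Rightarrow> 'r psl" where
  "psl A = (\<lambda>i. to_psl (A i))"

lemma group_G: "group (G :: 'r::finite psl monoid)"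
  unfolding G_def by (rule product_group) (rule group_PSL2R)

lemma carrier_G: "g \<in> carrier (G :: 'r::finite psl monoid) \<longleftrightarrow> (\<exists>A. (\<forall>i. det (A i) = 1) \<and> g = psl A)"
proof
  assume "g \<in> carrier G"
  then have "\<forall>i. \<exists>A. det A = 1 \<and> g i = to_psl A"
    by (auto simp: G_def carrier_product_group carrier_PSL2R PiE_def Pi_def)
  then obtain A where "\<And>i. det (A i) = 1 \<and> g i = to_psl (A i)" by metis
  then show "\<exists>A. (\<forall>i. det (A i) = 1) \<and> g = psl A" by (auto simp: psl_def)
next
  assume "\<exists>A. (\<forall>i. det (A i) = 1) \<and> g = psl A"
  then show "g \<in> carrier G"
    by (auto simp: G_def carrier_product_group carrier_PSL2R PiE_def Pi_def extensional_def psl_def)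
qed

lemma psl_in_G: "(\<And>i. det (A i) = 1) \<Longrightarrow> psl A \<in> carrier G"
  using carrier_G by blast

lemma psl_mult:
  assumes "\<And>i. det (A i) = 1" "\<And>i. det (B i) = 1"
  shows "psl A \<otimes>\<^bsub>G\<^esub> psl B = psl (\<lambda>i. A i ** B i)"
  using assms by (simp add: G_def psl_def PSL2R_mult restrict_def)

lemma psl_one: "\<one>\<^bsub>G\<^esub> = psl (\<lambda>_. mat 1)"
  by (simp add: G_def psl_def PSL2R_one restrict_def)

lemma act_psl: "act (psl A) z = (\<chi> i. moebius (A i) (z $ i))"
proof -
  have "(\<lambda>B. moebius B w) ` {B, - B} = {moebius B w}" for B w by (auto simp: moebius_uminus)
  then show ?thesis by (simp add: act_def psl_def to_psl_eq)
qed

lemma act_upper: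
  assumes "g \<in> carrier G" "z \<in> upper"
  shows "act g z \<in> upper"
proof -
  obtain A where "\<And>i. det (A i) = 1" "g = psl A" using assms(1) carrier_G by blast
  then show ?thesis using assms(2) by (auto simp: act_psl upper_def Im_moebius_pos)
qed

lemma act_mult:
  assumes "g \<in> carrier G" "h \<in> carrier G" "z \<in> upper"
  shows "act (g \<otimes>\<^bsub>G\<^esub> h) z = act g (act h z)"
proof -
  obtain A where A: "\<And>i. det (A i) = 1" "g = psl A" using assms(1) carrier_G by blast
  obtain B where B: "\<And>i. det (B i) = 1" "h = psl B" using assms(2) carrier_G by blast
  show ?thesis using assms(3) A B
    by (simp add: psl_mult act_psl moebius_mult upper_def)
qed

lemma act_one: "act \<one>\<^bsub>G\<^esub> z = z"
  by (simp add: psl_one act_psl moebius_one Finite_Cartesian_Product.vec_eq_iff)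

lemma act_inv_act:
  assumes "g \<in> carrier G" "z \<in> upper"
  shows "act (inv\<^bsub>G\<^esub> g) (act g z) = z" "act g (act (inv\<^bsub>G\<^esub> g) z) = z"
proof -
  have g: "inv\<^bsub>G\<^esub> g \<in> carrier G" using group.inv_closed[OF group_G assms(1)] .
  show "act (inv\<^bsub>G\<^esub> g) (act g z) = z"
    using act_mult[OF g assms] group.l_inv[OF group_G assms(1)] by (simp add: act_one)
  show "act g (act (inv\<^bsub>G\<^esub> g) z) = z"
    using act_mult[OF assms(1) g assms(2)] group.r_inv[OF group_G assms(1)] by (simp add: act_one)
qed

lemma upper_dist_act:
  assumes "g \<in> carrier G" "z \<in> upper" "w \<in> upper"
  shows "upper_dist (act g z) (act g w) = upper_dist z w"
proof -
  obtain A where "\<And>i. det (A i) = 1" "g = psl A" using assms(1) carrier_G by blast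
  then show ?thesis using assms(2,3) by (simp add: act_psl upper_dist_def upper_def hyp_dist_moebius)
qed

lemma upper_dist_L2: "upper_dist z w = L2_set (\<lambda>i. hyp_dist (z $ i) (w $ i)) UNIV"
  by (simp add: upper_dist_def L2_set_def)

lemma upper_dist_commute: "upper_dist z w = upper_dist w z"
  by (simp add: upper_dist_def hyp_dist_commute)

lemma upper_dist_self: "upper_dist z z = 0"
  by (simp add: upper_dist_def hyp_dist_self)

lemma upper_dist_triangle:
  assumes "z \<in> upper" "u \<in> upper" "w \<in> upper"
  shows "upper_dist z w \<le> upper_dist z u + upper_dist u w"
proof -
  have "upper_dist z w \<le> L2_set (\<lambda>i. hyp_dist (z $ i) (u $ i) + hyp_dist (u $ i) (w $ i)) UNIV"
    unfolding upper_dist_L2 using assms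
    by (intro L2_set_mono hyp_dist_triangle hyp_dist_nonneg) (auto simp: upper_def)
  also have "\<dots> \<le> upper_dist z u + upper_dist u w"
    unfolding upper_dist_L2 by (rule L2_set_triangle_ineq)
  finally show ?thesis .
qed

lemma hyp_dist_le_upper_dist:
  assumes "z \<in> upper" "w \<in> upper"
  shows "hyp_dist (z $ i) (w $ i) \<le> upper_dist z w"
  unfolding upper_dist_L2 using member_le_L2_set[of UNIV i "\<lambda>i. hyp_dist (z $ i) (w $ i)"] by simp

text \<open>Cauchy-Schwarz against the vector of ones, whose length is the square root of
  \<open>r\<close> in the final estimate.\<close>

lemma sum_hyp_dist_le_upper_dist:
  fixes z w :: "complex^'r::finite"
  shows "(\<Sum>i\<in>UNIV. hyp_dist (z $ i) (w $ i)) \<le> sqrt (real CARD('r)) * upper_dist z w"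
proof -
  have "(\<Sum>i\<in>UNIV. \<bar>1 :: real\<bar> * \<bar>hyp_dist (z $ i) (w $ i)\<bar>) \<le> L2_set (\<lambda>i::'r. 1) UNIV * upper_dist z w"
    unfolding upper_dist_L2 by (rule L2_set_mult_ineq)
  moreover have "(\<Sum>i\<in>UNIV. hyp_dist (z $ i) (w $ i)) \<le> (\<Sum>i\<in>UNIV. \<bar>1 :: real\<bar> * \<bar>hyp_dist (z $ i) (w $ i)\<bar>)"
    by (intro sum_mono) simp
  moreover have "L2_set (\<lambda>i::'r. 1) UNIV = sqrt (real CARD('r))" by (simp add: L2_set_def)
  ultimately show ?thesis by simp
qed

lemma upper_component: "z \<in> upper \<Longrightarrow> Im (z $ i) > 0"
  by (simp add: upper_def)

lemma upper_eq_INT: "upper = (\<Inter>i. {z :: complex^'r::finite. Im (z $ i) > 0})"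
  by (auto simp: upper_def)

lemma open_upper: "open (upper :: (complex^'r::finite) set)"
  unfolding upper_eq_INT
  by (intro open_INT finite) (auto intro!: open_Collect_less continuous_intros)

text \<open>Convexity supplies the straight-line homotopy by which closed lifts are
  contracted.\<close>

lemma convex_upper: "convex (upper :: (complex^'r::finite) set)"
proof (rule convexI)
  fix x y :: "complex^'r" and u v :: real
  assume *: "x \<in> upper" "y \<in> upper" "0 \<le> u" "0 \<le> v" "u + v = 1"
  have "u * Im (x $ i) + v * Im (y $ i) > 0" for i
  proof (cases "u = 0")
    case True
    then show ?thesis using * by (simp add: upper_def)
  next
    case False
    then have "u * Im (x $ i) > 0" "v * Im (y $ i) \<ge> 0"
      using * by (auto simp: upper_def less_imp_le)
    then show ?thesis by linarith
  qed
  then show "u *\<^sub>R x + v *\<^sub>R y \<in> upper" by (simp add: upper_def)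
qed

lemma continuous_on_act:
  assumes "g \<in> carrier (G :: 'r::finite psl monoid)"
  shows "continuous_on upper (act g)"
proof -
  obtain A where A: "\<And>i. det (A i) = 1" "g = psl A" using assms(1) carrier_G by blast
  have "continuous_on upper (\<lambda>z. moebius (A i) (z $ i))" for i
    unfolding moebius_def
    using moebius_denom_nonzero[OF A(1)] 
    by (intro continuous_intros) (auto simp: upper_def moebius_denom_def)
  then show ?thesis unfolding A(2) act_psl[abs_def] by (intro continuous_on_vec_lambda)
qed

lemma continuous_on_upper_dist:
  assumes "z \<in> upper"
  shows "continuous_on upper (upper_dist z)"
proof -
  have "continuous_on upper (\<lambda>w. hyp_dist (z $ i) (w $ i))" for i
    unfolding hyp_dist_hyp_e
  proof (rule continuous_on_compose2[OF continuous_on_arcosh[OF order_refl]])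
    show "continuous_on upper (\<lambda>w. 1 + hyp_e (z $ i) (w $ i) / 2)"
      using upper_component[OF assms, of i] unfolding hyp_e_def
      by (intro continuous_intros) (auto simp: upper_def less_imp_neq[symmetric])
    show "(\<lambda>w. 1 + hyp_e (z $ i) (w $ i) / 2) ` upper \<subseteq> {1..}"
      using hyp_e_nonneg[OF upper_component[OF assms] upper_component] by auto
  qed
  then show ?thesis unfolding upper_dist_def by (intro continuous_intros)
qed

text \<open>Together with \<open>continuous_on_upper_dist\<close> this says that the product
  distance induces the Euclidean topology. It makes curves that are Lipschitz for
  \<open>upper_dist\<close> continuous.\<close>

lemma upper_dist_close:
  fixes z :: "complex^'r::finite"
  assumes "z \<in> upper" "\<epsilon> > 0"
  obtains \<delta> where "\<delta> > 0" "\<And>w. w \<in> upper \<Longrightarrow> upper_dist z w < \<delta> \<Longrightarrow> dist z w < \<epsilon>"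
proof -
  define \<epsilon>' where "\<epsilon>' = \<epsilon> / real CARD('r)"
  have \<epsilon>': "\<epsilon>' > 0" using assms(2) by (simp add: \<epsilon>'_def)
  have "\<forall>i. \<exists>\<delta>>0. \<forall>w. Im w > 0 \<longrightarrow> hyp_dist (z $ i) w < \<delta> \<longrightarrow> cmod (z $ i - w) < \<epsilon>'"
    using hyp_dist_close[OF upper_component[OF assms(1)] \<epsilon>'] by metis
  then obtain \<delta> where \<delta>: "\<And>i. \<delta> i > 0"
    "\<And>i w. Im w > 0 \<Longrightarrow> hyp_dist (z $ i) w < \<delta> i \<Longrightarrow> cmod (z $ i - w) < \<epsilon>'" by metis
  define \<delta>' where "\<delta>' = Min (range \<delta>)"
  have "\<delta>' > 0" using \<delta>(1) by (auto simp: \<delta>'_def)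
  moreover have "dist z w < \<epsilon>" if w: "w \<in> upper" "upper_dist z w < \<delta>'" for w
  proof -
    have "cmod (z $ i - w $ i) < \<epsilon>'" for i
    proof (rule \<delta>(2)[OF upper_component[OF w(1)]])
      have "hyp_dist (z $ i) (w $ i) < \<delta>'"
        using hyp_dist_le_upper_dist[OF assms(1) w(1)] w(2) by (rule le_less_trans)
      also have "\<dots> \<le> \<delta> i" by (simp add: \<delta>'_def)
      finally show "hyp_dist (z $ i) (w $ i) < \<delta> i" .
    qed
    moreover have "dist z w \<le> (\<Sum>i\<in>UNIV. dist (z $ i) (w $ i))"
      unfolding dist_vec_def by (rule L2_set_le_sum) simp
    moreover have "(\<Sum>i\<in>UNIV. dist (z $ i) (w $ i)) < (\<Sum>i\<in>(UNIV :: 'r set). \<epsilon>')"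
      using calculation(1) by (intro sum_strict_mono) (auto simp: dist_norm)
    ultimately show ?thesis by (simp add: \<epsilon>'_def)
  qed
  ultimately show ?thesis using that by blast
qed

section \<open>Quotients by subgroups\<close>

context
  fixes \<Delta> :: "'r::finite psl set"
  assumes sub: "subgroup \<Delta> G"
begin

lemma in_G: "\<gamma> \<in> \<Delta> \<Longrightarrow> \<gamma> \<in> carrier G"
  using subgroup.subset[OF sub] by blast

lemma orbit_of_subset: "z \<in> upper \<Longrightarrow> orbit_of \<Delta> z \<subseteq> upper"
  by (auto simp: orbit_of_def act_upper in_G)

lemma orbit_of_self: "z \<in> orbit_of \<Delta> z"
  using subgroup.one_closed[OF sub] act_one unfolding orbit_of_def by (metis imageI)

lemma orbit_of_eq:
  assumes "z \<in> upper" "w \<in> orbit_of \<Delta> z"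
  shows "orbit_of \<Delta> w = orbit_of \<Delta> z"
proof -
  obtain \<gamma> where \<gamma>: "\<gamma> \<in> \<Delta>" "w = act \<gamma> z" using assms(2) by (auto simp: orbit_of_def)
  show ?thesis
  proof
    show "orbit_of \<Delta> w \<subseteq> orbit_of \<Delta> z"
      using \<gamma> assms(1) act_mult[OF in_G in_G, of _ \<gamma>, symmetric] subgroup.m_closed[OF sub]
      by (auto simp: orbit_of_def)
    show "orbit_of \<Delta> z \<subseteq> orbit_of \<Delta> w"
    proof
      fix v assume "v \<in> orbit_of \<Delta> z"
      then obtain \<delta> where \<delta>: "\<delta> \<in> \<Delta>" "v = act \<delta> z" by (auto simp: orbit_of_def)
      have inv: "inv\<^bsub>G\<^esub> \<gamma> \<in> \<Delta>" using subgroup.m_inv_closed[OF sub \<gamma>(1)] .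
      have "v = act \<delta> (act (inv\<^bsub>G\<^esub> \<gamma>) w)"
        using act_inv_act(1)[OF in_G[OF \<gamma>(1)] assms(1)] \<gamma> \<delta> by simp
      also have "\<dots> = act (\<delta> \<otimes>\<^bsub>G\<^esub> inv\<^bsub>G\<^esub> \<gamma>) w"
        using act_mult[OF in_G[OF \<delta>(1)] in_G[OF inv]] act_upper[OF in_G[OF \<gamma>(1)] assms(1)] \<gamma>(2) by simp
      finally show "v \<in> orbit_of \<Delta> w"
        using subgroup.m_closed[OF sub \<delta>(1) inv] by (auto simp: orbit_of_def)
    qed
  qed
qed

lemma orbit_of_in_quotient: "z \<in> upper \<Longrightarrow> orbit_of \<Delta> z \<in> quotient_space \<Delta>"
  by (simp add: quotient_space_def)

lemma quotient_elem:
  assumes "C \<in> quotient_space \<Delta>" "z \<in> C"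
  shows "z \<in> upper" "C = orbit_of \<Delta> z"
proof -
  obtain w where "w \<in> upper" "C = orbit_of \<Delta> w" using assms(1) by (auto simp: quotient_space_def)
  then show "z \<in> upper" "C = orbit_of \<Delta> z"
    using assms(2) orbit_of_subset[of w] orbit_of_eq[of w z] by blast+
qed

lemma quotient_elem_nonempty:
  assumes "C \<in> quotient_space \<Delta>"
  obtains z where "z \<in> C" "z \<in> upper"
  using assms orbit_of_self by (auto simp: quotient_space_def)

lemma Union_quotient: "\<Union>(quotient_space \<Delta>) = upper"
  using orbit_of_self orbit_of_subset by (auto simp: quotient_space_def)

lemma mem_Union_iff:
  assumes "U \<subseteq> quotient_space \<Delta>"
  shows "z \<in> \<Union>U \<longleftrightarrow> z \<in> upper \<and> orbit_of \<Delta> z \<in> U"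
  using assms quotient_elem orbit_of_self by (metis UnionE UnionI subsetD)

text \<open>Distinct orbits are disjoint, so unions of sets of orbits commute with intersections.
  This is what makes the quotient topology closed under intersection.\<close>

lemma Union_Int:
  assumes "U \<subseteq> quotient_space \<Delta>" "V \<subseteq> quotient_space \<Delta>"
  shows "\<Union>(U \<inter> V) = \<Union>U \<inter> \<Union>V"
proof (rule Set.set_eqI)
  fix z
  have "U \<inter> V \<subseteq> quotient_space \<Delta>" using assms by blast
  then show "z \<in> \<Union>(U \<inter> V) \<longleftrightarrow> z \<in> \<Union>U \<inter> \<Union>V"
    unfolding Int_iff mem_Union_iff[OF assms(1)] mem_Union_iff[OF assms(2)]
    by (subst mem_Union_iff) auto
qed

lemma openin_quotient_topology:
  "openin (quotient_topology \<Delta>) U \<longleftrightarrow> U \<subseteq> quotient_space \<Delta> \<and> openin (top_of_set upper) (\<Union>U)"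
proof -
  have "istopology (\<lambda>U. U \<subseteq> quotient_space \<Delta> \<and> openin (top_of_set upper) (\<Union>U))"
    unfolding istopology_def
  proof (intro conjI allI impI)
    fix U V :: "(complex^'r) set set"
    assume "U \<subseteq> quotient_space \<Delta> \<and> openin (top_of_set upper) (\<Union>U)"
      "V \<subseteq> quotient_space \<Delta> \<and> openin (top_of_set upper) (\<Union>V)"
    then show "U \<inter> V \<subseteq> quotient_space \<Delta>" "openin (top_of_set upper) (\<Union>(U \<inter> V))"
      by (auto simp: Union_Int)
  next
    fix K :: "(complex^'r) set set set"
    assume K: "\<forall>U\<in>K. U \<subseteq> quotient_space \<Delta> \<and> openin (top_of_set upper) (\<Union>U)"
    then show "\<Union>K \<subseteq> quotient_space \<Delta>" by blast
    have "\<Union>(\<Union>K) = (\<Union>U\<in>K. \<Union>U)" by blast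
    then show "openin (top_of_set upper) (\<Union>(\<Union>K))" using K by auto
  qed
  then show ?thesis unfolding quotient_topology_def by (simp add: topology_inverse')
qed

lemma topspace_quotient: "topspace (quotient_topology \<Delta>) = quotient_space \<Delta>"
proof
  show "topspace (quotient_topology \<Delta>) \<subseteq> quotient_space \<Delta>"
    unfolding topspace_def openin_quotient_topology by blast
  have "openin (quotient_topology \<Delta>) (quotient_space \<Delta>)"
    unfolding openin_quotient_topology Union_quotient by auto
  then show "quotient_space \<Delta> \<subseteq> topspace (quotient_topology \<Delta>)" by (rule openin_subset)
qed

lemma continuous_map_orbit_of:
  "continuous_map (top_of_set upper) (quotient_topology \<Delta>) (orbit_of \<Delta>)"
  unfolding continuous_map_def
proof (intro conjI allI impI)
  show "orbit_of \<Delta> \<in> topspace (top_of_set upper) \<rightarrow> topspace (quotient_topology \<Delta>)"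
    by (auto simp: topspace_quotient orbit_of_in_quotient)
  fix U assume "openin (quotient_topology \<Delta>) U"
  then have U: "U \<subseteq> quotient_space \<Delta>" "openin (top_of_set upper) (\<Union>U)"
    by (auto simp: openin_quotient_topology)
  have "{x \<in> topspace (top_of_set upper). orbit_of \<Delta> x \<in> U} = \<Union>U"
    using mem_Union_iff[OF U(1)] by (auto simp: set_eq_iff)
  then show "openin (top_of_set upper) {x \<in> topspace (top_of_set upper). orbit_of \<Delta> x \<in> U}"
    using U(2) by simp
qed

text \<open>The infimum runs over pairs from both orbits; since the group acts by isometries, a
  nearly minimal pair can be translated so that it starts at the prescribed point
  \<open>z\<close>.\<close>

lemma quotient_dist_less:
  assumes "P \<in> quotient_space \<Delta>" "Q \<in> quotient_space \<Delta>" "z \<in> P" "quotient_dist P Q < e"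
  obtains w where "w \<in> Q" "upper_dist z w < e"
proof -
  obtain q where "q \<in> Q" using quotient_elem_nonempty[OF assms(2)] by blast
  then have "{upper_dist x y | x y. x \<in> P \<and> y \<in> Q} \<noteq> {}" using assms(3) by blast
  then obtain x y where xy: "x \<in> P" "y \<in> Q" "upper_dist x y < e"
    using cInf_lessD[OF _ assms(4)[unfolded quotient_dist_def]] by blast
  have up: "x \<in> upper" "y \<in> upper" using xy quotient_elem assms by blast+
  have "z \<in> orbit_of \<Delta> x" using quotient_elem[OF assms(1) xy(1)] assms(3) by simp
  then obtain \<gamma> where \<gamma>: "\<gamma> \<in> \<Delta>" "z = act \<gamma> x" by (auto simp: orbit_of_def)
  have "act \<gamma> y \<in> Q" using quotient_elem[OF assms(2) xy(2)] \<gamma>(1) by (auto simp: orbit_of_def)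
  moreover have "upper_dist z (act \<gamma> y) < e" using upper_dist_act[OF in_G[OF \<gamma>(1)] up] \<gamma> xy by simp
  ultimately show ?thesis using that by blast
qed

end

section \<open>Groups with displacement bounded below: lifting closed geodesics\<close>

text \<open>The interface between arithmetic and geometry: the systole and volume estimates for a
  congruence subgroup start from this uniform bound \<open>L\<close>.\<close>

locale displaced =
  fixes \<Delta> :: "'r::finite psl set" and L :: real
  assumes subgroup: "subgroup \<Delta> G" and L_pos: "L > 0"
    and displacement: "\<gamma> \<in> \<Delta> \<Longrightarrow> \<gamma> \<noteq> \<one>\<^bsub>G\<^esub> \<Longrightarrow> z \<in> upper \<Longrightarrow> L \<le> upper_dist z (act \<gamma> z)"
begin

lemma orbit_unique:
  assumes "Q \<in> quotient_space \<Delta>" "w \<in> Q" "w' \<in> Q" "upper_dist w w' < L"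
  shows "w' = w"
proof -
  have w: "w \<in> upper" "w' \<in> orbit_of \<Delta> w" using quotient_elem[OF subgroup assms(1,2)] assms(3) by auto
  then obtain \<gamma> where \<gamma>: "\<gamma> \<in> \<Delta>" "w' = act \<gamma> w" by (auto simp: orbit_of_def)
  then have "\<gamma> = \<one>\<^bsub>G\<^esub>" using displacement[OF \<gamma>(1) _ w(1)] assms(4) by force
  then show ?thesis using \<gamma>(2) by (simp add: act_one)
qed

lemma orbit_unique_near:
  assumes "Q \<in> quotient_space \<Delta>" "w \<in> Q" "w' \<in> Q" "z \<in> upper"
    "upper_dist z w < L / 2" "upper_dist z w' < L / 2"
  shows "w' = w"
proof -
  have "w \<in> upper" "w' \<in> upper" using quotient_elem[OF subgroup assms(1)] assms by blast+
  then have "upper_dist w w' \<le> upper_dist w z + upper_dist z w'" using upper_dist_triangle assms(4) by blast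
  then show ?thesis using orbit_unique[OF assms(1-3)] assms(5,6) upper_dist_commute[of w z] by linarith
qed

text \<open>Every point over \<open>c a\<close> is allowed as a start, so that lifts over adjacent
  intervals can be concatenated. The last conjunct carries along the bound of the displacement by
  the length.\<close>

definition lifts :: "(real \<Rightarrow> (complex^'r) set) \<Rightarrow> real \<Rightarrow> real \<Rightarrow> bool" where
  "lifts c a b \<longleftrightarrow> (\<forall>z\<in>c a. \<exists>f. continuous_on {a..b} f \<and> f a = z \<and>
     (\<forall>t\<in>{a..b}. f t \<in> c t) \<and> upper_dist z (f b) \<le> b - a)"

lemma lifts_trans:
  assumes c: "range c \<subseteq> quotient_space \<Delta>" and ab: "lifts c a b" "lifts c b d" "a \<le> b" "b \<le> d"
  shows "lifts c a d"
  unfolding lifts_def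
proof
  fix z assume z: "z \<in> c a"
  obtain f where f: "continuous_on {a..b} f" "f a = z" "\<And>t. t \<in> {a..b} \<Longrightarrow> f t \<in> c t" "upper_dist z (f b) \<le> b - a"
    using ab(1) z unfolding lifts_def by blast
  have fb: "f b \<in> c b" using f(3) ab(3) by simp
  obtain g where g: "continuous_on {b..d} g" "g b = f b" "\<And>t. t \<in> {b..d} \<Longrightarrow> g t \<in> c t" "upper_dist (f b) (g d) \<le> d - b"
    using ab(2) fb unfolding lifts_def by blast
  have gd: "g d \<in> c d" using g(3) ab(4) by simp
  define h where "h = (\<lambda>t. if t \<le> b then f t else g t)"
  have "continuous_on ({a..b} \<union> {b..d}) h"
    unfolding h_def using f(1) g(1,2)
    by (intro continuous_on_cases) auto
  moreover have "{a..b} \<union> {b..d} = {a..d}" using ab by auto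
  moreover have "h a = z" using f(2) ab(3) by (simp add: h_def)
  moreover have "\<forall>t\<in>{a..d}. h t \<in> c t" using f(3) g(3) by (simp add: h_def)
  moreover have "h d = g d" using ab(4) g(2) by (auto simp: h_def)
  moreover have "upper_dist z (g d) \<le> d - a"
  proof -
    have "z \<in> upper" "f b \<in> upper" "g d \<in> upper"
      using quotient_elem(1)[OF subgroup] c z fb gd by (meson range_subsetD)+
    then have "upper_dist z (g d) \<le> upper_dist z (f b) + upper_dist (f b) (g d)" by (rule upper_dist_triangle)
    then show ?thesis using f(4) g(4) by simp
  qed
  ultimately show "\<exists>f. continuous_on {a..d} f \<and> f a = z \<and> (\<forall>t\<in>{a..d}. f t \<in> c t) \<and> upper_dist z (f d) \<le> d - a"
    by (intro exI[of _ h]) auto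
qed

text \<open>Over an interval shorter than \<open>L / 4\<close>, each orbit \<open>c t\<close> has a
  point within \<open>L / 4\<close> of the start \<open>z\<close>. Orbit points within
  \<open>L / 2\<close> of \<open>z\<close> are unique, so the choices fit together, and they inherit
  the isometry property of \<open>c\<close> as a Lipschitz bound.\<close>

lemma lifts_local:
  assumes c: "range c \<subseteq> quotient_space \<Delta>" and ab: "a \<le> b" "b - a < L / 4"
    and iso: "\<And>s t. s \<in> {a..b} \<Longrightarrow> t \<in> {a..b} \<Longrightarrow> quotient_dist (c s) (c t) = \<bar>s - t\<bar>"
  shows "lifts c a b"
  unfolding lifts_def
proof
  fix z assume z: "z \<in> c a"
  have cq: "c t \<in> quotient_space \<Delta>" for t using c by blast
  have up: "w \<in> upper" if "w \<in> c t" for w t using quotient_elem(1)[OF subgroup cq that] .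
  have "\<forall>t\<in>{a..b}. \<exists>w. w \<in> c t \<and> upper_dist z w < L / 4"
  proof
    fix t assume t: "t \<in> {a..b}"
    have "quotient_dist (c a) (c t) < L / 4" using iso[of a t] t ab by auto
    then show "\<exists>w. w \<in> c t \<and> upper_dist z w < L / 4"
      using quotient_dist_less[OF subgroup cq cq z] by blast
  qed
  then obtain f where f: "\<And>t. t \<in> {a..b} \<Longrightarrow> f t \<in> c t" "\<And>t. t \<in> {a..b} \<Longrightarrow> upper_dist z (f t) < L / 4"
    by metis
  \<comment> \<open>If \<open>f t\<close> were too far from \<open>f s\<close>, another point
    \<open>w\<close> of the orbit \<open>c t\<close> would be nearer to \<open>f s\<close>. Then
    \<open>w\<close> is within \<open>L / 4 + L / 4\<close> of \<open>z\<close> and must equal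
    \<open>f t\<close>.\<close>
  have lip: "upper_dist (f s) (f t) \<le> \<bar>s - t\<bar>" if st: "s \<in> {a..b}" "t \<in> {a..b}" for s t
  proof (rule ccontr)
    assume not: "\<not> upper_dist (f s) (f t) \<le> \<bar>s - t\<bar>"
    have "quotient_dist (c s) (c t) < min (L / 4) (upper_dist (f s) (f t))"
    proof -
      have "\<bar>s - t\<bar> \<le> b - a" using st by auto
      then show ?thesis using iso[OF st] not ab(2) by linarith
    qed
    then obtain w where w: "w \<in> c t" "upper_dist (f s) w < min (L / 4) (upper_dist (f s) (f t))"
      using quotient_dist_less[OF subgroup cq cq f(1)[OF st(1)]] by blast
    have "upper_dist z w \<le> upper_dist z (f s) + upper_dist (f s) w"
      by (rule upper_dist_triangle[OF up[OF z] up[OF f(1)[OF st(1)]] up[OF w(1)]])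
    then have "upper_dist z w < L / 2" using w(2) f(2)[OF st(1)] by simp
    then have "f t = w"
      using orbit_unique_near[OF cq w(1) f(1)[OF st(2)] up[OF z]] f(2)[OF st(2)] L_pos by simp
    then show False using w(2) by simp
  qed
  have "continuous_on {a..b} f"
    unfolding continuous_on_iff
  proof (intro ballI allI impI)
    fix s e :: real assume s: "s \<in> {a..b}" and "0 < e"
    obtain \<delta> where \<delta>: "\<delta> > 0" "\<And>w. w \<in> upper \<Longrightarrow> upper_dist (f s) w < \<delta> \<Longrightarrow> dist (f s) w < e"
      using upper_dist_close[OF up[OF f(1)[OF s]] \<open>0 < e\<close>] by blast
    have "dist (f t) (f s) < e" if "t \<in> {a..b}" "dist t s < \<delta>" for t
    proof -
      have "upper_dist (f s) (f t) < \<delta>"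
        using lip[OF s that(1)] that(2) by (simp add: dist_real_def abs_minus_commute)
      then show ?thesis using \<delta>(2)[OF up[OF f(1)[OF that(1)]]] by (simp add: dist_commute)
    qed
    then show "\<exists>d>0. \<forall>t\<in>{a..b}. dist t s < d \<longrightarrow> dist (f t) (f s) < e" using \<delta>(1) by blast
  qed
  moreover have fa: "f a = z"
    using orbit_unique_near[OF cq z f(1)[of a] up[OF z]] f(2)[of a] ab(1) L_pos upper_dist_self[of z] by simp
  moreover have "upper_dist z (f b) \<le> b - a" using lip[of a b] fa ab(1) by simp
  ultimately show "\<exists>f. continuous_on {a..b} f \<and> f a = z \<and> (\<forall>t\<in>{a..b}. f t \<in> c t) \<and> upper_dist z (f b) \<le> b - a"
    using f(1) by blast
qed

text \<open>Bisection: liftability passes to concatenated intervals and holds on all short intervals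
  around each parameter, hence on the whole period.\<close>

lemma closed_geodesic_lifts:
  assumes "closed_geodesic \<Delta> c l"
  shows "lifts c 0 l"
proof (rule Bolzano[where P = "lifts c"])
  have c: "range c \<subseteq> quotient_space \<Delta>" using assms by (simp add: closed_geodesic_def)
  show "0 \<le> l" using assms by (simp add: closed_geodesic_def)
  show "lifts c a d" if "lifts c a b" "lifts c b d" "a \<le> b" "b \<le> d" for a b d
    using lifts_trans[OF c that] .
  fix x :: real
  obtain \<epsilon> where \<epsilon>: "\<epsilon> > 0" "\<And>s s'. s \<in> {x-\<epsilon><..<x+\<epsilon>} \<Longrightarrow> s' \<in> {x-\<epsilon><..<x+\<epsilon>} \<Longrightarrow> quotient_dist (c s) (c s') = \<bar>s - s'\<bar>"
    using assms unfolding closed_geodesic_def by meson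
  have "lifts c a b" if "a \<le> x" "x \<le> b" "b - a < min \<epsilon> (L / 4)" for a b
    using that by (intro lifts_local[OF c] \<epsilon>(2)) auto
  then show "\<exists>d>0. \<forall>a b. a \<le> x \<and> x \<le> b \<and> b - a < d \<longrightarrow> lifts c a b"
    using \<epsilon>(1) L_pos by (intro exI[of _ "min \<epsilon> (L / 4)"]) auto
qed

text \<open>The lift is contracted along segments to its starting point inside the convex set
  \<open>upper\<close>, and the homotopy is projected. Each intermediate curve is closed because the
  lift is.\<close>

lemma contractible_if_lift_closed:
  assumes f: "continuous_on {0..l} f" "f 0 = f l" "0 \<le> l" and fc: "\<And>t. t \<in> {0..l} \<Longrightarrow> f t \<in> c t"
    and c: "range c \<subseteq> quotient_space \<Delta>"
  shows "contractible_loop \<Delta> c l"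
proof -
  have up: "f t \<in> upper" "c t = orbit_of \<Delta> (f t)" if "t \<in> {0..l}" for t
    using quotient_elem[OF subgroup _ fc[OF that]] c by blast+
  define z where "z = f 0"
  have z: "z \<in> upper" using up[of 0] assms(3) by (simp add: z_def)
  define H where "H = (\<lambda>(s, t). (1 - s) *\<^sub>R f t + s *\<^sub>R z)"
  have "continuous_on ({0..1} \<times> {0..l}) H"
    unfolding H_def split_def
    by (intro continuous_intros continuous_on_compose2[OF f(1) continuous_on_snd[OF continuous_on_id]]) auto
  moreover have "H ` ({0..1} \<times> {0..l}) \<subseteq> upper"
    using convexD_alt[OF convex_upper _ z] up by (force simp: H_def)
  ultimately have H: "continuous_map (top_of_set ({0..1} \<times> {0..l})) (top_of_set upper) H"
    by auto
  have "continuous_map (prod_topology (top_of_set {0..1}) (top_of_set {0..l})) (quotient_topology \<Delta>) (orbit_of \<Delta> \<circ> H)"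
    using continuous_map_compose[OF H continuous_map_orbit_of[OF subgroup]]
    by (simp only: prod_topology_subtopology_eu)
  then have "homotopic_with (\<lambda>h. h 0 = h l) (top_of_set {0..l}) (quotient_topology \<Delta>)
      (\<lambda>t. orbit_of \<Delta> (f t)) (\<lambda>_. orbit_of \<Delta> z)"
    unfolding homotopic_with_def
    by (intro exI[of _ "orbit_of \<Delta> \<circ> H"]) (auto simp: H_def f(2))
  then have "homotopic_with (\<lambda>h. h 0 = h l) (top_of_set {0..l}) (quotient_topology \<Delta>) c (\<lambda>_. orbit_of \<Delta> z)"
    using up f(3) by (rule_tac homotopic_with_eq) auto
  then show ?thesis unfolding contractible_loop_def by blast
qed

lemma sys1_ge: "sys1 \<Delta> \<ge> ereal L"
  unfolding sys1_def
proof (rule Inf_greatest, clarify)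
  fix l c assume c: "closed_geodesic \<Delta> c l" and nc: "\<not> contractible_loop \<Delta> c l"
  have l: "l > 0" "range c \<subseteq> quotient_space \<Delta>" "c l = c 0"
    using c unfolding closed_geodesic_def by (auto dest: spec[of _ 0])
  obtain z where z: "z \<in> c 0" "z \<in> upper" using quotient_elem_nonempty[OF subgroup] l(2) by blast
  obtain f where f: "continuous_on {0..l} f" "f 0 = z" "\<And>t. t \<in> {0..l} \<Longrightarrow> f t \<in> c t" "upper_dist z (f l) \<le> l"
    using closed_geodesic_lifts[OF c] z(1) unfolding lifts_def by auto
  have "f l \<in> c 0" using f(3)[of l] l by simp
  moreover have "c 0 = orbit_of \<Delta> z" using quotient_elem(2)[OF subgroup _ z(1)] l(2) by blast
  ultimately obtain \<gamma> where \<gamma>: "\<gamma> \<in> \<Delta>" "f l = act \<gamma> z" by (auto simp: orbit_of_def)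
  have "\<gamma> \<noteq> \<one>\<^bsub>G\<^esub>"
  proof
    assume "\<gamma> = \<one>\<^bsub>G\<^esub>"
    then have "f 0 = f l" using \<gamma>(2) f(2) by (simp add: act_one)
    then have "contractible_loop \<Delta> c l" using contractible_if_lift_closed[OF f(1) _ _ f(3) l(2)] l(1) by simp
    then show False using nc by simp
  qed
  then show "ereal L \<le> ereal l" using displacement[OF \<gamma>(1) _ z(2)] \<gamma>(2) f(4) by simp
qed

end

section \<open>Invariance of the volume\<close>

text \<open>The change of variables theorem concerns maps of \<open>real^n\<close>; these two maps
  carry the plane to \<open>real^2\<close> and back.\<close>

definition c2v :: "complex \<Rightarrow> real^2" where "c2v z = vector [Re z, Im z]"
definition v2c :: "real^2 \<Rightarrow> complex" where "v2c v = Complex (v$1) (v$2)"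

lemma c2v_component [simp]: "c2v z $ 1 = Re z" "c2v z $ 2 = Im z"
  by (simp_all add: c2v_def)

lemma v2c_simps [simp]: "Re (v2c v) = v$1" "Im (v2c v) = v$2" "v2c (c2v z) = z" "c2v (v2c v) = v"
  by (simp_all add: v2c_def complex_eq_iff Finite_Cartesian_Product.vec_eq_iff forall_2)

lemma bounded_linear_v2c: "bounded_linear v2c"
  by (rule linear_conv_bounded_linear[THEN iffD1], rule linearI) (simp_all add: complex_eq_iff)

lemma bounded_linear_c2v: "bounded_linear c2v"
  by (rule linear_conv_bounded_linear[THEN iffD1], rule linearI)
     (simp_all add: Finite_Cartesian_Product.vec_eq_iff forall_2)

lemma measurable_v2c [measurable]: "v2c \<in> borel \<rightarrow>\<^sub>M borel" and measurable_c2v [measurable]: "c2v \<in> borel \<rightarrow>\<^sub>M borel"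
  using bounded_linear_v2c bounded_linear_c2v
  by (auto intro!: borel_measurable_continuous_onI linear_continuous_on)

lemma c2v_image: "c2v ` U = v2c -` U"
  by (auto simp: image_iff) (metis v2c_simps(4))

lemma Basis_real2: "(Basis :: (real^2) set) = {axis 1 1, axis 2 1}"
  by (auto simp: Basis_vec_def UNIV_2)

lemma axis_12_neq: "axis 1 (1::real) \<noteq> (axis 2 1 :: real^2)"
  by (simp add: axis_eq_axis)

lemma lborel_complex: "(lborel :: complex measure) = distr lborel borel v2c"
proof (rule lborel_eqI)
  fix l u :: complex assume lu: "\<And>b. b \<in> Basis \<Longrightarrow> l \<bullet> b \<le> u \<bullet> b"
  have "Re l \<le> Re u" "Im l \<le> Im u" using lu[of 1] lu[of \<i>] by (auto simp: Basis_complex_def)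
  moreover have "v2c -` box l u = box (c2v l) (c2v u)"
    by (auto simp: mem_box Basis_complex_def Basis_real2 inner_axis)
  ultimately show "emeasure (distr lborel borel v2c) (box l u) = (\<Prod>b\<in>Basis. (u - l) \<bullet> b)"
    using axis_12_neq
    by (simp add: emeasure_distr emeasure_lborel_box_eq Basis_real2 inner_axis Basis_complex_def complex_eq_iff)
qed simp

text \<open>A bridge between measures and the change of variables theorem, which speaks of absolute
  integrability. The infinite value records failure of integrability, so that sets of infinite
  measure are covered as well.\<close>

lemma nn_integral_absolutely_integrable:
  fixes h :: "real^2 \<Rightarrow> real"
  assumes S: "S \<in> sets borel" and h: "h \<in> borel_measurable borel" and nn: "\<And>x. x \<in> S \<Longrightarrow> h x \<ge> 0"
  shows "(\<integral>\<^sup>+x. ennreal (indicator S x * h x) \<partial>lborel) =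
    (if h absolutely_integrable_on S then ennreal (integral S h) else \<infinity>)"
proof -
  have nn': "0 \<le> indicator S x * h x" for x using nn by (simp add: indicator_def)
  have mb: "(\<lambda>x. indicator S x * h x) \<in> borel_measurable borel" using S h by measurable
  then have ml: "(\<lambda>x. indicator S x * h x) \<in> borel_measurable lebesgue"
    by (simp add: measurable_completion)
  have eq: "(\<integral>\<^sup>+x. ennreal (indicator S x * h x) \<partial>lborel) = (\<integral>\<^sup>+x. ennreal (indicator S x * h x) \<partial>lebesgue)"
    by (simp add: nn_integral_completion)
  show ?thesis
  proof (cases "h absolutely_integrable_on S")
    case True
    then have int: "integrable lebesgue (\<lambda>x. indicator S x * h x)" by (simp add: set_integrable_def)
    have "(\<integral>\<^sup>+x. ennreal (indicator S x * h x) \<partial>lebesgue) = ennreal (\<integral>x. indicator S x * h x \<partial>lebesgue)"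
      by (rule nn_integral_eq_integral[OF int]) (simp add: nn')
    also have "(\<integral>x. indicator S x * h x \<partial>lebesgue) = integral S h"
      using set_lebesgue_integral_eq_integral(2)[OF True] by (simp add: set_lebesgue_integral_def)
    finally show ?thesis using True eq by simp
  next
    case False
    then have "\<not> integrable lebesgue (\<lambda>x. indicator S x * h x)" by (simp add: set_integrable_def)
    then have "\<not> (\<integral>\<^sup>+x. ennreal (indicator S x * h x) \<partial>lebesgue) < \<infinity>"
      using integrableI_nonneg[OF ml] nn' by auto
    then show ?thesis using False eq by (simp add: less_top[symmetric])
  qed
qed

definition hyp_meas :: "complex measure" where
  "hyp_meas = density lborel (\<lambda>z. ennreal (indicator {z. Im z > 0} z * (1 / (Im z)\<^sup>2)))"

lemma sets_hyp_meas [simp, measurable_cong]: "sets hyp_meas = sets borel"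
  by (simp add: hyp_meas_def)

lemma space_hyp_meas [simp]: "space hyp_meas = UNIV"
  by (simp add: hyp_meas_def)

lemma measurable_hyp_density [measurable]:
  "(\<lambda>z. indicator {z. Im z > 0} z * (1 / (Im z)\<^sup>2)) \<in> borel_measurable borel"
proof -
  have "{z. Im z > 0} \<in> sets borel" by (intro borel_open open_Collect_less continuous_intros)
  then show ?thesis by measurable
qed

lemma emeasure_hyp_meas:
  assumes U: "U \<in> sets borel" "U \<subseteq> {z. Im z > 0}"
  shows "emeasure hyp_meas U = (\<integral>\<^sup>+v. ennreal (indicator (c2v ` U) v * (1 / (v$2)\<^sup>2)) \<partial>lborel)"
proof -
  have "emeasure hyp_meas U = (\<integral>\<^sup>+z. ennreal (indicator {z. Im z > 0} z * (1 / (Im z)\<^sup>2)) * indicator U z \<partial>lborel)"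
    unfolding hyp_meas_def using U by (intro emeasure_density) simp_all
  also have "\<dots> = (\<integral>\<^sup>+z. ennreal (indicator U z * (1 / (Im z)\<^sup>2)) \<partial>lborel)"
    using U(2) by (intro nn_integral_cong) (auto simp: indicator_def)
  also have "\<dots> = (\<integral>\<^sup>+v. ennreal (indicator U (v2c v) * (1 / (Im (v2c v))\<^sup>2)) \<partial>lborel)"
    unfolding lborel_complex using U(1) by (subst nn_integral_distr) simp_all
  also have "\<dots> = (\<integral>\<^sup>+v. ennreal (indicator (c2v ` U) v * (1 / (v$2)\<^sup>2)) \<partial>lborel)"
    by (intro nn_integral_cong) (simp add: c2v_image indicator_def)
  finally show ?thesis .
qed

lemma det_matrix_complex_mult:
  "det (matrix (\<lambda>v. c2v (k * v2c v))) = (cmod k)\<^sup>2"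
  unfolding cmod_power2
  by (simp add: det_2 matrix_def Finite_Cartesian_Product.axis_def power2_eq_square)

lemma moebius_has_field_derivative:
  assumes "det A = 1" "Im z > 0"
  shows "(moebius A has_field_derivative 1 / (moebius_denom A z)\<^sup>2) (at z)"
proof -
  have d: "moebius_denom A z \<noteq> 0" using moebius_denom_nonzero[OF assms] .
  have "complex_of_real (A$1$1 * A$2$2 - A$1$2 * A$2$1) = 1" using assms(1) by (simp add: det_2)
  then have *: "of_real (A$1$1) * of_real (A$2$2) - of_real (A$1$2) * of_real (A$2$1) = (1 :: complex)" by simp
  have "((\<lambda>z. (of_real (A$1$1) * z + of_real (A$1$2)) / (of_real (A$2$1) * z + of_real (A$2$2))) has_field_derivative
     (of_real (A$1$1) * (of_real (A$2$1) * z + of_real (A$2$2)) - (of_real (A$1$1) * z + of_real (A$1$2)) * of_real (A$2$1)) /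
     ((of_real (A$2$1) * z + of_real (A$2$2)) * (of_real (A$2$1) * z + of_real (A$2$2)))) (at z)"
    using d unfolding moebius_denom_def by (auto intro!: derivative_eq_intros)
  also have "of_real (A$1$1) * (of_real (A$2$1) * z + of_real (A$2$2)) - (of_real (A$1$1) * z + of_real (A$1$2)) * of_real (A$2$1) = (1 :: complex)"
    using * by (simp add: algebra_simps)
  finally show ?thesis by (simp add: moebius_def[abs_def] moebius_denom_def power2_eq_square)
qed

lemma moebius_minv:
  assumes "det A = 1" "Im z > 0"
  shows "moebius (minv A) (moebius A z) = z" "moebius A (moebius (minv A) z) = z"
  using moebius_mult[of "minv A" A z] moebius_mult[of A "minv A" z] assms
  by (simp_all add: det_minv minv_mult moebius_one)

lemma measurable_moebius [measurable]: "moebius A \<in> borel \<rightarrow>\<^sub>M borel"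
  unfolding moebius_def[abs_def] by measurable

lemma moebius_image_eq:
  assumes "det A = 1" "U \<subseteq> {z. Im z > 0}"
  shows "moebius A ` U = {z. Im z > 0} \<inter> moebius (minv A) -` U"
proof
  show "moebius A ` U \<subseteq> {z. Im z > 0} \<inter> moebius (minv A) -` U"
    using assms by (auto simp: Im_moebius_pos moebius_minv)
  show "{z. Im z > 0} \<inter> moebius (minv A) -` U \<subseteq> moebius A ` U"
    using moebius_minv(2)[OF assms(1)] by (auto simp: image_iff) metis
qed

text \<open>With \<open>D\<close> the modulus of the automorphy factor, the Jacobian is
  \<open>1 / D ^ 4\<close>, while the density at the image is that at the point times
  \<open>D ^ 4\<close>. The two factors cancel in \<open>dens\<close>.\<close>

lemma emeasure_hyp_meas_image:
  assumes A: "det A = 1" and U: "U \<in> sets borel" "U \<subseteq> {z. Im z > 0}"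
  shows "emeasure hyp_meas (moebius A ` U) = emeasure hyp_meas U"
proof -
  define S where "S = c2v ` U"
  define g where "g v = c2v (moebius A (v2c v))" for v
  define g' where "g' v = (\<lambda>h. c2v (1 / (moebius_denom A (v2c v))\<^sup>2 * v2c h))" for v
  have S: "S \<in> sets borel" unfolding S_def c2v_image using U(1) by (rule measurable_sets_borel[OF measurable_v2c])
  have Sp: "Im (v2c v) > 0" if "v \<in> S" for v using that U(2) by (auto simp: S_def)
  have gS: "g ` S = c2v ` (moebius A ` U)" by (simp add: g_def S_def image_image)
  have H: "{z. Im z > 0} \<in> sets borel" by (intro borel_open open_Collect_less continuous_intros)
  have AU: "moebius A ` U \<in> sets borel" "moebius A ` U \<subseteq> {z. Im z > 0}"
  proof -
    have "moebius (minv A) -` U \<in> sets borel" by (rule measurable_sets_borel[OF measurable_moebius U(1)])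
    then show "moebius A ` U \<in> sets borel" unfolding moebius_image_eq[OF A U(2)] using H by (rule sets.Int[rotated])
    show "moebius A ` U \<subseteq> {z. Im z > 0}" using U(2) by (auto simp: Im_moebius_pos[OF A])
  qed
  have gSb: "g ` S \<in> sets borel"
    unfolding gS c2v_image using AU(1) by (rule measurable_sets_borel[OF measurable_v2c])
  have der: "(g has_derivative g' v) (at v within S)" if "v \<in> S" for v
  proof -
    have "(moebius A has_derivative (\<lambda>h. 1 / (moebius_denom A (v2c v))\<^sup>2 * h)) (at (v2c v))"
      using moebius_has_field_derivative[OF A Sp[OF that]] unfolding has_field_derivative_def .
    then have "((\<lambda>v. moebius A (v2c v)) has_derivative (\<lambda>h. 1 / (moebius_denom A (v2c v))\<^sup>2 * v2c h)) (at v within S)"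
      by (rule has_derivative_compose[OF bounded_linear_imp_has_derivative[OF bounded_linear_v2c]])
    then show ?thesis unfolding g_def g'_def
      by (rule bounded_linear.has_derivative[OF bounded_linear_c2v])
  qed
  have inj: "inj_on g S"
  proof (rule inj_onI)
    fix v w assume vw: "v \<in> S" "w \<in> S" "g v = g w"
    then have "moebius A (v2c v) = moebius A (v2c w)" unfolding g_def by (metis v2c_simps(3))
    then have "v2c v = v2c w" using moebius_minv(1)[OF A] Sp[OF vw(1)] Sp[OF vw(2)] by metis
    then show "v = w" by (metis v2c_simps(4))
  qed
  \<comment> \<open>The integrand is given values in \<open>real^1\<close>, the form in which the
    change of variables theorem takes it.\<close>
  let ?f = "\<lambda>v :: real^2. vec (1 / (v$2)\<^sup>2) :: real^1"
  have dens: "\<bar>det (matrix (g' v))\<bar> *\<^sub>R ?f (g v) = ?f v" if "v \<in> S" for v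
  proof -
    have d: "moebius_denom A (v2c v) \<noteq> 0" using moebius_denom_nonzero[OF A Sp[OF that]] .
    have "\<bar>det (matrix (g' v))\<bar> = 1 / cmod (moebius_denom A (v2c v)) ^ 4"
      unfolding g'_def det_matrix_complex_mult by (simp add: norm_divide norm_power power_divide)
    moreover have "g v $ 2 = v$2 / (cmod (moebius_denom A (v2c v)))\<^sup>2"
      unfolding g_def using Im_moebius[OF A Sp[OF that]] by simp
    ultimately show ?thesis using d
      by (simp add: Finite_Cartesian_Product.vec_eq_iff power_divide power_mult[symmetric])
  qed
  have h: "(\<lambda>v :: real^2. 1 / (v$2)\<^sup>2) \<in> borel_measurable borel" by measurable
  have abs_eq: "(\<lambda>v. \<bar>det (matrix (g' v))\<bar> *\<^sub>R ?f (g v)) absolutely_integrable_on S \<longleftrightarrow> ?f absolutely_integrable_on S"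
    by (rule set_integrable_cong) (auto simp: dens)
  have int_eq: "integral S (\<lambda>v. \<bar>det (matrix (g' v))\<bar> *\<^sub>R ?f (g v)) = integral S ?f"
    by (rule integral_cong) (rule dens)
  \<comment> \<open>Integrability and value are transferred jointly, for every candidate value
    \<open>b\<close>; they are separated just below.\<close>
  have cov: "?f absolutely_integrable_on S \<and> integral S ?f = b \<longleftrightarrow> ?f absolutely_integrable_on (g ` S) \<and> integral (g ` S) ?f = b" for b
    using has_absolute_integral_change_of_variables[where S = S and g = g and g' = g' and f = ?f and b = b] S der inj abs_eq int_eq by simp
  have "(\<lambda>v::real^2. 1 / (v$2)\<^sup>2) absolutely_integrable_on S \<longleftrightarrow> (\<lambda>v::real^2. 1 / (v$2)\<^sup>2) absolutely_integrable_on (g ` S)"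
    using cov absolutely_integrable_on_1_iff[where f = ?f] by auto
  moreover have "integral S (\<lambda>v::real^2. 1 / (v$2)\<^sup>2) = integral (g ` S) (\<lambda>v. 1 / (v$2)\<^sup>2)" if "(\<lambda>v::real^2. 1 / (v$2)\<^sup>2) absolutely_integrable_on S"
    using cov[of "integral S ?f"] that absolutely_integrable_on_1_iff[where f = ?f] integral_on_1_eq[of S ?f] integral_on_1_eq[of "g ` S" ?f]
    by (auto simp: Finite_Cartesian_Product.vec_eq_iff)
  moreover note nn_integral_absolutely_integrable[OF S h] nn_integral_absolutely_integrable[OF gSb h]
  ultimately show ?thesis
    unfolding emeasure_hyp_meas[OF U] emeasure_hyp_meas[OF AU] gS[symmetric] S_def[symmetric]
    by (simp del: times_divide_eq_right mult_1_right split: if_split)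
qed

section \<open>The volume of the product space as a product measure\<close>

lemma product_sigma_finite_lborel: "product_sigma_finite (\<lambda>_::'r. lborel :: complex measure)"
  by (simp add: product_sigma_finite_def sigma_finite_lborel)

lemma product_sigma_finite_hyp_meas: "product_sigma_finite (\<lambda>_::'r. hyp_meas)"
proof -
  have "sigma_finite_measure hyp_meas"
    unfolding hyp_meas_def
    by (subst sigma_finite_measure.sigma_finite_iff_density_finite[OF sigma_finite_lborel]) auto
  then show ?thesis by (simp add: product_sigma_finite_def)
qed

lemma sets_PiM_hyp_meas [measurable_cong]:
  "sets (PiM UNIV (\<lambda>_::'r. hyp_meas)) = sets (PiM UNIV (\<lambda>_::'r. borel))"
  "sets (PiM UNIV (\<lambda>_::'r. lborel :: complex measure)) = sets (PiM UNIV (\<lambda>_::'r. borel))"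
  by (intro sets_PiM_cong; simp)+

lemma measurable_vec_lambda:
  "(vec_lambda :: ('r::finite \<Rightarrow> complex) \<Rightarrow> complex^'r) \<in> PiM UNIV (\<lambda>_. borel) \<rightarrow>\<^sub>M borel"
proof (subst borel_measurable_euclidean_space, intro ballI)
  fix b :: "complex^'r" assume "b \<in> Basis"
  then obtain i u where b: "b = axis i u" by (auto simp: Basis_vec_def)
  have "(\<lambda>f. f i \<bullet> u) \<in> borel_measurable (PiM UNIV (\<lambda>_::'r. borel :: complex measure))" by measurable
  then show "(\<lambda>f. vec_lambda f \<bullet> b) \<in> borel_measurable (PiM UNIV (\<lambda>_::'r. borel :: complex measure))"
    by (simp add: b inner_axis)
qed

lemma measurable_vec_lambda_PiM:
  "(vec_lambda :: ('r::finite \<Rightarrow> complex) \<Rightarrow> complex^'r) \<in> PiM UNIV (\<lambda>_. hyp_meas) \<rightarrow>\<^sub>M borel"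
  "(vec_lambda :: ('r::finite \<Rightarrow> complex) \<Rightarrow> complex^'r) \<in> PiM UNIV (\<lambda>_. lborel) \<rightarrow>\<^sub>M borel"
  by (subst measurable_cong_sets[OF sets_PiM_hyp_meas(1) refl], rule measurable_vec_lambda)
     (subst measurable_cong_sets[OF sets_PiM_hyp_meas(2) refl], rule measurable_vec_lambda)

text \<open>Both measures agree on boxes: the orthonormal basis of the product consists of the basis
  vectors of the factors, so the product of side lengths splits factor by factor.\<close>

lemma lborel_complex_vec:
  "(lborel :: (complex^'r::finite) measure) = distr (PiM UNIV (\<lambda>_. lborel)) borel vec_lambda"
proof (rule lborel_eqI)
  interpret product_sigma_finite "\<lambda>_::'r. lborel :: complex measure" by (rule product_sigma_finite_lborel)
  fix l u :: "complex^'r" assume lu: "\<And>b. b \<in> Basis \<Longrightarrow> l \<bullet> b \<le> u \<bullet> b"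
  have comp: "l $ i \<bullet> b \<le> u $ i \<bullet> b" if "b \<in> Basis" for i b
    using lu[of "axis i b"] that by (simp add: inner_axis)
  have "vec_lambda -` box l u = PiE UNIV (\<lambda>i. box (l $ i) (u $ i))"
    by (auto simp: mem_box PiE_def Pi_def Basis_vec_def inner_axis)
  moreover have "emeasure (distr (PiM UNIV (\<lambda>_. lborel)) borel vec_lambda) (box l u) =
      emeasure (PiM UNIV (\<lambda>_. lborel)) (vec_lambda -` box l u)"
    using measurable_vec_lambda_PiM(2) by (subst emeasure_distr) (auto simp: space_PiM)
  moreover have "emeasure (PiM UNIV (\<lambda>_. lborel)) (PiE UNIV (\<lambda>i. box (l $ i) (u $ i))) = (\<Prod>i\<in>UNIV. emeasure lborel (box (l $ i) (u $ i)))"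
    by (intro emeasure_PiM) auto
  moreover have "(\<Prod>i\<in>UNIV. emeasure lborel (box (l $ i) (u $ i))) = ennreal (\<Prod>i\<in>UNIV. \<Prod>b\<in>Basis. (u $ i - l $ i) \<bullet> b)"
    using comp by (simp add: prod_ennreal prod_nonneg inner_diff_left)
  moreover have "(\<Prod>i\<in>UNIV. \<Prod>b\<in>Basis. (u $ i - l $ i) \<bullet> b) = (\<Prod>b\<in>Basis. (u - l) \<bullet> b)"
  proof -
    have inj: "inj_on (\<lambda>(i, b). axis i b) (UNIV \<times> (Basis :: complex set))"
      by (auto simp: inj_on_def axis_eq_axis)
    have "(\<Prod>b\<in>Basis. (u - l) \<bullet> b) = (\<Prod>(i, b)\<in>UNIV \<times> Basis. (u - l) \<bullet> axis i b)"
    proof -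
      have "(Basis :: (complex^'r) set) = (\<lambda>(i, b). axis i b) ` (UNIV \<times> Basis)" by (auto simp: Basis_vec_def)
      then show ?thesis using prod.reindex[OF inj, of "\<lambda>v. (u - l) \<bullet> v"] by (simp add: o_def split_def)
    qed
    also have "\<dots> = (\<Prod>i\<in>UNIV. \<Prod>b\<in>Basis. (u - l) \<bullet> axis i b)" by (rule prod.cartesian_product[symmetric])
    finally show ?thesis by (simp add: inner_axis)
  qed
  ultimately show "emeasure (distr (PiM UNIV (\<lambda>_. lborel)) borel vec_lambda) (box l u) = ennreal (\<Prod>b\<in>Basis. (u - l) \<bullet> b)"
    by simp
qed simp

abbreviation hyp_density :: "complex \<Rightarrow> ennreal" where
  "hyp_density z \<equiv> ennreal (indicator {z. Im z > 0} z * (1 / (Im z)\<^sup>2))"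

lemma PiM_hyp_meas:
  "PiM UNIV (\<lambda>_::'r::finite. hyp_meas) = density (PiM UNIV (\<lambda>_. lborel)) (\<lambda>f. \<Prod>i\<in>UNIV. hyp_density (f i))"
proof (rule product_sigma_finite.PiM_eqI[OF product_sigma_finite_hyp_meas, symmetric])
  interpret product_sigma_finite "\<lambda>_::'r. lborel :: complex measure" by (rule product_sigma_finite_lborel)
  show "sets (density (PiM UNIV (\<lambda>_. lborel)) (\<lambda>f. \<Prod>i\<in>UNIV. hyp_density (f i))) = sets (PiM UNIV (\<lambda>_::'r. hyp_meas))"
    by (simp add: sets_PiM_hyp_meas)
  fix A :: "'r \<Rightarrow> complex set" assume "\<And>i. i \<in> UNIV \<Longrightarrow> A i \<in> sets hyp_meas"
  then have A: "A i \<in> sets borel" for i by simp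
  have m: "(\<lambda>f. \<Prod>i\<in>UNIV. hyp_density (f i)) \<in> borel_measurable (PiM UNIV (\<lambda>_::'r. lborel))"
    by (intro borel_measurable_prod_ennreal measurable_compose[OF measurable_component_singleton]) auto
  have mA: "PiE UNIV A \<in> sets (PiM UNIV (\<lambda>_::'r. lborel :: complex measure))"
    using A by (intro sets_PiM_I_finite) auto
  have "emeasure (density (PiM UNIV (\<lambda>_. lborel)) (\<lambda>f. \<Prod>i\<in>UNIV. hyp_density (f i))) (PiE UNIV A) =
      (\<integral>\<^sup>+f. (\<Prod>i\<in>UNIV. hyp_density (f i)) * indicator (PiE UNIV A) f \<partial>PiM UNIV (\<lambda>_. lborel))"
    using m mA by (rule emeasure_density)
  also have "\<dots> = (\<integral>\<^sup>+f. (\<Prod>i\<in>UNIV. hyp_density (f i) * indicator (A i) (f i)) \<partial>PiM UNIV (\<lambda>_. lborel))"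
  proof (intro nn_integral_cong)
    fix f :: "'r \<Rightarrow> complex"
    have "(indicator (PiE UNIV A) f :: ennreal) = (\<Prod>i\<in>UNIV. indicator (A i) (f i))"
      by (auto simp: indicator_def PiE_def Pi_def prod_zero_iff)
    then show "(\<Prod>i\<in>UNIV. hyp_density (f i)) * indicator (PiE UNIV A) f = (\<Prod>i\<in>UNIV. hyp_density (f i) * indicator (A i) (f i))"
      by (simp add: prod.distrib)
  qed
  also have "\<dots> = (\<Prod>i\<in>UNIV. \<integral>\<^sup>+z. hyp_density z * indicator (A i) z \<partial>lborel)"
    using A by (intro product_nn_integral_prod) auto
  also have "\<dots> = (\<Prod>i\<in>UNIV. emeasure hyp_meas (A i))"
    unfolding hyp_meas_def using A by (intro prod.cong refl emeasure_density[symmetric]) auto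
  finally show "emeasure (density (PiM UNIV (\<lambda>_. lborel)) (\<lambda>f. \<Prod>i\<in>UNIV. hyp_density (f i))) (PiE UNIV A) =
    (\<Prod>i\<in>UNIV. emeasure hyp_meas (A i))" .
qed simp

lemma upper_density_eq:
  "ennreal (indicator upper z * (\<Prod>i\<in>UNIV. 1 / (Im (z $ i))\<^sup>2)) = (\<Prod>i\<in>UNIV. hyp_density (z $ i))"
proof -
  have "(\<Prod>i\<in>UNIV. hyp_density (z $ i)) = ennreal (\<Prod>i\<in>UNIV. indicator {z. Im z > 0} (z $ i) * (1 / (Im (z $ i))\<^sup>2))"
    by (rule prod_ennreal) simp
  also have "(\<Prod>i\<in>UNIV. indicator {z. Im z > 0} (z $ i) * (1 / (Im (z $ i))\<^sup>2)) =
      (\<Prod>i\<in>UNIV. indicator {z. Im z > 0} (z $ i)) * (\<Prod>i\<in>UNIV. 1 / (Im (z $ i))\<^sup>2)"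
    by (rule prod.distrib)
  also have "(\<Prod>i\<in>UNIV. indicator {z. Im z > 0} (z $ i)) = (indicator upper z :: real)"
    by (auto simp: indicator_def upper_def prod_zero_iff)
  finally show ?thesis by simp
qed

lemma measurable_vec_nth [measurable]: "(\<lambda>z :: complex^'r::finite. z $ i) \<in> borel \<rightarrow>\<^sub>M borel"
  by (intro borel_measurable_continuous_onI continuous_intros)

lemma measurable_upper_density:
  "(\<lambda>z :: complex^'r::finite. \<Prod>i\<in>UNIV. hyp_density (z $ i)) \<in> borel_measurable borel"
  by (intro borel_measurable_prod_ennreal measurable_compose[OF measurable_vec_nth]) auto

text \<open>The product form reduces invariance under \<open>G\<close> and the volume of boxes to a
  single half-plane.\<close>

lemma upper_vol_eq_distr:
  "upper_vol = distr (PiM UNIV (\<lambda>_::'r::finite. hyp_meas)) borel vec_lambda"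
proof -
  have v: "vec_lambda \<in> PiM UNIV (\<lambda>_::'r. lborel :: complex measure) \<rightarrow>\<^sub>M borel"
    by (rule measurable_vec_lambda_PiM)
  have "upper_vol = density (distr (PiM UNIV (\<lambda>_::'r. lborel)) borel vec_lambda) (\<lambda>z. \<Prod>i\<in>UNIV. hyp_density (z $ i))"
    unfolding upper_vol_def upper_density_eq lborel_complex_vec[symmetric] ..
  also have "\<dots> = distr (density (PiM UNIV (\<lambda>_::'r. lborel)) (\<lambda>f. \<Prod>i\<in>UNIV. hyp_density (vec_lambda f $ i))) borel vec_lambda"
    by (rule density_distr[OF measurable_upper_density v])
  finally show ?thesis by (simp add: PiM_hyp_meas)
qed

lemma sets_upper_vol [simp, measurable_cong]: "sets upper_vol = sets borel"
  by (simp add: upper_vol_def)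

lemma space_upper_vol [simp]: "space upper_vol = UNIV"
  by (simp add: upper_vol_def)

lemma emeasure_upper_vol:
  assumes "U \<in> sets borel"
  shows "emeasure upper_vol U = (\<integral>\<^sup>+z. (\<Prod>i\<in>UNIV. hyp_density (z $ i)) * indicator U z \<partial>lborel)"
  unfolding upper_vol_def upper_density_eq using assms measurable_upper_density
  by (intro emeasure_density) auto

lemma upper_borel: "upper \<in> sets borel"
  by (intro borel_open open_upper)

lemma emeasure_upper_vol_Int_upper:
  assumes "U \<in> sets borel"
  shows "emeasure upper_vol (upper \<inter> U) = emeasure upper_vol U"
  using assms upper_borel
  by (subst (1 2) emeasure_upper_vol)
     (auto intro!: nn_integral_cong simp: indicator_def upper_density_eq[symmetric] upper_def)

lemma measurable_act:
  assumes "g \<in> carrier (G :: 'r::finite psl monoid)"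
  shows "act g \<in> borel \<rightarrow>\<^sub>M borel"
proof -
  obtain A where A: "\<And>i. det (A i) = 1" "g = psl A" using assms(1) carrier_G by blast
  have "(\<lambda>z. \<lambda>i\<in>UNIV. moebius (A i) (z $ i)) \<in> borel \<rightarrow>\<^sub>M PiM UNIV (\<lambda>_::'r. borel)"
    by (intro measurable_restrict) measurable
  from measurable_compose[OF this measurable_vec_lambda] show ?thesis
    by (simp add: A(2) act_psl[abs_def] restrict_def)
qed

lemma act_image_eq:
  assumes "g \<in> carrier G" "U \<subseteq> upper"
  shows "act g ` U = upper \<inter> act (inv\<^bsub>G\<^esub> g) -` U"
proof
  show "act g ` U \<subseteq> upper \<inter> act (inv\<^bsub>G\<^esub> g) -` U"
    using assms by (auto simp: act_upper act_inv_act)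
  show "upper \<inter> act (inv\<^bsub>G\<^esub> g) -` U \<subseteq> act g ` U"
    using act_inv_act(2)[OF assms(1)] by (auto simp: image_iff) metis
qed

lemma act_image_borel:
  assumes "g \<in> carrier G" "U \<subseteq> upper" "U \<in> sets borel"
  shows "act g ` U \<in> sets borel"
proof -
  have "act (inv\<^bsub>G\<^esub> g) -` U \<in> sets borel"
    by (rule measurable_sets_borel[OF measurable_act[OF group.inv_closed[OF group_G assms(1)]] assms(3)])
  then show ?thesis unfolding act_image_eq[OF assms(1,2)] using upper_borel by (rule sets.Int[rotated])
qed

text \<open>A product measure is determined by its values on products of sets, and each factor is
  invariant. The action is therefore treated as a coordinatewise map preserving the product of the
  \<open>hyp_meas\<close>.\<close>

lemma emeasure_upper_vol_act:
  assumes g: "g \<in> carrier (G :: 'r::finite psl monoid)" and U: "U \<subseteq> upper" "U \<in> sets borel"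
  shows "emeasure upper_vol (act g ` U) = emeasure upper_vol U"
proof -
  interpret product_sigma_finite "\<lambda>_::'r. hyp_meas" by (rule product_sigma_finite_hyp_meas)
  let ?P = "PiM UNIV (\<lambda>_::'r. hyp_meas)"
  \<comment> \<open>The image under \<open>g\<close> is, inside \<open>upper\<close>, the preimage
    under its inverse, and preimages are what \<open>distr\<close> measures.\<close>
  define h where "h = inv\<^bsub>G\<^esub> g"
  have h: "h \<in> carrier G" using g group.inv_closed[OF group_G] by (simp add: h_def)
  obtain A where A: "\<And>i. det (A i) = 1" "h = psl A" using h carrier_G by blast
  define T where "T f = (\<lambda>i. moebius (A i) (f i))" for f :: "'r \<Rightarrow> complex"
  have v: "vec_lambda \<in> ?P \<rightarrow>\<^sub>M borel"
    by (rule measurable_vec_lambda_PiM)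
  have T: "T \<in> ?P \<rightarrow>\<^sub>M ?P"
  proof -
    have "(\<lambda>f. \<lambda>i\<in>UNIV. moebius (A i) (f i)) \<in> ?P \<rightarrow>\<^sub>M ?P"
      by (intro measurable_restrict) measurable
    then show ?thesis by (simp add: T_def[abs_def] restrict_def)
  qed
  have H: "{z. Im z > 0} \<in> sets borel" by (intro borel_open open_Collect_less continuous_intros)
  have restrict: "emeasure hyp_meas B = emeasure hyp_meas ({z. Im z > 0} \<inter> B)" if "B \<in> sets borel" for B
    unfolding hyp_meas_def using that H
    by (subst (1 2) emeasure_density) (auto intro!: nn_integral_cong simp: indicator_def)
  have inv: "emeasure hyp_meas (moebius (A i) -` B) = emeasure hyp_meas B" if "B \<in> sets borel" for i B
  proof -
    have "emeasure hyp_meas (moebius (A i) -` B) = emeasure hyp_meas ({z. Im z > 0} \<inter> (moebius (A i) -` B))"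
      using that by (intro restrict measurable_sets_borel[OF measurable_moebius])
    also have "{z. Im z > 0} \<inter> (moebius (A i) -` B) = {z. Im z > 0} \<inter> (moebius (minv (minv (A i))) -` ({z. Im z > 0} \<inter> B))"
    proof -
      have "minv (minv (A i)) = A i" by (simp add: mat2_eq_iff minv_component)
      then show ?thesis using Im_moebius_pos[OF A(1)] by auto
    qed
    also have "\<dots> = moebius (minv (A i)) ` ({z. Im z > 0} \<inter> B)"
      using A(1) by (subst moebius_image_eq) (auto simp: det_minv)
    also have "emeasure hyp_meas \<dots> = emeasure hyp_meas ({z. Im z > 0} \<inter> B)"
      using A(1) that H by (intro emeasure_hyp_meas_image) (auto simp: det_minv)
    also have "\<dots> = emeasure hyp_meas B" using restrict[OF that] by simp
    finally show ?thesis .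
  qed
  have "distr ?P ?P T = ?P"
  proof (rule PiM_eqI)
    fix B :: "'r \<Rightarrow> complex set" assume "\<And>i. i \<in> UNIV \<Longrightarrow> B i \<in> sets hyp_meas"
    then have B: "B i \<in> sets borel" for i by simp
    have "emeasure (distr ?P ?P T) (PiE UNIV B) = emeasure ?P (T -` PiE UNIV B \<inter> space ?P)"
      using B by (intro emeasure_distr T sets_PiM_I_finite) auto
    also have "T -` PiE UNIV B \<inter> space ?P = PiE UNIV (\<lambda>i. moebius (A i) -` B i)"
      by (auto simp: T_def PiE_def Pi_def space_PiM)
    also have "emeasure ?P \<dots> = (\<Prod>i\<in>UNIV. emeasure hyp_meas (moebius (A i) -` B i))"
      using B by (intro emeasure_PiM) (auto intro!: measurable_sets_borel[OF measurable_moebius])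
    also have "\<dots> = (\<Prod>i\<in>UNIV. emeasure hyp_meas (B i))" using inv B by simp
    finally show "emeasure (distr ?P ?P T) (PiE UNIV B) = (\<Prod>i\<in>UNIV. emeasure hyp_meas (B i))" .
  qed simp_all
  then have "emeasure upper_vol U = emeasure (distr ?P ?P T) (vec_lambda -` U \<inter> space ?P)"
    using v U(2) by (simp add: upper_vol_eq_distr emeasure_distr)
  also have "\<dots> = emeasure ?P (T -` (vec_lambda -` U \<inter> space ?P) \<inter> space ?P)"
    using v U(2) by (intro emeasure_distr T measurable_sets)
  also have "T -` (vec_lambda -` U \<inter> space ?P) \<inter> space ?P = vec_lambda -` (act h -` U) \<inter> space ?P"
    by (auto simp: space_PiM T_def A(2) act_psl)
  also have "emeasure ?P \<dots> = emeasure upper_vol (act h -` U)"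
    using v U(2) measurable_act[OF h] by (simp add: upper_vol_eq_distr emeasure_distr measurable_sets_borel)
  also have "\<dots> = emeasure upper_vol (upper \<inter> act h -` U)"
    using U(2) measurable_act[OF h] by (simp add: emeasure_upper_vol_Int_upper measurable_sets_borel)
  also have "upper \<inter> act h -` U = act g ` U" unfolding h_def using act_image_eq[OF g U(1)] by simp
  finally show ?thesis by simp
qed

section \<open>The volume of a quotient\<close>

context displaced
begin

lemma carrier [simp]: "\<gamma> \<in> \<Delta> \<Longrightarrow> \<gamma> \<in> carrier G"
  using in_G[OF subgroup] .

lemma act_free:
  assumes "\<gamma> \<in> \<Delta>" "\<delta> \<in> \<Delta>" "z \<in> upper" "act \<gamma> z = act \<delta> z"
  shows "\<gamma> = \<delta>"
proof -
  interpret group G by (rule group_G)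
  have inv: "inv\<^bsub>G\<^esub> \<delta> \<otimes>\<^bsub>G\<^esub> \<gamma> \<in> \<Delta>"
    using assms subgroup.m_closed[OF subgroup] subgroup.m_inv_closed[OF subgroup] by blast
  have "act (inv\<^bsub>G\<^esub> \<delta> \<otimes>\<^bsub>G\<^esub> \<gamma>) z = act (inv\<^bsub>G\<^esub> \<delta>) (act \<gamma> z)"
    using assms by (intro act_mult) auto
  also have "\<dots> = z" using assms act_inv_act(1)[of \<delta> z] by simp
  finally have "inv\<^bsub>G\<^esub> \<delta> \<otimes>\<^bsub>G\<^esub> \<gamma> = \<one>\<^bsub>G\<^esub>"
    using displacement[OF inv _ assms(3)] L_pos upper_dist_self[of z] by force
  then show ?thesis using assms(1,2) by (metis carrier inv_equality inv_inv inv_closed)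
qed

definition sat :: "(complex^'r) set \<Rightarrow> (complex^'r) set" where
  "sat X = (\<Union>\<gamma>\<in>\<Delta>. act \<gamma> ` X)"

lemma sat_iff:
  assumes "X \<subseteq> upper" "z \<in> upper"
  shows "z \<in> sat X \<longleftrightarrow> (\<exists>w\<in>X. w \<in> orbit_of \<Delta> z)"
proof
  assume "z \<in> sat X"
  then obtain \<gamma> w where "\<gamma> \<in> \<Delta>" "w \<in> X" "z = act \<gamma> w" by (auto simp: sat_def)
  then show "\<exists>w\<in>X. w \<in> orbit_of \<Delta> z"
    using orbit_of_eq[OF subgroup, of w z] orbit_of_self[OF subgroup, of w] assms(1)
    by (auto simp: orbit_of_def)
next
  assume "\<exists>w\<in>X. w \<in> orbit_of \<Delta> z"
  then obtain w where w: "w \<in> X" "w \<in> orbit_of \<Delta> z" by blast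
  then have "z \<in> orbit_of \<Delta> w" using orbit_of_eq[OF subgroup assms(2) w(2)] orbit_of_self[OF subgroup] by simp
  then show "z \<in> sat X" using w(1) by (auto simp: sat_def orbit_of_def)
qed

lemma act_image_open:
  assumes "\<gamma> \<in> \<Delta>" "X \<subseteq> upper" "open X"
  shows "open (act \<gamma> ` X)"
proof -
  have "inv\<^bsub>G\<^esub> \<gamma> \<in> carrier G" by (rule group.inv_closed[OF group_G carrier[OF assms(1)]])
  then have "open (upper \<inter> act (inv\<^bsub>G\<^esub> \<gamma>) -` X)"
    by (rule continuous_open_preimage[OF continuous_on_act open_upper assms(3)])
  then show ?thesis unfolding act_image_eq[OF carrier[OF assms(1)] assms(2)] .
qed

definition small :: "(complex^'r) set \<Rightarrow> bool" where
  "small U \<longleftrightarrow> U \<subseteq> upper \<and> (\<forall>z\<in>U. \<forall>w\<in>U. upper_dist z w < L)"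

lemma small_orbit:
  assumes "small U" "z \<in> U" "w \<in> U" "w \<in> orbit_of \<Delta> z"
  shows "w = z"
proof -
  have "z \<in> upper" using assms by (auto simp: small_def)
  then show ?thesis
    using orbit_unique[OF orbit_of_in_quotient[OF subgroup], of z z w] orbit_of_self[OF subgroup] assms
    by (auto simp: small_def)
qed

lemma small_neighbourhood:
  assumes "z \<in> upper"
  defines "V \<equiv> {w \<in> upper. upper_dist z w < L / 2}"
  shows "open V" "z \<in> V" "small V"
proof -
  have "open (upper \<inter> upper_dist z -` {..<L / 2})"
    by (rule continuous_open_preimage[OF continuous_on_upper_dist[OF assms(1)] open_upper]) simp
  moreover have "V = upper \<inter> upper_dist z -` {..<L / 2}" by (auto simp: V_def)
  ultimately show "open V" by simp
  show "z \<in> V" using assms L_pos by (simp add: upper_dist_self)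
  show "small V"
    unfolding small_def
  proof (intro conjI ballI)
    fix u w assume "u \<in> V" "w \<in> V"
    then show "upper_dist u w < L"
      using upper_dist_triangle[of u z w] assms(1) upper_dist_commute[of u z] by (auto simp: V_def)
  qed (auto simp: V_def)
qed

text \<open>The translates of a small open set are open and pairwise disjoint, and a separable space
  has only countably many such sets. Countability lets unions over the group stay Borel and measures
  add up.\<close>

lemma countable_Delta: "countable \<Delta>"
proof -
  define z :: "complex^'r" where "z = (\<chi> i. \<i>)"
  have z: "z \<in> upper" by (simp add: z_def upper_def)
  define V where "V = {w \<in> upper. upper_dist z w < L / 2}"
  note V = small_neighbourhood[OF z, folded V_def]
  have Vup: "V \<subseteq> upper" by (auto simp: V_def)
  have disj: "\<gamma> = \<delta>" if gd: "\<gamma> \<in> \<Delta>" "\<delta> \<in> \<Delta>" "act \<gamma> ` V \<inter> act \<delta> ` V \<noteq> {}" for \<gamma> \<delta>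
  proof -
    obtain u w where uw: "u \<in> V" "w \<in> V" "act \<gamma> u = act \<delta> w" using gd(3) by blast
    have "act \<gamma> u \<in> orbit_of \<Delta> u" "act \<gamma> u \<in> orbit_of \<Delta> w"
      using gd imageI[of \<gamma> \<Delta> "\<lambda>g. act g u"] imageI[of \<delta> \<Delta> "\<lambda>g. act g w"] uw(3)
      unfolding orbit_of_def by simp_all
    then have "orbit_of \<Delta> w = orbit_of \<Delta> u"
      using orbit_of_eq[OF subgroup] uw Vup by (metis subsetD)
    then have "w \<in> orbit_of \<Delta> u" using orbit_of_self[OF subgroup, of w] by simp
    then have "w = u" using small_orbit[OF V(3) uw(1,2)] by simp
    then show ?thesis using act_free[OF gd(1,2)] uw Vup by auto
  qed
  have "countable ((\<lambda>\<gamma>. act \<gamma> ` V) ` \<Delta>)"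
  proof (rule countable_disjoint_open_subsets)
    show "open S" if "S \<in> (\<lambda>\<gamma>. act \<gamma> ` V) ` \<Delta>" for S using that act_image_open[OF _ Vup V(1)] by auto
    show "disjoint ((\<lambda>\<gamma>. act \<gamma> ` V) ` \<Delta>)"
      using disj by (auto simp: pairwise_def disjnt_def)
  qed
  moreover have "inj_on (\<lambda>\<gamma>. act \<gamma> ` V) \<Delta>"
    using disj V(2) by (intro inj_onI) blast
  ultimately show ?thesis by (rule countable_image_inj_on)
qed

lemma sat_borel: "X \<subseteq> upper \<Longrightarrow> X \<in> sets borel \<Longrightarrow> sat X \<in> sets borel"
  unfolding sat_def by (rule sets.countable_UN'[OF countable_Delta]) (auto intro!: act_image_borel)

lemma sat_open: "X \<subseteq> upper \<Longrightarrow> open X \<Longrightarrow> open (sat X)"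
  unfolding sat_def by (intro open_UN ballI act_image_open)

text \<open>By the Lindelof property countably many balls of radius \<open>L / 2\<close> suffice;
  each of them meets every orbit at most once.\<close>

lemma small_open_cover:
  obtains U :: "nat \<Rightarrow> (complex^'r) set" where "\<And>n. open (U n)" "\<And>n. small (U n)" "(\<Union>n. U n) = upper"
proof -
  define V where "V z = {w \<in> upper. upper_dist z w < L / 2}" for z :: "complex^'r"
  have V: "open (V z)" "z \<in> V z" "small (V z)" if "z \<in> upper" for z
    using small_neighbourhood[OF that] by (simp_all add: V_def)
  have "\<And>S. S \<in> V ` upper \<Longrightarrow> open S" using V(1) by blast
  then obtain \<F> where \<F>: "\<F> \<subseteq> V ` upper" "countable \<F>" "\<Union>\<F> = \<Union>(V ` upper)"
    using Lindelof[of "V ` upper"] by blast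
  have un: "\<Union>(V ` upper) = upper" using V(2) by (auto simp: V_def)
  have "(\<chi> i. (\<i> :: complex)) \<in> (upper :: (complex^'r) set)" by (simp add: upper_def)
  then have "\<F> \<noteq> {}" using \<F>(3) un by auto
  then have r: "range (from_nat_into \<F>) = \<F>" using \<F>(2) by (rule range_from_nat_into)
  have in_F: "from_nat_into \<F> n \<in> V ` upper" for n using from_nat_into[OF \<open>\<F> \<noteq> {}\<close>] \<F>(1) by blast
  show ?thesis
  proof
    show "open (from_nat_into \<F> n)" "small (from_nat_into \<F> n)" for n using in_F[of n] V by auto
    show "(\<Union>n. from_nat_into \<F> n) = upper" using r \<F>(3) un by simp
  qed
qed

section \<open>Borel transversals and the volume measure of the quotient\<close>

definition transversal :: "(complex^'r) set \<Rightarrow> bool" where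
  "transversal F \<longleftrightarrow> F \<in> sets borel \<and> F \<subseteq> upper \<and> (\<forall>z\<in>upper. \<exists>!w. w \<in> F \<and> w \<in> orbit_of \<Delta> z)"

text \<open>From each small open set \<open>U n\<close> the saturations of the earlier ones are
  removed. Every orbit is then represented only in the first \<open>U n\<close> that it meets, and
  there only once.\<close>

lemma transversal_exists: "\<exists>F. transversal F"
proof -
  obtain U :: "nat \<Rightarrow> (complex^'r) set" where U: "\<And>n. open (U n)" "\<And>n. small (U n)" "(\<Union>n. U n) = upper"
    by (rule small_open_cover) (rule that)
  have Uup: "U n \<subseteq> upper" for n using U(3) by blast
  define F where "F = (\<Union>n. U n - (\<Union>m<n. sat (U m)))"
  have "F \<in> sets borel"
    unfolding F_def using U(1) Uup
    by (intro sets.countable_UN sets.Diff sets.finite_UN image_subsetI borel_open sat_open) auto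
  moreover have "F \<subseteq> upper" using Uup by (auto simp: F_def)
  moreover have "\<exists>!w. w \<in> F \<and> w \<in> orbit_of \<Delta> z" if z: "z \<in> upper" for z
  proof (rule ex_ex1I)
    define n where "n = (LEAST n. z \<in> sat (U n))"
    have "\<exists>n. z \<in> sat (U n)"
    proof -
      obtain n where "z \<in> U n" using z U(3) by blast
      then have "z \<in> sat (U n)" using sat_iff[OF Uup z] orbit_of_self[OF subgroup] by blast
      then show ?thesis ..
    qed
    then have n: "z \<in> sat (U n)" "\<And>m. m < n \<Longrightarrow> z \<notin> sat (U m)"
      unfolding n_def by (auto intro: LeastI dest: not_less_Least)
    then obtain w where w: "w \<in> U n" "w \<in> orbit_of \<Delta> z" using sat_iff[OF Uup z] by blast
    have "w \<notin> sat (U m)" if "m < n" for m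
    proof -
      have "w \<in> upper" using w(1) Uup by blast
      then show ?thesis using n(2)[OF that] sat_iff[OF Uup z] sat_iff[OF Uup, of w m] orbit_of_eq[OF subgroup z w(2)] by simp
    qed
    then show "\<exists>w. w \<in> F \<and> w \<in> orbit_of \<Delta> z" using w unfolding F_def by blast
  next
    fix v w assume vw: "v \<in> F \<and> v \<in> orbit_of \<Delta> z" "w \<in> F \<and> w \<in> orbit_of \<Delta> z"
    obtain m where m: "v \<in> U m" "\<And>k. k < m \<Longrightarrow> v \<notin> sat (U k)" using vw unfolding F_def by blast
    obtain n where n: "w \<in> U n" "\<And>k. k < n \<Longrightarrow> w \<notin> sat (U k)" using vw unfolding F_def by blast
    have up: "v \<in> upper" "w \<in> upper" using m(1) n(1) Uup by blast+
    have o: "orbit_of \<Delta> v = orbit_of \<Delta> z" "orbit_of \<Delta> w = orbit_of \<Delta> z" using vw orbit_of_eq[OF subgroup z] by auto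
    then have "w \<in> orbit_of \<Delta> v" "v \<in> orbit_of \<Delta> w" 
      using orbit_of_self[OF subgroup, of w] orbit_of_self[OF subgroup, of v] by simp_all
    \<comment> \<open>Two representatives of one orbit, taken at stages \<open>m\<close> and
      \<open>n\<close>, each forbid the other stage from being earlier, so the stages agree.\<close>
    then have "v \<in> sat (U n)" "w \<in> sat (U m)" using sat_iff[OF Uup up(1)] sat_iff[OF Uup up(2)] m(1) n(1) by blast+
    then have "m = n" using m(2) n(2) by (metis linorder_neqE_nat)
    then show "v = w" using small_orbit[OF U(2), of w n v] m(1) n(1) \<open>v \<in> orbit_of \<Delta> w\<close> by simp
  qed
  ultimately have "transversal F" unfolding transversal_def by (intro conjI ballI)
  then show ?thesis ..
qed

lemma transversal_unique:
  assumes "transversal F" "v \<in> F" "w \<in> F" "w \<in> orbit_of \<Delta> v"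
  shows "v = w"
proof -
  have "v \<in> upper" using assms by (auto simp: transversal_def)
  then show ?thesis using assms orbit_of_self[OF subgroup, of v] unfolding transversal_def by blast
qed

lemma emeasure_transversal_sat:
  assumes F: "transversal F" and B: "B \<in> sets borel" "B \<subseteq> upper" "inj_on (orbit_of \<Delta>) B"
  shows "emeasure upper_vol (F \<inter> sat B) = emeasure upper_vol B"
proof -
  have Fb: "F \<in> sets borel" "F \<subseteq> upper" using F by (auto simp: transversal_def)
  have invD: "inv\<^bsub>G\<^esub> \<gamma> \<in> \<Delta>" if "\<gamma> \<in> \<Delta>" for \<gamma> using subgroup.m_inv_closed[OF subgroup that] .
  have orb: "orbit_of \<Delta> (act \<gamma> z) = orbit_of \<Delta> z" if "\<gamma> \<in> \<Delta>" "z \<in> upper" for \<gamma> z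
    using that by (intro orbit_of_eq[OF subgroup]) (auto simp: orbit_of_def)
  have "F \<inter> sat B = (\<Union>\<gamma>\<in>\<Delta>. F \<inter> act \<gamma> ` B)" by (auto simp: sat_def)
  then have "emeasure upper_vol (F \<inter> sat B) = (\<integral>\<^sup>+\<gamma>. emeasure upper_vol (F \<inter> act \<gamma> ` B) \<partial>count_space \<Delta>)"
  proof (simp only:, intro emeasure_UN_countable countable_Delta)
    show "F \<inter> act \<gamma> ` B \<in> sets upper_vol" if "\<gamma> \<in> \<Delta>" for \<gamma>
      using that Fb B by (auto intro!: sets.Int act_image_borel)
    \<comment> \<open>A common point gives two points of \<open>B\<close> in one orbit, equal by
      injectivity; freeness then identifies the group elements.\<close>
    show "disjoint_family_on (\<lambda>\<gamma>. F \<inter> act \<gamma> ` B) \<Delta>"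
      unfolding disjoint_family_on_def
    proof (intro ballI impI, rule ccontr)
      fix \<gamma> \<delta> assume gd: "\<gamma> \<in> \<Delta>" "\<delta> \<in> \<Delta>" "\<gamma> \<noteq> \<delta>" "F \<inter> act \<gamma> ` B \<inter> (F \<inter> act \<delta> ` B) \<noteq> {}"
      then obtain u w where uw: "u \<in> B" "w \<in> B" "act \<gamma> u = act \<delta> w" by blast
      then have "orbit_of \<Delta> u = orbit_of \<Delta> w" using orb gd B(2) by (metis subsetD)
      then have "u = w" using B(3) uw by (auto dest: inj_onD)
      then show False using act_free[OF gd(1,2)] uw gd(3) B(2) by auto
    qed
  qed
  also have "\<dots> = (\<integral>\<^sup>+\<gamma>. emeasure upper_vol (B \<inter> act (inv\<^bsub>G\<^esub> \<gamma>) ` F) \<partial>count_space \<Delta>)"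
  proof (intro nn_integral_cong)
    fix \<gamma> assume "\<gamma> \<in> space (count_space \<Delta>)"
    then have \<gamma>: "\<gamma> \<in> \<Delta>" by simp
    have "act \<gamma> ` (B \<inter> act (inv\<^bsub>G\<^esub> \<gamma>) ` F) = F \<inter> act \<gamma> ` B"
    proof -
      have "act \<gamma> (act (inv\<^bsub>G\<^esub> \<gamma>) z) = z" if "z \<in> F" for z using act_inv_act(2)[of \<gamma> z] \<gamma> that Fb by auto
      moreover have "act (inv\<^bsub>G\<^esub> \<gamma>) (act \<gamma> z) = z" if "z \<in> B" for z using act_inv_act(1)[of \<gamma> z] \<gamma> that B by auto
      ultimately show ?thesis by (force simp: image_iff)
    qed
    moreover have "B \<inter> act (inv\<^bsub>G\<^esub> \<gamma>) ` F \<in> sets borel" using B Fb invD[OF \<gamma>] by (intro sets.Int act_image_borel) auto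
    ultimately show "emeasure upper_vol (F \<inter> act \<gamma> ` B) = emeasure upper_vol (B \<inter> act (inv\<^bsub>G\<^esub> \<gamma>) ` F)"
      using emeasure_upper_vol_act[of \<gamma> "B \<inter> act (inv\<^bsub>G\<^esub> \<gamma>) ` F"] \<gamma> B(2) by auto
  qed
  also have "\<dots> = emeasure upper_vol (\<Union>\<gamma>\<in>\<Delta>. B \<inter> act (inv\<^bsub>G\<^esub> \<gamma>) ` F)"
  proof (intro emeasure_UN_countable[symmetric] countable_Delta)
    show "B \<inter> act (inv\<^bsub>G\<^esub> \<gamma>) ` F \<in> sets upper_vol" if "\<gamma> \<in> \<Delta>" for \<gamma>
      using B Fb invD[OF that] by (auto intro!: sets.Int act_image_borel)
    show "disjoint_family_on (\<lambda>\<gamma>. B \<inter> act (inv\<^bsub>G\<^esub> \<gamma>) ` F) \<Delta>"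
      unfolding disjoint_family_on_def
    proof (intro ballI impI, rule ccontr)
      fix \<gamma> \<delta> assume gd: "\<gamma> \<in> \<Delta>" "\<delta> \<in> \<Delta>" "\<gamma> \<noteq> \<delta>"
        "B \<inter> act (inv\<^bsub>G\<^esub> \<gamma>) ` F \<inter> (B \<inter> act (inv\<^bsub>G\<^esub> \<delta>) ` F) \<noteq> {}"
      then obtain u w where uw: "u \<in> F" "w \<in> F" "act (inv\<^bsub>G\<^esub> \<gamma>) u = act (inv\<^bsub>G\<^esub> \<delta>) w" by blast
      have up: "u \<in> upper" "w \<in> upper" using uw Fb by auto
      have "orbit_of \<Delta> u = orbit_of \<Delta> w" using orb[OF invD up(1)] orb[OF invD up(2)] gd uw(3) by metis
      then have "w \<in> orbit_of \<Delta> u" using orbit_of_self[OF subgroup] by simp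
      then have "u = w" using transversal_unique[OF F] uw by blast
      then have "inv\<^bsub>G\<^esub> \<gamma> = inv\<^bsub>G\<^esub> \<delta>" using act_free[OF invD invD up(1)] gd uw(3) by simp
      then show False using gd group.inv_inv[OF group_G] carrier by metis
    qed
  qed
  also have "(\<Union>\<gamma>\<in>\<Delta>. B \<inter> act (inv\<^bsub>G\<^esub> \<gamma>) ` F) = B"
  proof -
    have "\<exists>\<gamma>\<in>\<Delta>. z \<in> act (inv\<^bsub>G\<^esub> \<gamma>) ` F" if z: "z \<in> B" for z
    proof -
      have zu: "z \<in> upper" using z B by auto
      then obtain w where w: "w \<in> F" "w \<in> orbit_of \<Delta> z" using F unfolding transversal_def by blast
      then obtain \<gamma> where \<gamma>: "\<gamma> \<in> \<Delta>" "w = act \<gamma> z" by (auto simp: orbit_of_def)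
      then have "z = act (inv\<^bsub>G\<^esub> \<gamma>) w" using act_inv_act(1)[of \<gamma> z] zu by simp
      then show ?thesis using \<gamma>(1) w(1) by blast
    qed
    then show ?thesis by blast
  qed
  finally show ?thesis .
qed

text \<open>Here \<open>B\<close> may meet an orbit several times. Cut into countably many small
  Borel pieces, it becomes injective on each of them, and subadditivity gives the
  inequality.\<close>

lemma emeasure_transversal_sat_le:
  assumes F: "transversal F" and B: "B \<in> sets borel" "B \<subseteq> upper"
  shows "emeasure upper_vol (F \<inter> sat B) \<le> emeasure upper_vol B"
proof -
  have Fb: "F \<in> sets borel" "F \<subseteq> upper" using F by (auto simp: transversal_def)
  obtain U :: "nat \<Rightarrow> (complex^'r) set" where U: "\<And>n. open (U n)" "\<And>n. small (U n)" "(\<Union>n. U n) = upper"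
    by (rule small_open_cover) (rule that)
  define C where "C n = B \<inter> disjointed U n" for n
  have dj: "disjointed U n \<in> sets borel" for n
    using sets.range_disjointed_sets[of U borel] U(1) by (auto simp: image_subset_iff)
  have C: "C n \<in> sets borel" "C n \<subseteq> upper" for n using B dj by (auto simp: C_def)
  have inj: "inj_on (orbit_of \<Delta>) (C n)" for n
  proof (rule inj_onI)
    fix u w assume uw: "u \<in> C n" "w \<in> C n" "orbit_of \<Delta> u = orbit_of \<Delta> w"
    then have "u \<in> U n" "w \<in> U n" using disjointed_subset[of U n] by (auto simp: C_def)
    then show "u = w" using small_orbit[OF U(2), of w n u] uw(3) orbit_of_self[OF subgroup, of u] by simp
  qed
  have CB: "(\<Union>n. C n) = B" using UN_disjointed_eq[of U] U(3) B(2) by (auto simp: C_def)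
  have sat: "F \<inter> sat B = (\<Union>n. F \<inter> sat (C n))" unfolding CB[symmetric] by (auto simp: sat_def)
  have "emeasure upper_vol (F \<inter> sat B) \<le> suminf (\<lambda>n. emeasure upper_vol (F \<inter> sat (C n)))"
    unfolding sat using Fb C sat_borel by (intro emeasure_subadditive_countably) auto
  also have "\<dots> = suminf (\<lambda>n. emeasure upper_vol (C n))"
    by (simp add: emeasure_transversal_sat[OF F C inj])
  also have "\<dots> = emeasure upper_vol (\<Union>n. C n)"
  proof (rule suminf_emeasure)
    show "disjoint_family C"
      using disjoint_family_disjointed[of U] unfolding disjoint_family_on_def C_def by blast
  qed (use C in auto)
  finally show ?thesis by (simp add: CB)
qed

text \<open>The definite description has to be shown to have exactly one solution. Existence: push
  the volume on \<open>F\<close> forward to the orbits. Uniqueness: every measurable set of orbits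
  is the injective image of a Borel subset of \<open>F\<close>, so its measure is
  prescribed.\<close>

lemma quotient_vol_transversal:
  assumes F: "transversal F"
  shows "emeasure (quotient_vol \<Delta>) (quotient_space \<Delta>) = emeasure upper_vol F"
proof -
  let ?Q = "quotient_space \<Delta>"
  let ?S = "{B. B \<subseteq> ?Q \<and> \<Union>B \<in> sets borel}"
  have Fb: "F \<in> sets borel" "F \<subseteq> upper" using F by (auto simp: transversal_def)
  have Union_Diff: "\<Union>(?Q - B) = upper - \<Union>B" if "B \<subseteq> ?Q" for B
  proof (rule Set.set_eqI)
    fix z
    have *: "?Q - B \<subseteq> ?Q" by blast
    show "z \<in> \<Union>(?Q - B) \<longleftrightarrow> z \<in> upper - \<Union>B"
      unfolding mem_Union_iff[OF subgroup *] Diff_iff mem_Union_iff[OF subgroup that]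
      using orbit_of_in_quotient[OF subgroup] by auto
  qed
  \<comment> \<open>The sets of orbits with Borel preimage form a sigma-algebra, so
    \<open>measure_of\<close> really has them as its measurable sets.\<close>
  have sa: "sigma_algebra ?Q ?S"
    unfolding sigma_algebra_iff2
  proof (intro conjI ballI allI impI)
    show "?S \<subseteq> Pow ?Q" "{} \<in> ?S" by auto
    fix s assume "s \<in> ?S"
    then show "?Q - s \<in> ?S" using Union_Diff upper_borel by auto
  next
    fix A :: "nat \<Rightarrow> (complex^'r) set set" assume "range A \<subseteq> ?S"
    then have "A i \<subseteq> ?Q" "\<Union>(A i) \<in> sets borel" for i by auto
    moreover have "\<Union>(\<Union>i. A i) = (\<Union>i. \<Union>(A i))" by blast
    ultimately show "(\<Union>i. A i) \<in> ?S" by auto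
  qed
  define M where "M = measure_of ?Q ?S (\<lambda>_. 0)"
  have M: "space M = ?Q" "sets M = ?S"
    unfolding M_def using sa by (auto simp: space_measure_of_conv sigma_algebra.sets_measure_of_eq)
  have meas: "orbit_of \<Delta> \<in> restrict_space upper_vol F \<rightarrow>\<^sub>M M"
  proof (rule measurableI)
    show "orbit_of \<Delta> z \<in> space M" if "z \<in> space (restrict_space upper_vol F)" for z
      using that Fb orbit_of_in_quotient[OF subgroup] by (auto simp: M space_restrict_space)
    fix B assume "B \<in> sets M"
    then have B: "B \<subseteq> ?Q" "\<Union>B \<in> sets borel" by (auto simp: M)
    have "orbit_of \<Delta> -` B \<inter> F = F \<inter> \<Union>B"
      using mem_Union_iff[OF subgroup B(1)] Fb by (auto simp del: Union_iff)
    then show "orbit_of \<Delta> -` B \<inter> space (restrict_space upper_vol F) \<in> sets (restrict_space upper_vol F)"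
      using B Fb by (auto simp: space_restrict_space sets_restrict_space)
  qed
  define V where "V = distr (restrict_space upper_vol F) M (orbit_of \<Delta>)"
  have V: "space V = ?Q" "sets V = ?S" by (simp_all add: V_def M)
  have eV: "emeasure V B = emeasure upper_vol (F \<inter> \<Union>B)" if "B \<in> ?S" for B
  proof -
    have "emeasure V B = emeasure (restrict_space upper_vol F) (orbit_of \<Delta> -` B \<inter> F)"
      unfolding V_def using meas that by (subst emeasure_distr) (auto simp: M space_restrict_space)
    also have "orbit_of \<Delta> -` B \<inter> F = F \<inter> \<Union>B"
      using mem_Union_iff[OF subgroup, of B] that Fb by (auto simp del: Union_iff)
    also have "emeasure (restrict_space upper_vol F) (F \<inter> \<Union>B) = emeasure upper_vol (F \<inter> \<Union>B)"
      using Fb by (intro emeasure_restrict_space) auto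
    finally show ?thesis .
  qed
  have Union_orbits: "\<Union>(orbit_of \<Delta> ` U) = sat U" for U
    by (auto simp: orbit_of_def sat_def)
  define is_qv where "is_qv W \<longleftrightarrow> space W = ?Q \<and> sets W = ?S \<and>
     (\<forall>U \<in> sets borel. U \<subseteq> upper \<and> inj_on (orbit_of \<Delta>) U \<longrightarrow>
        emeasure W (orbit_of \<Delta> ` U) = emeasure upper_vol U)" for W
  have "is_qv V"
    unfolding is_qv_def
  proof (intro conjI ballI impI V)
    fix U :: "(complex^'r) set" assume U: "U \<in> sets borel" "U \<subseteq> upper \<and> inj_on (orbit_of \<Delta>) U"
    then have "orbit_of \<Delta> ` U \<in> ?S"
      using orbit_of_in_quotient[OF subgroup] sat_borel by (auto simp: Union_orbits)
    then show "emeasure V (orbit_of \<Delta> ` U) = emeasure upper_vol U"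
      using eV emeasure_transversal_sat[OF F, of U] U by (simp add: Union_orbits)
  qed
  moreover have "W = V" if "is_qv W" for W
  proof (rule measure_eqI)
    show "sets W = sets V" using that V by (simp add: is_qv_def)
    fix B assume "B \<in> sets W"
    then have B: "B \<subseteq> ?Q" "\<Union>B \<in> sets borel" using that by (auto simp: is_qv_def)
    have "orbit_of \<Delta> ` (F \<inter> \<Union>B) = B"
    proof
      show "orbit_of \<Delta> ` (F \<inter> \<Union>B) \<subseteq> B" using mem_Union_iff[OF subgroup B(1)] by blast
      show "B \<subseteq> orbit_of \<Delta> ` (F \<inter> \<Union>B)"
      proof
        fix C assume C: "C \<in> B"
        then obtain z where z: "z \<in> C" "z \<in> upper" using quotient_elem_nonempty[OF subgroup] B(1) by blast
        then obtain w where w: "w \<in> F" "w \<in> orbit_of \<Delta> z" using F unfolding transversal_def by blast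
        have Cz: "C = orbit_of \<Delta> z" using quotient_elem(2)[OF subgroup _ z(1)] C B(1) by blast
        then have "C = orbit_of \<Delta> w" "w \<in> C" using orbit_of_eq[OF subgroup z(2) w(2)] w(2) by simp_all
        then show "C \<in> orbit_of \<Delta> ` (F \<inter> \<Union>B)" using w(1) C by blast
      qed
    qed
    moreover have "inj_on (orbit_of \<Delta>) (F \<inter> \<Union>B)"
      using transversal_unique[OF F] orbit_of_self[OF subgroup] by (intro inj_onI) (metis IntD1)
    moreover have "F \<inter> \<Union>B \<in> sets borel" "F \<inter> \<Union>B \<subseteq> upper" using B Fb by auto
    ultimately have "emeasure W B = emeasure upper_vol (F \<inter> \<Union>B)"
      using that unfolding is_qv_def by metis
    then show "emeasure W B = emeasure V B" using eV B by simp
  qed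
  ultimately have "quotient_vol \<Delta> = V"
    unfolding quotient_vol_def is_qv_def[symmetric] by (rule the_equality)
  moreover have "F \<inter> \<Union>?Q = F" using Fb Union_quotient[OF subgroup] by blast
  moreover have "?Q \<in> ?S" using Union_quotient[OF subgroup] upper_borel by simp
  ultimately show ?thesis using eV[of ?Q] by simp
qed

text \<open>As a real number, \<open>vol\<close> would be 0 for an infinite measure; for this reason
  the lower bound too is proved under the assumption of a covering set \<open>B\<close> of finite
  volume.\<close>

lemma vol_bounds:
  assumes B: "B \<in> sets borel" "B \<subseteq> upper" "upper \<subseteq> sat B" and fin: "emeasure upper_vol B \<le> ennreal K" "K \<ge> 0"
  shows "vol \<Delta> \<le> K" "\<And>U k. U \<in> sets borel \<Longrightarrow> small U \<Longrightarrow> ennreal k \<le> emeasure upper_vol U \<Longrightarrow> k \<le> vol \<Delta>"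
proof -
  obtain F where F: "transversal F" using transversal_exists by blast
  have FB: "F \<inter> sat B = F" using F B(3) by (auto simp: transversal_def)
  have vol: "vol \<Delta> = enn2real (emeasure upper_vol F)"
    by (simp add: vol_def measure_def quotient_vol_transversal[OF F])
  have "emeasure upper_vol F \<le> ennreal K"
    using emeasure_transversal_sat_le[OF F B(1,2)] fin(1) by (simp add: FB)
  then show "vol \<Delta> \<le> K" unfolding vol using fin(2) enn2real_mono[of _ "ennreal K"] by (metis enn2real_ennreal ennreal_less_top)
  have lt: "emeasure upper_vol F < \<infinity>"
    using \<open>emeasure upper_vol F \<le> ennreal K\<close> by (rule le_less_trans) simp
  fix U k assume U: "U \<in> sets borel" "small U" "ennreal k \<le> emeasure upper_vol U"
  have inj: "inj_on (orbit_of \<Delta>) U"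
    using small_orbit[OF U(2)] orbit_of_self[OF subgroup] by (intro inj_onI) metis
  have "emeasure upper_vol U = emeasure upper_vol (F \<inter> sat U)"
    using emeasure_transversal_sat[OF F U(1) _ inj] U(2) by (simp add: small_def)
  also have "\<dots> \<le> emeasure upper_vol F" using F by (intro emeasure_mono) (auto simp: transversal_def)
  finally have "ennreal k \<le> emeasure upper_vol F" using U(3) by simp
  then have "enn2real (ennreal k) \<le> vol \<Delta>" unfolding vol using lt by (intro enn2real_mono) auto
  moreover have "0 \<le> vol \<Delta>" by (simp add: vol)
  ultimately show "k \<le> vol \<Delta>" by (cases "k \<ge> 0") auto
qed

end

section \<open>Quaternions\<close>

fun qconj :: "'k::comm_ring_1 quat \<Rightarrow> 'k quat" where
  "qconj (x0, x1, x2, x3) = (x0, - x1, - x2, - x3)"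

lemma qmult_assoc: "qmult a b (qmult a b x y) z = qmult a b x (qmult a b y z)"
  by (cases x; cases y; cases z) (simp add: algebra_simps)

lemma qmult_qone [simp]: "qmult a b qone x = x" "qmult a b x qone = x"
  by (cases x; simp add: qone_def)+

lemma qnrd_qmult: "qnrd a b (qmult a b x y) = qnrd a b x * qnrd a b y"
  by (cases x; cases y) (simp add: power2_eq_square algebra_simps)

lemma qmult_qconj: "qmult a b x (qconj x) = (qnrd a b x, 0, 0, 0)" "qmult a b (qconj x) x = (qnrd a b x, 0, 0, 0)"
  by (cases x; simp add: power2_eq_square algebra_simps)+

lemma qnrd_qconj [simp]: "qnrd a b (qconj x) = qnrd a b x"
  by (cases x) simp

lemma qnrd_qone [simp]: "qnrd a b qone = 1"
  by (simp add: qone_def)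

lemma qtr_qmult_commute: "qtr (qmult a b x y) = qtr (qmult a b y x)"
  by (cases x; cases y) (simp add: algebra_simps)

subsection \<open>Splitting at a real place\<close>

text \<open>The explicit splitting: \<open>\<iota>\<close> goes to the diagonal matrix with entries
  \<open>s\<close> and \<open>- s\<close>, and \<open>j\<close> to the matrix with rows
  \<open>(0, 1)\<close> and \<open>(B, 0)\<close>. The inverse \<open>\<psi>\<close> reads the
  coordinates off sums and differences of entries.\<close>

lemma quat_split_pos:
  fixes A B :: real
  assumes "A > 0" "B \<noteq> 0"
  shows "\<exists>\<phi> :: real quat \<Rightarrow> real^2^2. linear \<phi> \<and> bij \<phi> \<and> \<phi> qone = mat 1 \<and>
    (\<forall>x y. \<phi> (qmult A B x y) = \<phi> x ** \<phi> y)"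
proof -
  define s where "s = sqrt A"
  have s: "s * s = A" "s \<noteq> 0" using assms by (auto simp: s_def)
  define \<phi> :: "real quat \<Rightarrow> real^2^2" where
    "\<phi> = (\<lambda>(x0, x1, x2, x3). vector [vector [x0 + s * x1, x2 + s * x3], vector [B * (x2 - s * x3), x0 - s * x1]])"
  define \<psi> :: "real^2^2 \<Rightarrow> real quat" where
    "\<psi> M = ((M$1$1 + M$2$2) / 2, (M$1$1 - M$2$2) / (2 * s), (M$1$2 + M$2$1 / B) / 2, (M$1$2 - M$2$1 / B) / (2 * s))" for M
  have comp: "\<phi> (x0, x1, x2, x3) $ 1 $ 1 = x0 + s * x1" "\<phi> (x0, x1, x2, x3) $ 1 $ 2 = x2 + s * x3"
    "\<phi> (x0, x1, x2, x3) $ 2 $ 1 = B * (x2 - s * x3)" "\<phi> (x0, x1, x2, x3) $ 2 $ 2 = x0 - s * x1" for x0 x1 x2 x3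
    by (simp_all add: \<phi>_def vector_2)
  have "linear \<phi>"
  proof (rule linearI)
    fix x y :: "real quat" and c :: real
    show "\<phi> (x + y) = \<phi> x + \<phi> y" by (cases x; cases y) (simp add: mat2_eq_iff comp algebra_simps)
    show "\<phi> (c *\<^sub>R x) = c *\<^sub>R \<phi> x" by (cases x) (simp add: mat2_eq_iff comp algebra_simps)
  qed
  moreover have "bij \<phi>"
  proof (rule o_bij[of \<psi>])
    show "\<psi> \<circ> \<phi> = id"
    proof
      fix x show "(\<psi> \<circ> \<phi>) x = id x" using s(2) assms(2) by (cases x) (simp add: \<psi>_def comp)
    qed
    show "\<phi> \<circ> \<psi> = id"
    proof
      fix M :: "real^2^2"
      have e: "s * (t / (2 * s)) = t / 2" for t using s(2) by simp
      have f: "(p + q) / 2 - (p - q) / 2 = q" "(p + q) / 2 + (p - q) / 2 = p" for p q :: real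
        by (simp_all add: diff_divide_distrib add_divide_distrib)
      have "B * (M$2$1 / B) = M$2$1" using assms(2) by simp
      then show "(\<phi> \<circ> \<psi>) M = id M" unfolding comp_apply id_apply \<psi>_def mat2_eq_iff comp e f by simp
    qed
  qed
  moreover have "\<phi> qone = mat 1" by (simp add: qone_def mat2_eq_iff comp mat1_component)
  moreover have "\<phi> (qmult A B x y) = \<phi> x ** \<phi> y" for x y
    by (cases x; cases y) (simp add: mat2_eq_iff comp mult2_component s(1)[symmetric] algebra_simps)
  ultimately show ?thesis by blast
qed

text \<open>Exchanging \<open>\<iota>\<close> and \<open>j\<close> turns parameters
  \<open>A, B\<close> into \<open>B, A\<close>; the sign of the last coordinate changes since
  \<open>j \<iota> = - \<kappa>\<close>.\<close>

lemma quat_split_swap: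
  fixes A B :: real
  assumes "A \<noteq> 0" "B > 0"
  shows "\<exists>\<phi> :: real quat \<Rightarrow> real^2^2. linear \<phi> \<and> bij \<phi> \<and> \<phi> qone = mat 1 \<and>
    (\<forall>x y. \<phi> (qmult A B x y) = \<phi> x ** \<phi> y)"
proof -
  obtain \<phi> :: "real quat \<Rightarrow> real^2^2" where \<phi>: "linear \<phi>" "bij \<phi>" "\<phi> qone = mat 1"
    "\<And>x y. \<phi> (qmult B A x y) = \<phi> x ** \<phi> y"
    using quat_split_pos[OF assms(2,1)] by blast
  define sw :: "real quat \<Rightarrow> real quat" where "sw = (\<lambda>(x0, x1, x2, x3). (x0, x2, x1, - x3))"
  have "linear sw" by (rule linearI) (auto simp: sw_def)
  moreover have sw2: "sw \<circ> sw = id" by (auto simp: sw_def fun_eq_iff)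
  then have "bij sw" using o_bij by blast
  moreover have "sw (qmult A B x y) = qmult B A (sw x) (sw y)" for x y
    by (cases x; cases y) (simp add: sw_def algebra_simps)
  ultimately show ?thesis using \<phi>
    by (intro exI[of _ "\<phi> \<circ> sw"]) (auto simp: linear_compose bij_comp sw_def qone_def)
qed

text \<open>A positive parameter would give a splitting. With both parameters negative the norm form
  at \<open>\<tau>\<close> is positive definite, as for Hamilton's quaternions.\<close>

lemma not_splits_negative:
  assumes "\<not> splits_at a b \<tau>" "field_embedding \<tau>" "a \<noteq> 0" "b \<noteq> 0"
  shows "\<tau> a < 0" "\<tau> b < 0"
proof -
  have nz: "\<tau> a \<noteq> 0" "\<tau> b \<noteq> 0" using field_embedding_eq_0[OF assms(2)] assms(3,4) by auto
  show "\<tau> a < 0"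
  proof (rule ccontr)
    assume "\<not> \<tau> a < 0"
    then have "\<tau> a > 0" using nz by simp
    from quat_split_pos[OF this nz(2)] show False using assms(1) unfolding splits_at_def by simp
  qed
  show "\<tau> b < 0"
  proof (rule ccontr)
    assume "\<not> \<tau> b < 0"
    then have "\<tau> b > 0" using nz by simp
    from quat_split_swap[OF nz(1) this] show False using assms(1) unfolding splits_at_def by simp
  qed
qed

section \<open>Congruence subgroups\<close>

lemma ring_of_integers_carrier [simp]: "carrier ring_of_integers = {x. algebraic_int x}"
  by (simp add: ring_of_integers_def)

lemma ring_ring_of_integers: "ring (ring_of_integers :: 'k::field_char_0 ring)"
proof (rule ringI)
  show "abelian_group (ring_of_integers :: 'k ring)"
  proof (rule abelian_groupI)
    fix x :: 'k assume "x \<in> carrier ring_of_integers"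
    then show "\<exists>y\<in>carrier ring_of_integers. y \<oplus>\<^bsub>ring_of_integers\<^esub> x = \<zero>\<^bsub>ring_of_integers\<^esub>"
      by (intro bexI[of _ "- x"]) (auto simp: ring_of_integers_def)
  qed (auto simp: ring_of_integers_def algebraic_int_add)
  show "Group.monoid (ring_of_integers :: 'k ring)"
    by (rule monoidI) (auto simp: ring_of_integers_def algebraic_int_mult)
qed (auto simp: ring_of_integers_def algebra_simps)

section \<open>The powers of 3 and congruences between quaternions of norm 1\<close>

definition pow3_ideal :: "nat \<Rightarrow> 'k::field_char_0 set" where
  "pow3_ideal n = {3 ^ n * y | y. algebraic_int y}"

lemma pow3_idealI: "algebraic_int y \<Longrightarrow> x = 3 ^ n * y \<Longrightarrow> x \<in> pow3_ideal n"
  by (auto simp: pow3_ideal_def)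

lemma pow3_idealE:
  assumes "x \<in> pow3_ideal n"
  obtains y where "algebraic_int y" "x = 3 ^ n * y"
  using assms by (auto simp: pow3_ideal_def)

lemma pow3_ideal_add: "x \<in> pow3_ideal n \<Longrightarrow> y \<in> pow3_ideal n \<Longrightarrow> x + y \<in> pow3_ideal n"
  by (elim pow3_idealE, rule pow3_idealI[OF algebraic_int_add]) (auto simp: algebra_simps)

lemma pow3_ideal_uminus: "x \<in> pow3_ideal n \<Longrightarrow> - x \<in> pow3_ideal n"
  by (elim pow3_idealE, rule pow3_idealI[of "- _"]) auto

lemma pow3_ideal_diff: "x \<in> pow3_ideal n \<Longrightarrow> y \<in> pow3_ideal n \<Longrightarrow> x - y \<in> pow3_ideal n"
  using pow3_ideal_add[of x n "- y"] pow3_ideal_uminus by auto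

lemma pow3_ideal_mult: "x \<in> pow3_ideal n \<Longrightarrow> algebraic_int y \<Longrightarrow> x * y \<in> pow3_ideal n"
  by (elim pow3_idealE, rule pow3_idealI[OF algebraic_int_mult]) (auto simp: algebra_simps)

lemma pow3_ideal_mult_left: "x \<in> pow3_ideal n \<Longrightarrow> algebraic_int y \<Longrightarrow> y * x \<in> pow3_ideal n"
  using pow3_ideal_mult[of x n y] by (simp add: mult.commute)

lemma pow3_ideal_0: "0 \<in> pow3_ideal n"
  by (rule pow3_idealI[of 0]) auto

lemma pow3_ideal_integral: "x \<in> pow3_ideal n \<Longrightarrow> algebraic_int x"
  by (elim pow3_idealE) (auto intro: algebraic_int_mult algebraic_int_power)

lemma ideal_pow3_ideal: "ideal (pow3_ideal n) (ring_of_integers :: 'k::field_char_0 ring)"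
proof (rule idealI)
  show "ring (ring_of_integers :: 'k ring)" by (rule ring_ring_of_integers)
  interpret ring "ring_of_integers :: 'k ring" by (rule ring_ring_of_integers)
  show "subgroup (pow3_ideal n) (add_monoid (ring_of_integers :: 'k ring))"
  proof (rule group.subgroupI[OF a_group])
    show "pow3_ideal n \<subseteq> carrier (add_monoid (ring_of_integers :: 'k ring))"
      using pow3_ideal_integral by auto
    show "pow3_ideal n \<noteq> ({} :: 'k set)" using pow3_ideal_0 by blast
    fix x :: 'k assume x: "x \<in> pow3_ideal n"
    have "inv\<^bsub>add_monoid ring_of_integers\<^esub> x = - x"
      using pow3_ideal_integral[OF x] by (intro group.inv_equality[OF a_group]) (auto simp: ring_of_integers_def)
    then show "inv\<^bsub>add_monoid ring_of_integers\<^esub> x \<in> pow3_ideal n" using pow3_ideal_uminus[OF x] by simp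
    fix y :: 'k assume "y \<in> pow3_ideal n"
    then show "x \<otimes>\<^bsub>add_monoid ring_of_integers\<^esub> y \<in> pow3_ideal n"
      using pow3_ideal_add[OF x] by (simp add: ring_of_integers_def)
  qed
qed (auto simp: ring_of_integers_def pow3_ideal_mult pow3_ideal_mult_left)

lemma pow3_ideal_nonzero: "pow3_ideal n \<noteq> {0 :: 'k::field_char_0}"
proof -
  have "(3 ^ n :: 'k) \<in> pow3_ideal n" by (rule pow3_idealI[of 1]) auto
  then show ?thesis by force
qed

text \<open>The trace of the Cayley-Hamilton identity; it recovers determinants from traces.\<close>

lemma trace_square: "trace (A ** A) = (trace A)\<^sup>2 - 2 * det A" for A :: "real^2^2"
  by (simp add: trace2 mult2_component det_2 power2_eq_square algebra_simps)

lemma Q1_iff: "x \<in> Q1 a b \<longleftrightarrow> qnrd a b x = 1 \<and> (case x of (x0, x1, x2, x3) \<Rightarrow>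
    algebraic_int x0 \<and> algebraic_int x1 \<and> algebraic_int x2 \<and> algebraic_int x3)"
  by (cases x) (auto simp: Q1_def)

lemma Q1_cong_iff: "x \<in> Q1_cong a b I \<longleftrightarrow> x \<in> Q1 a b \<and> (case x of (x0, x1, x2, x3) \<Rightarrow>
    x0 - 1 \<in> I \<and> x1 \<in> I \<and> x2 \<in> I \<and> x3 \<in> I)"
  by (cases x) (auto simp: Q1_cong_def)

lemma qone_in_Q1: "qone \<in> Q1 a b" "qone \<in> Q1_cong a b (pow3_ideal n)"
  by (auto simp: Q1_iff Q1_cong_iff qone_def pow3_ideal_0)

lemma qconj_in_Q1: "x \<in> Q1 a b \<Longrightarrow> qconj x \<in> Q1 a b"
  by (cases x) (auto simp: Q1_iff)

lemma qconj_in_Q1_cong: "x \<in> Q1_cong a b (pow3_ideal n) \<Longrightarrow> qconj x \<in> Q1_cong a b (pow3_ideal n)"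
  by (cases x) (auto simp: Q1_cong_iff qconj_in_Q1[of "(_, _, _, _)", simplified] pow3_ideal_uminus)

lemma qmult_in_Q1:
  assumes "algebraic_int a" "algebraic_int b" "x \<in> Q1 a b" "y \<in> Q1 a b"
  shows "qmult a b x y \<in> Q1 a b"
proof -
  have "qnrd a b (qmult a b x y) = 1" using assms by (simp add: qnrd_qmult Q1_iff)
  then show ?thesis using assms unfolding Q1_iff
    by (cases x; cases y) (auto intro!: algebraic_int_add algebraic_int_diff algebraic_int_mult)
qed

text \<open>\<open>x y\<^sup>-\<^sup>1 = 1 + (x - y) y\<^sup>-\<^sup>1\<close>, and the inverse of \<open>y\<close> is its conjugate.\<close>

lemma quotient_in_Q1_cong:
  assumes ab: "algebraic_int a" "algebraic_int b" and xy: "x \<in> Q1 a b" "y \<in> Q1 a b"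
    and x: "x = (x0, x1, x2, x3)" and y: "y = (y0, y1, y2, y3)"
    and d: "x0 - y0 \<in> pow3_ideal n" "x1 - y1 \<in> pow3_ideal n" "x2 - y2 \<in> pow3_ideal n" "x3 - y3 \<in> pow3_ideal n"
  shows "qmult a b x (qconj y) \<in> Q1_cong a b (pow3_ideal n)"
proof -
  have in1: "qmult a b x (qconj y) \<in> Q1 a b" by (intro qmult_in_Q1 ab xy qconj_in_Q1)
  obtain u0 u1 u2 u3 where u: "u0 = x0 - y0" "u1 = x1 - y1" "u2 = x2 - y2" "u3 = x3 - y3" by blast
  have uI: "u0 \<in> pow3_ideal n" "u1 \<in> pow3_ideal n" "u2 \<in> pow3_ideal n" "u3 \<in> pow3_ideal n"
    using d by (simp_all add: u)
  have nrd: "qnrd a b y = 1" using xy by (simp add: Q1_iff)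
  have int: "algebraic_int (- y0)" "algebraic_int (- y1)" "algebraic_int (- y2)" "algebraic_int (- y3)"
    "algebraic_int y0" "algebraic_int y1" "algebraic_int y2" "algebraic_int y3"
    using xy(2) by (auto simp: Q1_iff y)
  have "qmult a b x (qconj y) = qmult a b (u0, u1, u2, u3) (qconj y) + qmult a b y (qconj y)"
    unfolding x y u by (simp add: algebra_simps)
  also have "qmult a b y (qconj y) = (1, 0, 0, 0)" by (simp only: qmult_qconj nrd)
  finally have eq: "qmult a b x (qconj y) = qmult a b (u0, u1, u2, u3) (y0, - y1, - y2, - y3) + (1, 0, 0, 0)"
    by (simp only: y qconj.simps)
  note m = uI[THEN pow3_ideal_mult]
  show ?thesis
    using in1 unfolding eq qmult.simps Q1_cong_iff
    by (auto intro!: pow3_ideal_add pow3_ideal_diff m m[THEN pow3_ideal_mult_left] int ab algebraic_int_mult)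
qed

text \<open>The product is the quotient of \<open>x\<close> by the conjugate of \<open>y\<close>,
  and these two are congruent to each other because both are congruent to 1.\<close>

lemma qmult_in_Q1_cong:
  assumes ab: "algebraic_int a" "algebraic_int b"
    and "x \<in> Q1_cong a b (pow3_ideal n)" "y \<in> Q1_cong a b (pow3_ideal n)"
  shows "qmult a b x y \<in> Q1_cong a b (pow3_ideal n)"
proof -
  obtain x0 x1 x2 x3 where x: "x = (x0, x1, x2, x3)" by (cases x)
  obtain y0 y1 y2 y3 where y: "y = (y0, y1, y2, y3)" by (cases y)
  have xI: "x0 - 1 \<in> pow3_ideal n" "x1 \<in> pow3_ideal n" "x2 \<in> pow3_ideal n" "x3 \<in> pow3_ideal n"
    and yI: "y0 - 1 \<in> pow3_ideal n" "y1 \<in> pow3_ideal n" "y2 \<in> pow3_ideal n" "y3 \<in> pow3_ideal n"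
    and Q: "x \<in> Q1 a b" "y \<in> Q1 a b"
    using assms(3,4) by (auto simp: Q1_cong_iff x y)
  have "qmult a b x (qconj (qconj y)) \<in> Q1_cong a b (pow3_ideal n)"
  proof (rule quotient_in_Q1_cong[OF ab Q(1) qconj_in_Q1[OF Q(2)] x])
    show "qconj y = (y0, - y1, - y2, - y3)" by (simp add: y)
    show "x0 - y0 \<in> pow3_ideal n" using pow3_ideal_diff[OF xI(1) yI(1)] by simp
    show "x1 - - y1 \<in> pow3_ideal n" "x2 - - y2 \<in> pow3_ideal n" "x3 - - y3 \<in> pow3_ideal n"
      using pow3_ideal_add xI yI by auto
  qed
  then show ?thesis by (simp add: y)
qed

text \<open>The norm form determines \<open>x0\<^sup>2 - y0\<^sup>2\<close>, and \<open>x0 + y0 \<equiv> 2\<close> is invertible modulo powers of \<open>3\<close>.\<close>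

lemma first_coordinate_congruent:
  assumes ab: "algebraic_int a" "algebraic_int b"
    and x: "(x0, x1, x2, x3) \<in> Q1_cong a b (pow3_ideal 1)" and y: "(y0, y1, y2, y3) \<in> Q1_cong a b (pow3_ideal 1)"
    and d: "x1 - y1 \<in> pow3_ideal n" "x2 - y2 \<in> pow3_ideal n" "x3 - y3 \<in> pow3_ideal n"
  shows "x0 - y0 \<in> pow3_ideal n"
proof -
  have int: "algebraic_int x0" "algebraic_int x1" "algebraic_int x2" "algebraic_int x3"
    "algebraic_int y0" "algebraic_int y1" "algebraic_int y2" "algebraic_int y3"
    and nx: "x0\<^sup>2 - a * x1\<^sup>2 - b * x2\<^sup>2 + a * b * x3\<^sup>2 = 1"
    and ny: "y0\<^sup>2 - a * y1\<^sup>2 - b * y2\<^sup>2 + a * b * y3\<^sup>2 = 1"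
    and xI: "x0 - 1 \<in> pow3_ideal 1" "y0 - 1 \<in> pow3_ideal 1"
    using x y by (auto simp: Q1_cong_iff Q1_iff)
  have "(x0 - y0) * (x0 + y0) = (x1 - y1) * (a * (x1 + y1)) + (x2 - y2) * (b * (x2 + y2)) - (x3 - y3) * (a * b * (x3 + y3))"
  proof -
    have "(x0 - y0) * (x0 + y0) = x0\<^sup>2 - y0\<^sup>2" by (simp add: power2_eq_square algebra_simps)
    also have "\<dots> = (1 + a * x1\<^sup>2 + b * x2\<^sup>2 - a * b * x3\<^sup>2) - (1 + a * y1\<^sup>2 + b * y2\<^sup>2 - a * b * y3\<^sup>2)"
      using nx ny by (simp add: algebra_simps)
    finally show ?thesis by (simp add: power2_eq_square algebra_simps)
  qed
  also have "\<dots> \<in> pow3_ideal n"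
    by (rule pow3_ideal_diff[OF pow3_ideal_add[OF d(1,2)[THEN pow3_ideal_mult]] d(3)[THEN pow3_ideal_mult]])
       (intro algebraic_int_mult algebraic_int_add ab int)+
  finally obtain s where s: "algebraic_int s" "(x0 - y0) * (x0 + y0) = 3 ^ n * s" by (rule pow3_idealE)
  have "x0 - 1 + (y0 - 1) \<in> pow3_ideal 1" using xI by (rule pow3_ideal_add)
  then obtain w where w: "algebraic_int w" "x0 - 1 + (y0 - 1) = 3 ^ 1 * w" by (rule pow3_idealE)
  then have sum: "x0 + y0 = 2 + 3 * w" by (simp add: algebra_simps)
  \<comment> \<open>Factors of 3 are split off one at a time from the first coordinate, using that
    \<open>x0 + y0\<close> has the form \<open>2 + 3 * w\<close>.\<close>
  have "j \<le> n \<Longrightarrow> x0 - y0 \<in> pow3_ideal j" for j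
  proof (induction j)
    case 0
    show ?case by (rule pow3_idealI[of "x0 - y0"]) (auto intro: algebraic_int_diff int)
  next
    case (Suc j)
    then obtain v where v: "algebraic_int v" "x0 - y0 = 3 ^ j * v" by (auto elim: pow3_idealE)
    have n: "n = j + Suc (n - Suc j)" using Suc.prems by simp
    have "3 ^ j * (v * (2 + 3 * w)) = 3 ^ j * (3 ^ Suc (n - Suc j) * s)"
      using s(2) unfolding sum v(2) by (subst (asm) n) (simp only: power_add mult.assoc)
    then have "v * (2 + 3 * w) = 3 * (3 ^ (n - Suc j) * s)" by simp
    \<comment> \<open>From \<open>2 * v + 3 * v * w\<close> divisible by 3 one passes to
      \<open>v\<close> itself through \<open>v = 3 * v - 2 * v\<close>.\<close>
    then have "v = 3 * (v + v * w - 3 ^ (n - Suc j) * s)" by (simp add: algebra_simps)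
    then obtain t where t: "t = v + v * w - 3 ^ (n - Suc j) * s" "v = 3 * t" by blast
    have "x0 - y0 = 3 ^ Suc j * t" unfolding v(2) by (subst t(2)) simp
    moreover have "algebraic_int t"
      unfolding t(1) using v w s by (intro algebraic_int_add algebraic_int_diff algebraic_int_mult algebraic_int_power) auto
    ultimately show ?case by (intro pow3_idealI)
  qed
  then show ?thesis by simp
qed

text \<open>Since \<open>x0\<^sup>2 - 1 = 2 * (x0 - 1) + (x0 - 1)\<^sup>2\<close>, the norm equation
  writes \<open>2 * (x0 - 1)\<close> as a combination of squares of elements of the ideal; squaring
  turns \<open>3 ^ n\<close> into \<open>9 ^ n\<close>.\<close>

lemma trace_minus_2_congruence:
  assumes ab: "algebraic_int a" "algebraic_int b" and x: "(x0, x1, x2, x3) \<in> Q1_cong a b (pow3_ideal n)"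
  obtains y where "algebraic_int y" "2 * (x0 - 1) = 9 ^ n * y"
proof -
  have nx: "x0\<^sup>2 - a * x1\<^sup>2 - b * x2\<^sup>2 + a * b * x3\<^sup>2 = 1"
    and I: "x0 - 1 \<in> pow3_ideal n" "x1 \<in> pow3_ideal n" "x2 \<in> pow3_ideal n" "x3 \<in> pow3_ideal n"
    using x by (auto simp: Q1_cong_iff Q1_iff)
  obtain y0 where y0: "algebraic_int y0" "x0 - 1 = 3 ^ n * y0" using I(1) by (rule pow3_idealE)
  obtain y1 where y1: "algebraic_int y1" "x1 = 3 ^ n * y1" using I(2) by (rule pow3_idealE)
  obtain y2 where y2: "algebraic_int y2" "x2 = 3 ^ n * y2" using I(3) by (rule pow3_idealE)
  obtain y3 where y3: "algebraic_int y3" "x3 = 3 ^ n * y3" using I(4) by (rule pow3_idealE)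
  have nine: "(3 ^ n)\<^sup>2 = (9 ^ n :: 'a)" by (simp add: power_mult[symmetric] mult.commute[of n]) (simp add: power_mult)
  have "2 * (x0 - 1) = a * x1\<^sup>2 + b * x2\<^sup>2 - a * b * x3\<^sup>2 - (x0 - 1)\<^sup>2"
    using nx by (simp add: power2_eq_square algebra_simps)
  also have "\<dots> = 9 ^ n * (a * y1\<^sup>2 + b * y2\<^sup>2 - a * b * y3\<^sup>2 - y0\<^sup>2)"
    unfolding y0(2) y1(2) y2(2) y3(2) power_mult_distrib nine by (simp add: algebra_simps)
  finally have "2 * (x0 - 1) = 9 ^ n * (a * y1\<^sup>2 + b * y2\<^sup>2 - a * b * y3\<^sup>2 - y0\<^sup>2)" .
  moreover have "algebraic_int (a * y1\<^sup>2 + b * y2\<^sup>2 - a * b * y3\<^sup>2 - y0\<^sup>2)"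
    using ab y0 y1 y2 y3 by (intro algebraic_int_add algebraic_int_diff algebraic_int_mult algebraic_int_power)
  ultimately show ?thesis using that by blast
qed

section \<open>The arithmetic group\<close>

text \<open>The boxes \<open>K n\<close> increase to the whole space, and their images in the
  quotient are open because the preimage of such an image is a union of translates. Compactness
  selects finitely many boxes, hence one.\<close>

lemma compact_exhaustion:
  fixes \<Delta> :: "'r::finite psl set"
  assumes sub: "subgroup \<Delta> G" and coc: "cocompact \<Delta>"
  obtains k :: real where "k \<ge> 1"
    "\<And>z. z \<in> upper \<Longrightarrow> \<exists>\<gamma>\<in>\<Delta>. \<forall>i. 1 / k < Im (act \<gamma> z $ i) \<and> Im (act \<gamma> z $ i) < k \<and> \<bar>Re (act \<gamma> z $ i)\<bar> < k"
proof -
  define K :: "nat \<Rightarrow> (complex^'r) set" where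
    "K n = (\<Inter>i. {z. 1 / real (Suc n) < Im (z $ i)} \<inter> {z. Im (z $ i) < real (Suc n)} \<inter> {z. \<bar>Re (z $ i)\<bar> < real (Suc n)})" for n
  have K_iff: "z \<in> K n \<longleftrightarrow> (\<forall>i. 1 / real (Suc n) < Im (z $ i) \<and> Im (z $ i) < real (Suc n) \<and> \<bar>Re (z $ i)\<bar> < real (Suc n))" for z n
    by (auto simp: K_def)
  have K_open: "open (K n)" for n
    unfolding K_def
    by (intro open_INT finite ballI open_Int open_Collect_less continuous_intros) auto
  have K_upper: "K n \<subseteq> upper" for n
  proof
    fix z assume z: "z \<in> K n"
    have "0 < Im (z $ i)" for i
    proof -
      have "0 < 1 / real (Suc n)" by simp
      also have "\<dots> < Im (z $ i)" using z K_iff by blast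
      finally show ?thesis .
    qed
    then show "z \<in> upper" by (simp add: upper_def)
  qed
  have K_mono: "K m \<subseteq> K n" if "m \<le> n" for m n
  proof
    fix z assume z: "z \<in> K m"
    have "1 / real (Suc n) \<le> 1 / real (Suc m)" "real (Suc m) \<le> real (Suc n)"
      using that by (auto intro!: divide_left_mono)
    then show "z \<in> K n" using z unfolding K_iff by (meson le_less_trans less_le_trans)
  qed
  have K_ex: "\<exists>n. z \<in> K n" if z: "z \<in> upper" for z
  proof -
    have "\<exists>n. 1 / real (Suc n) < Im (z $ i) \<and> Im (z $ i) < real (Suc n) \<and> \<bar>Re (z $ i)\<bar> < real (Suc n)" for i
    proof -
      have pos: "Im (z $ i) > 0" using z upper_component by blast
      obtain n where n: "max (1 / Im (z $ i)) (max (Im (z $ i)) \<bar>Re (z $ i)\<bar>) < real n"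
        using reals_Archimedean2 by blast
      then have "1 / Im (z $ i) < real (Suc n)" by simp
      then have "1 / real (Suc n) < Im (z $ i)" using pos by (simp add: field_simps)
      then show ?thesis using n by (intro exI[of _ n]) auto
    qed
    then obtain N where N: "\<And>i. 1 / real (Suc (N i)) < Im (z $ i) \<and> Im (z $ i) < real (Suc (N i)) \<and> \<bar>Re (z $ i)\<bar> < real (Suc (N i))"
      by metis
    have "1 / real (Suc (Max (range N))) < Im (z $ i) \<and> Im (z $ i) < real (Suc (Max (range N))) \<and> \<bar>Re (z $ i)\<bar> < real (Suc (Max (range N)))" for i
    proof -
      have le: "N i \<le> Max (range N)" by simp
      then have "1 / real (Suc (Max (range N))) \<le> 1 / real (Suc (N i))" "real (Suc (N i)) \<le> real (Suc (Max (range N)))"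
        by (auto intro!: divide_left_mono)
      then show ?thesis using N[of i] by linarith
    qed
    then show ?thesis using K_iff by blast
  qed
  have op: "openin (quotient_topology \<Delta>) (orbit_of \<Delta> ` K n)" for n
    unfolding openin_quotient_topology[OF sub]
  proof
    show "orbit_of \<Delta> ` K n \<subseteq> quotient_space \<Delta>"
      using K_upper orbit_of_in_quotient[OF sub] by blast
    have "\<Union>(orbit_of \<Delta> ` K n) = (\<Union>\<gamma>\<in>\<Delta>. act \<gamma> ` K n)" by (auto simp: orbit_of_def)
    moreover have "open (act \<gamma> ` K n)" if \<gamma>: "\<gamma> \<in> \<Delta>" for \<gamma>
    proof -
      have g: "\<gamma> \<in> carrier G" using in_G[OF sub \<gamma>] .
      have "open (upper \<inter> act (inv\<^bsub>G\<^esub> \<gamma>) -` K n)"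
        by (rule continuous_open_preimage[OF continuous_on_act open_upper K_open]) (rule group.inv_closed[OF group_G g])
      then show ?thesis unfolding act_image_eq[OF g K_upper] .
    qed
    moreover have "act \<gamma> ` K n \<subseteq> upper" if "\<gamma> \<in> \<Delta>" for \<gamma>
      using act_upper[OF in_G[OF sub that]] K_upper by blast
    ultimately show "openin (top_of_set upper) (\<Union>(orbit_of \<Delta> ` K n))"
      by (simp add: openin_open_eq[OF open_upper] open_UN UN_least)
  qed
  have "topspace (quotient_topology \<Delta>) \<subseteq> \<Union>(range (\<lambda>n. orbit_of \<Delta> ` K n))"
    unfolding topspace_quotient[OF sub] quotient_space_def using K_ex by blast
  then obtain \<F> where \<F>: "finite \<F>" "\<F> \<subseteq> range (\<lambda>n. orbit_of \<Delta> ` K n)" "topspace (quotient_topology \<Delta>) \<subseteq> \<Union>\<F>"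
    using coc op unfolding cocompact_def compact_space_alt by (metis (no_types, lifting) rangeE)
  obtain J where J: "finite J" "\<F> = (\<lambda>n. orbit_of \<Delta> ` K n) ` J"
    using finite_subset_image[OF \<F>(1,2)] by blast
  \<comment> \<open>Inserting 0 keeps the maximum defined when no box is selected.\<close>
  define m where "m = Max (insert 0 J)"
  have ex: "\<exists>\<gamma>\<in>\<Delta>. act \<gamma> z \<in> K m" if z: "z \<in> upper" for z
  proof -
    have "orbit_of \<Delta> z \<in> \<Union>\<F>" using \<F>(3) topspace_quotient[OF sub] orbit_of_in_quotient[OF sub z] by blast
    then obtain n w where n: "n \<in> J" "w \<in> K n" "orbit_of \<Delta> z = orbit_of \<Delta> w" unfolding J(2) by blast
    have "n \<le> m" using n(1) J(1) by (simp add: m_def)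
    then have "w \<in> K m" using K_mono n(2) by blast
    moreover have "w \<in> orbit_of \<Delta> z" using n(3) orbit_of_self[OF sub] by simp
    ultimately show ?thesis by (auto simp: orbit_of_def)
  qed
  show ?thesis
  proof (rule that[of "real (Suc m)"])
    show "\<exists>\<gamma>\<in>\<Delta>. \<forall>i. 1 / real (Suc m) < Im (act \<gamma> z $ i) \<and> Im (act \<gamma> z $ i) < real (Suc m) \<and> \<bar>Re (act \<gamma> z $ i)\<bar> < real (Suc m)"
      if "z \<in> upper" for z
      using ex[OF that] unfolding K_iff .
  qed simp
qed

section \<open>Parabolic matrices: short displacement and smallness of the entries\<close>

text \<open>For trace 2, \<open>trace_displacement\<close> leaves \<open>hyp_e\<close> equal to a
  single square, which tends to 0 towards the fixed point: upwards when that point is infinity, and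
  down the vertical line over the double root of the fixed point polynomial otherwise.\<close>

lemma parabolic_small_displacement:
  assumes "det A = 1" "trace A = 2" "\<epsilon> > 0"
  shows "\<exists>z. Im z > 0 \<and> hyp_e z (moebius A z) < \<epsilon>\<^sup>2"
proof -
  define \<alpha> \<beta> \<gamma> \<delta> where "\<alpha> = A$1$1" and "\<beta> = A$1$2" and "\<gamma> = A$2$1" and "\<delta> = A$2$2"
  have det: "\<alpha> * \<delta> - \<beta> * \<gamma> = 1" and tr: "\<alpha> + \<delta> = 2"
    using assms by (simp_all add: det_2 trace2 \<alpha>_def \<beta>_def \<gamma>_def \<delta>_def)
  have e: "hyp_e z (moebius A z) = ((\<gamma> * (Re z)\<^sup>2 + (\<delta> - \<alpha>) * Re z - \<beta>) / Im z + \<gamma> * Im z)\<^sup>2" if "Im z > 0" for z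
    using trace_displacement[OF assms(1) that] assms(2) by (simp add: \<alpha>_def \<beta>_def \<gamma>_def \<delta>_def)
  have small: "?thesis" if z: "Im z > 0" "\<bar>(\<gamma> * (Re z)\<^sup>2 + (\<delta> - \<alpha>) * Re z - \<beta>) / Im z + \<gamma> * Im z\<bar> < \<epsilon>" for z
    using z e[OF z(1)] assms(3) by (intro exI[of _ z]) (metis abs_ge_zero power2_abs power_strict_mono zero_less_numeral)
  show ?thesis
  proof (cases "\<gamma> = 0")
    case True
    \<comment> \<open>The added 1 keeps the height positive when \<open>\<beta>\<close>
      vanishes.\<close>
    define y where "y = (\<bar>\<beta>\<bar> + 1) / \<epsilon>"
    have y: "y > 0" using assms(3) by (simp add: y_def)
    have "\<bar>\<beta>\<bar> / y < \<epsilon>" using assms(3) by (simp add: y_def field_simps)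
    then show ?thesis using y True by (intro small[of "Complex 0 y"]) auto
  next
    case False
    define x where "x = (\<alpha> - \<delta>) / (2 * \<gamma>)"
    define y where "y = \<epsilon> / (2 * \<bar>\<gamma>\<bar>)"
    have y: "y > 0" using False assms(3) by (simp add: y_def)
    have "4 * \<gamma> * (\<gamma> * x\<^sup>2 + (\<delta> - \<alpha>) * x - \<beta>) = (2 * \<gamma> * x + (\<delta> - \<alpha>))\<^sup>2 - ((\<alpha> + \<delta>)\<^sup>2 - 4 * (\<alpha> * \<delta> - \<beta> * \<gamma>))"
      by (simp add: power2_eq_square algebra_simps)
    also have "2 * \<gamma> * x + (\<delta> - \<alpha>) = 0" using False by (simp add: x_def)
    finally have P: "\<gamma> * x\<^sup>2 + (\<delta> - \<alpha>) * x - \<beta> = 0" using False det tr by simp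
    have "\<bar>\<gamma> * y\<bar> = \<epsilon> / 2" using False assms(3) by (simp add: y_def abs_mult)
    then show ?thesis using y P assms(3) by (intro small[of "Complex x y"]) auto
  qed
qed

text \<open>The discriminant \<open>trace\<^sup>2 - 4 * det\<close> vanishes, so
  \<open>p * q\<close> is a quarter of a square and \<open>p\<close>, \<open>q\<close> have the same
  sign; smallness of their sum makes each of them small. The bounds on \<open>z\<close> convert this
  to the entries of \<open>A - 1\<close>. The factor 6 comes from the upper right entry, a sum of
  three terms with constants 1, 4 and 1.\<close>

lemma parabolic_entries_small:
  assumes "det A = 1" "trace A = 2" "k \<ge> 1" "1 / k < Im z" "Im z < k" "\<bar>Re z\<bar> < k"
    and e: "hyp_e z (moebius A z) < \<epsilon>\<^sup>2" and \<epsilon>: "\<epsilon> > 0"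
  shows "\<bar>A$1$1 - 1\<bar> \<le> 6 * k ^ 3 * \<epsilon>" "\<bar>A$1$2\<bar> \<le> 6 * k ^ 3 * \<epsilon>" "\<bar>A$2$1\<bar> \<le> 6 * k ^ 3 * \<epsilon>" "\<bar>A$2$2 - 1\<bar> \<le> 6 * k ^ 3 * \<epsilon>"
proof -
  define \<alpha> \<beta> \<gamma> \<delta> where "\<alpha> = A$1$1" and "\<beta> = A$1$2" and "\<gamma> = A$2$1" and "\<delta> = A$2$2"
  define x y where "x = Re z" and "y = Im z"
  have det: "\<alpha> * \<delta> - \<beta> * \<gamma> = 1" and tr: "\<alpha> + \<delta> = 2"
    using assms by (simp_all add: det_2 trace2 \<alpha>_def \<beta>_def \<gamma>_def \<delta>_def)
  have "0 < 1 / k" using assms(3) by simp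
  then have "y > 0" using assms(4) unfolding y_def by (rule less_trans)
  then have y: "y > 0" "1 / k < y" "y < k" and x: "\<bar>x\<bar> < k" using assms(4-6) by (simp_all add: x_def y_def)
  define P where "P = \<gamma> * x\<^sup>2 + (\<delta> - \<alpha>) * x - \<beta>"
  define p q where "p = P / y" and "q = \<gamma> * y"
  have "(p + q)\<^sup>2 < \<epsilon>\<^sup>2"
    using trace_displacement[OF assms(1), of z] e y(1) assms(2)
    by (simp add: p_def q_def P_def x_def y_def \<alpha>_def \<beta>_def \<gamma>_def \<delta>_def)
  then have pq: "\<bar>p + q\<bar> < \<epsilon>" using \<epsilon> by (metis abs_of_pos power2_abs power_less_imp_less_base less_imp_le)
  have "4 * (p * q) = (2 * \<gamma> * x + (\<delta> - \<alpha>))\<^sup>2"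
  proof -
    have "4 * (p * q) = 4 * \<gamma> * P" using y(1) by (simp add: p_def q_def)
    also have "\<dots> = (2 * \<gamma> * x + (\<delta> - \<alpha>))\<^sup>2 - ((\<alpha> + \<delta>)\<^sup>2 - 4 * (\<alpha> * \<delta> - \<beta> * \<gamma>))"
      by (simp add: P_def power2_eq_square algebra_simps)
    finally show ?thesis using det tr by simp
  qed
  then have sq: "(2 * \<gamma> * x + (\<delta> - \<alpha>))\<^sup>2 = 4 * (p * q)" by simp
  then have "p * q \<ge> 0" by (metis zero_le_mult_iff zero_le_numeral zero_le_power2 not_numeral_le_zero)
  then have p: "\<bar>p\<bar> < \<epsilon>" and q: "\<bar>q\<bar> < \<epsilon>" using pq by (auto simp: zero_le_mult_iff)
  have "(2 * \<gamma> * x + (\<delta> - \<alpha>))\<^sup>2 \<le> (2 * \<epsilon>)\<^sup>2"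
  proof -
    have "p * q \<le> \<bar>p\<bar> * \<bar>q\<bar>" by (simp add: abs_mult[symmetric])
    also have "\<dots> \<le> \<epsilon> * \<epsilon>" using p q by (intro mult_mono) auto
    finally show ?thesis using sq by (simp add: power2_eq_square)
  qed
  \<comment> \<open>This expression is the derivative of the fixed point polynomial, with square
    \<open>4 * (p * q)\<close>; it controls the difference of the diagonal entries.\<close>
  then have r: "\<bar>2 * \<gamma> * x + (\<delta> - \<alpha>)\<bar> \<le> 2 * \<epsilon>"
    using \<epsilon> by (metis abs_le_square_iff abs_of_pos mult_pos_pos zero_less_numeral)
  have k3: "k \<le> k ^ 3" "k\<^sup>2 \<le> k ^ 3" "1 \<le> k ^ 3" "1 \<le> k\<^sup>2"
    using assms(3) by (auto intro: power_increasing self_le_power)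
  have g: "\<bar>\<gamma>\<bar> \<le> \<epsilon> * k"
  proof -
    have "\<bar>\<gamma>\<bar> = \<bar>q\<bar> * (1 / y)" using y(1) by (simp add: q_def abs_mult)
    also have "\<dots> \<le> \<epsilon> * k"
      using q y assms(3) by (intro mult_mono) (auto simp: field_simps)
    finally show ?thesis .
  qed
  have Pb: "\<bar>P\<bar> \<le> \<epsilon> * k"
  proof -
    have "\<bar>P\<bar> = \<bar>p\<bar> * y" using y(1) by (simp add: p_def)
    also have "\<dots> \<le> \<epsilon> * k" using p y by (intro mult_mono) auto
    finally show ?thesis .
  qed
  have gx: "\<bar>\<gamma> * x\<bar> \<le> \<epsilon> * k\<^sup>2"
  proof -
    have "\<bar>\<gamma> * x\<bar> \<le> (\<epsilon> * k) * k" unfolding abs_mult using g x by (intro mult_mono) auto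
    then show ?thesis by (simp add: power2_eq_square mult.assoc)
  qed
  have "\<epsilon> * 1 \<le> \<epsilon> * k\<^sup>2" using \<epsilon> k3(4) by (intro mult_left_mono) auto
  then have da: "\<bar>\<delta> - \<alpha>\<bar> \<le> 4 * (\<epsilon> * k\<^sup>2)" using r gx by linarith
  have bounds: "\<epsilon> * k \<le> k ^ 3 * \<epsilon>" "\<epsilon> * k\<^sup>2 \<le> k ^ 3 * \<epsilon>" "0 \<le> k ^ 3 * \<epsilon>"
    using \<epsilon> k3 assms(3) by (auto simp: mult.commute[of _ \<epsilon>])
  show "\<bar>A$2$1\<bar> \<le> 6 * k ^ 3 * \<epsilon>" using g bounds by (simp add: \<gamma>_def)
  have "2 * \<bar>\<alpha> - 1\<bar> = \<bar>\<delta> - \<alpha>\<bar>" "2 * \<bar>\<delta> - 1\<bar> = \<bar>\<delta> - \<alpha>\<bar>" using tr by (simp_all add: abs_if)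
  then show "\<bar>A$1$1 - 1\<bar> \<le> 6 * k ^ 3 * \<epsilon>" "\<bar>A$2$2 - 1\<bar> \<le> 6 * k ^ 3 * \<epsilon>"
    using da bounds by (simp_all add: \<alpha>_def \<delta>_def)
  have "\<beta> = \<gamma> * x * x + (\<delta> - \<alpha>) * x - P" by (simp add: P_def power2_eq_square)
  moreover have "\<bar>\<gamma> * x * x\<bar> \<le> k ^ 3 * \<epsilon>"
  proof -
    have "\<bar>\<gamma> * x * x\<bar> \<le> (\<epsilon> * k\<^sup>2) * k" unfolding abs_mult[of "\<gamma> * x" x] using gx x by (intro mult_mono) auto
    then show ?thesis by (simp add: power3_eq_cube power2_eq_square mult_ac)
  qed
  moreover have "\<bar>(\<delta> - \<alpha>) * x\<bar> \<le> 4 * (k ^ 3 * \<epsilon>)"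
  proof -
    have "\<bar>(\<delta> - \<alpha>) * x\<bar> \<le> (4 * (\<epsilon> * k\<^sup>2)) * k" unfolding abs_mult using da x by (intro mult_mono) auto
    then show ?thesis by (simp add: power3_eq_cube power2_eq_square mult_ac)
  qed
  moreover have "\<bar>P\<bar> \<le> k ^ 3 * \<epsilon>" using Pb bounds by simp
  ultimately have "\<bar>\<beta>\<bar> \<le> 6 * (k ^ 3 * \<epsilon>)" by linarith
  then show "\<bar>A$1$2\<bar> \<le> 6 * k ^ 3 * \<epsilon>" by (simp add: \<beta>_def)
qed

section \<open>Displacement in the congruence subgroups\<close>

context arithmetic_data
begin

lemma ab_int: "algebraic_int a" "algebraic_int b"
  using integral by simp_all

lemma sigma_embedding: "field_embedding (\<sigma> i)"
  using split_embeddings by blast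

text \<open>The data prescribe traces. Twice a determinant is the square of the trace minus the
  trace of the square, so \<open>\<rho>\<close> also carries reduced norms to determinants.\<close>

lemma det_rho: "det (\<rho> i x) = \<sigma> i (qnrd a b x)"
proof -
  obtain x0 x1 x2 x3 where x: "x = (x0, x1, x2, x3)" by (cases x)
  have "2 * det (\<rho> i x) = (trace (\<rho> i x))\<^sup>2 - trace (\<rho> i (qmult a b x x))"
    using trace_square[of "\<rho> i x"] by (simp add: hom_mult)
  also have "\<dots> = \<sigma> i ((qtr x)\<^sup>2 - qtr (qmult a b x x))"
    by (simp add: trace field_embedding_diff[OF sigma_embedding] field_embedding_power[OF sigma_embedding])
  also have "(qtr x)\<^sup>2 - qtr (qmult a b x x) = 2 * qnrd a b x"
    by (simp add: x power2_eq_square algebra_simps)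
  also have "\<sigma> i (2 * qnrd a b x) = 2 * \<sigma> i (qnrd a b x)"
    by (simp add: field_embedding_mult[OF sigma_embedding] field_embedding_numeral[OF sigma_embedding])
  finally show ?thesis by simp
qed

definition img :: "'k quat \<Rightarrow> 'r psl" where
  "img x = psl (\<lambda>i. \<rho> i x)"

lemma psl_image_img: "psl_image \<rho> S = img ` S"
  by (simp add: psl_image_def img_def psl_def)

lemma det_rho_Q1: "x \<in> Q1 a b \<Longrightarrow> det (\<rho> i x) = 1"
  by (simp add: det_rho Q1_iff field_embedding_1[OF sigma_embedding])

lemma img_in_G: "x \<in> Q1 a b \<Longrightarrow> img x \<in> carrier G"
  unfolding img_def by (intro psl_in_G det_rho_Q1)

lemma img_mult: "x \<in> Q1 a b \<Longrightarrow> y \<in> Q1 a b \<Longrightarrow> img x \<otimes>\<^bsub>G\<^esub> img y = img (qmult a b x y)"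
  by (simp add: img_def psl_mult det_rho_Q1 hom_mult)

lemma img_qone: "img qone = \<one>\<^bsub>G\<^esub>"
  by (simp add: img_def hom_one psl_one)

lemma qmult_qconj_Q1: "x \<in> Q1 a b \<Longrightarrow> qmult a b x (qconj x) = qone" "x \<in> Q1 a b \<Longrightarrow> qmult a b (qconj x) x = qone"
  by (simp_all add: qmult_qconj Q1_iff qone_def)

lemma img_inv: "x \<in> Q1 a b \<Longrightarrow> inv\<^bsub>G\<^esub> (img x) = img (qconj x)"
  by (intro group.inv_equality[OF group_G])
     (simp_all add: img_mult qconj_in_Q1 qmult_qconj_Q1 img_qone img_in_G)

lemma subgroup_img:
  assumes S: "S \<subseteq> Q1 a b" "qone \<in> S" and m: "\<And>x y. x \<in> S \<Longrightarrow> y \<in> S \<Longrightarrow> qmult a b x y \<in> S"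
    and c: "\<And>x. x \<in> S \<Longrightarrow> qconj x \<in> S"
  shows "subgroup (img ` S) G"
proof (rule group.subgroupI[OF group_G])
  show "img ` S \<subseteq> carrier G" using S img_in_G by blast
  show "img ` S \<noteq> {}" using S by blast
  show "inv\<^bsub>G\<^esub> g \<in> img ` S" if g: "g \<in> img ` S" for g
  proof -
    obtain x where "x \<in> S" "g = img x" using g by blast
    then show ?thesis using img_inv[of x] c[of x] S(1) by auto
  qed
  show "g \<otimes>\<^bsub>G\<^esub> h \<in> img ` S" if gh: "g \<in> img ` S" "h \<in> img ` S" for g h
  proof -
    obtain x y where "x \<in> S" "g = img x" "y \<in> S" "h = img y" using gh by blast
    then show ?thesis using img_mult[of x y] m[of x y] S(1) by auto
  qed
qed

abbreviation P where "P \<equiv> psl_image \<rho> (Q1 a b)"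
abbreviation Pn where "Pn n \<equiv> psl_image \<rho> (Q1_cong a b (pow3_ideal n))"

lemma Q1_cong_subset: "Q1_cong a b I \<subseteq> Q1 a b"
  by (auto simp: Q1_cong_iff)

lemma subgroup_P: "subgroup P G"
  unfolding psl_image_img by (intro subgroup_img qone_in_Q1 qmult_in_Q1 qconj_in_Q1 ab_int) auto

lemma subgroup_Pn: "subgroup (Pn n) G"
  unfolding psl_image_img
  by (intro subgroup_img qone_in_Q1 qmult_in_Q1_cong qconj_in_Q1_cong ab_int Q1_cong_subset)

abbreviation "embs \<equiv> {\<tau> :: 'k \<Rightarrow> real. field_embedding \<tau>}"

lemma ramified_negative:
  assumes "\<tau> \<in> embs" "\<tau> \<notin> range \<sigma>"
  shows "\<tau> a < 0" "\<tau> b < 0"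
  using not_splits_negative[of a b \<tau>] assms split_embeddings nonzero by auto

lemma ramified_nonneg:
  assumes "\<tau> \<in> embs" "\<tau> \<notin> range \<sigma>"
  shows "(- \<tau> a) * t\<^sup>2 \<ge> 0" "(- \<tau> b) * t\<^sup>2 \<ge> 0" "(\<tau> a * \<tau> b) * t\<^sup>2 \<ge> 0"
proof -
  have n: "0 \<le> - \<tau> a" "0 \<le> - \<tau> b" "0 \<le> \<tau> a * \<tau> b"
    using ramified_negative[OF assms] by (simp_all add: mult_nonpos_nonpos)
  show "(- \<tau> a) * t\<^sup>2 \<ge> 0" by (rule mult_nonneg_nonneg[OF n(1) zero_le_power2])
  show "(- \<tau> b) * t\<^sup>2 \<ge> 0" by (rule mult_nonneg_nonneg[OF n(2) zero_le_power2])
  show "(\<tau> a * \<tau> b) * t\<^sup>2 \<ge> 0" by (rule mult_nonneg_nonneg[OF n(3) zero_le_power2])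
qed

text \<open>The signs are arranged so that at a non-split embedding every term is nonnegative by
  \<open>ramified_nonneg\<close>; there the equation bounds each coordinate.\<close>

lemma ramified_norm:
  assumes "\<tau> \<in> embs" and "(x0, x1, x2, x3) \<in> Q1 a b"
  shows "(\<tau> x0)\<^sup>2 + (- \<tau> a) * (\<tau> x1)\<^sup>2 + (- \<tau> b) * (\<tau> x2)\<^sup>2 + (\<tau> a * \<tau> b) * (\<tau> x3)\<^sup>2 = 1"
proof -
  have \<tau>: "field_embedding \<tau>" using assms(1) by simp
  have "\<tau> (x0\<^sup>2 - a * x1\<^sup>2 - b * x2\<^sup>2 + a * b * x3\<^sup>2) = 1"
    using assms(2) by (simp add: Q1_iff field_embedding_1[OF \<tau>])
  then show ?thesis
    by (simp add: field_embedding_add[OF \<tau>] field_embedding_diff[OF \<tau>] field_embedding_mult[OF \<tau>] field_embedding_power[OF \<tau>])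
qed

text \<open>With a ramified real place, a first coordinate 1 exhausts the definite norm form and the
  other coordinates vanish. Otherwise all real embeddings are split. A conjugate \<open>y\<close> of
  \<open>x\<close> by an element of \<open>Q1 a b\<close> is then close to 1 in every factor, so its
  traces against the basis quaternions are algebraic integers all of whose conjugates are smaller
  than 1, hence zero.\<close>

lemma no_parabolic:
  assumes x: "x \<in> Q1 a b" and x0: "fst x = 1"
  shows "x = qone"
proof (cases "embs \<subseteq> range \<sigma>")
  case False
  then obtain \<tau> where \<tau>: "\<tau> \<in> embs" "\<tau> \<notin> range \<sigma>" by blast
  obtain x1 x2 x3 where x': "x = (1, x1, x2, x3)" using x0 by (cases x) auto
  have e: "field_embedding \<tau>" using \<tau>(1) by simp
  note neg = ramified_negative[OF \<tau>]
  have "(- \<tau> a) * (\<tau> x1)\<^sup>2 + (- \<tau> b) * (\<tau> x2)\<^sup>2 + (\<tau> a * \<tau> b) * (\<tau> x3)\<^sup>2 = 0"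
    using ramified_norm[OF \<tau>(1) x[unfolded x']] by (simp add: field_embedding_1[OF e])
  moreover have "(- \<tau> a) * (\<tau> x1)\<^sup>2 \<ge> 0" "(- \<tau> b) * (\<tau> x2)\<^sup>2 \<ge> 0" "(\<tau> a * \<tau> b) * (\<tau> x3)\<^sup>2 \<ge> 0"
    by (rule ramified_nonneg[OF \<tau>])+
  ultimately have "(- \<tau> a) * (\<tau> x1)\<^sup>2 = 0" "(- \<tau> b) * (\<tau> x2)\<^sup>2 = 0" "(\<tau> a * \<tau> b) * (\<tau> x3)\<^sup>2 = 0" by linarith+
  then show ?thesis using nonzero by (simp add: x' qone_def field_embedding_eq_0[OF e])
next
  case True
  obtain k :: real where k: "k \<ge> 1"
    "\<And>z. z \<in> upper \<Longrightarrow> \<exists>\<gamma>\<in>P. \<forall>i. 1 / k < Im (act \<gamma> z $ i) \<and> Im (act \<gamma> z $ i) < k \<and> \<bar>Re (act \<gamma> z $ i)\<bar> < k"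
    using compact_exhaustion[OF subgroup_P cocompact] by blast
  \<comment> \<open>The traces of \<open>y\<close> against these elements are its last three
    coordinates up to the factors \<open>2 * a\<close>, \<open>2 * b\<close> and
    \<open>- 2 * a * b\<close>, all nonzero.\<close>
  define test :: "'k quat set" where "test = {(0, 1, 0, 0), (0, 0, 1, 0), (0, 0, 0, 1)}"
  \<comment> \<open>A strict bound for the entries of the test matrices in all factors; the summand
    1 makes it strict and positive.\<close>
  define m where "m = 1 + (\<Sum>v\<in>test. \<Sum>i\<in>UNIV. \<bar>\<rho> i v $ 1 $ 1\<bar> + \<bar>\<rho> i v $ 1 $ 2\<bar> + \<bar>\<rho> i v $ 2 $ 1\<bar> + \<bar>\<rho> i v $ 2 $ 2\<bar>)"
  have m_sum: "\<bar>\<rho> i v $ 1 $ 1\<bar> + \<bar>\<rho> i v $ 1 $ 2\<bar> + \<bar>\<rho> i v $ 2 $ 1\<bar> + \<bar>\<rho> i v $ 2 $ 2\<bar> < m" if "v \<in> test" for i v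
  proof -
    have "\<bar>\<rho> i v $ 1 $ 1\<bar> + \<bar>\<rho> i v $ 1 $ 2\<bar> + \<bar>\<rho> i v $ 2 $ 1\<bar> + \<bar>\<rho> i v $ 2 $ 2\<bar>
      \<le> (\<Sum>i\<in>UNIV. \<bar>\<rho> i v $ 1 $ 1\<bar> + \<bar>\<rho> i v $ 1 $ 2\<bar> + \<bar>\<rho> i v $ 2 $ 1\<bar> + \<bar>\<rho> i v $ 2 $ 2\<bar>)"
      by (rule member_le_sum) auto
    also have "\<dots> \<le> (\<Sum>v\<in>test. \<Sum>i\<in>UNIV. \<bar>\<rho> i v $ 1 $ 1\<bar> + \<bar>\<rho> i v $ 1 $ 2\<bar> + \<bar>\<rho> i v $ 2 $ 1\<bar> + \<bar>\<rho> i v $ 2 $ 2\<bar>)"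
      using that by (intro member_le_sum[of v test]) (auto simp: test_def intro!: sum_nonneg)
    finally show ?thesis by (simp add: m_def)
  qed
  have "m \<ge> 1" unfolding m_def by (auto intro!: sum_nonneg)
  \<comment> \<open>The constant \<open>6 * k ^ 3\<close> is the loss in
    \<open>parabolic_entries_small\<close>, and \<open>m\<close> the loss in passing to
    traces.\<close>
  define \<epsilon> where "\<epsilon> = 1 / (6 * k ^ 3 * m)"
  have \<epsilon>: "\<epsilon> > 0" "6 * k ^ 3 * \<epsilon> * m = 1" using k(1) \<open>m \<ge> 1\<close> by (auto simp: \<epsilon>_def)
  have tr2: "trace (\<rho> i y) = 2" if "fst y = 1" for i y
    using trace[of i y] that by (cases y) (simp add: field_embedding_numeral[OF sigma_embedding])
  have "\<forall>i. \<exists>z. Im z > 0 \<and> hyp_e z (moebius (\<rho> i x) z) < \<epsilon>\<^sup>2"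
    using parabolic_small_displacement[OF det_rho_Q1[OF x] tr2[OF x0] \<epsilon>(1)] by blast
  then obtain Z where Z: "\<And>i. Im (Z i) > 0" "\<And>i. hyp_e (Z i) (moebius (\<rho> i x) (Z i)) < \<epsilon>\<^sup>2" by metis
  have "(\<chi> i. Z i) \<in> upper" using Z(1) by (simp add: upper_def)
  then obtain g where g: "g \<in> P" "\<And>i. 1 / k < Im (act g (\<chi> i. Z i) $ i) \<and> Im (act g (\<chi> i. Z i) $ i) < k \<and> \<bar>Re (act g (\<chi> i. Z i) $ i)\<bar> < k"
    using k(2) by meson
  then obtain q where q: "q \<in> Q1 a b" "g = img q" by (auto simp: psl_image_img)
  \<comment> \<open>Conjugation by \<open>q\<close> moves the nearly fixed points into the compact
    box without changing the displacement.\<close>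
  define y where "y = qmult a b (qmult a b q x) (qconj q)"
  have y: "y \<in> Q1 a b" unfolding y_def by (intro qmult_in_Q1 ab_int q(1) x qconj_in_Q1)
  have "qtr y = qtr (qmult a b (qconj q) (qmult a b q x))" unfolding y_def by (rule qtr_qmult_commute)
  also have "\<dots> = qtr x" using qmult_qconj_Q1(2)[OF q(1)] by (simp add: qmult_assoc[symmetric])
  finally have y0: "fst y = 1" using x0 by (cases x; cases y) simp
  have W: "moebius (\<rho> i q) (Z i) = act g (\<chi> i. Z i) $ i" for i by (simp add: q(2) img_def act_psl)
  have disp: "hyp_e (moebius (\<rho> i q) (Z i)) (moebius (\<rho> i y) (moebius (\<rho> i q) (Z i))) < \<epsilon>\<^sup>2" for i
  proof -
    have dq: "det (\<rho> i q) = 1" "det (\<rho> i y) = 1" "det (\<rho> i x) = 1" using det_rho_Q1 q(1) y x by auto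
    have "qmult a b y q = qmult a b q x"
      unfolding y_def qmult_assoc qmult_qconj_Q1(2)[OF q(1)] by simp
    then have "\<rho> i y ** \<rho> i q = \<rho> i q ** \<rho> i x" by (metis hom_mult)
    then have "moebius (\<rho> i y) (moebius (\<rho> i q) (Z i)) = moebius (\<rho> i q) (moebius (\<rho> i x) (Z i))"
      using moebius_mult[OF dq(2,1) Z(1)[of i]] moebius_mult[OF dq(1,3) Z(1)[of i]] by simp
    then show ?thesis
      using hyp_e_moebius[OF dq(1) Z(1)[of i] Im_moebius_pos[OF dq(3) Z(1)[of i]]] Z(2)[of i] by simp
  qed
  have ent: "\<bar>\<rho> i y $ 1 $ 1 - 1\<bar> \<le> 6 * k ^ 3 * \<epsilon>" "\<bar>\<rho> i y $ 1 $ 2\<bar> \<le> 6 * k ^ 3 * \<epsilon>"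
    "\<bar>\<rho> i y $ 2 $ 1\<bar> \<le> 6 * k ^ 3 * \<epsilon>" "\<bar>\<rho> i y $ 2 $ 2 - 1\<bar> \<le> 6 * k ^ 3 * \<epsilon>" for i
    using parabolic_entries_small[OF det_rho_Q1[OF y] tr2[OF y0] k(1) _ _ _ disp \<epsilon>(1)] g(2)[of i] unfolding W by blast+
  have tr_small: "\<bar>\<sigma> i (qtr (qmult a b y v))\<bar> < 1" if v: "v \<in> test" for i v
  proof -
    let ?A = "\<rho> i y" and ?M = "\<rho> i v" and ?e = "6 * k ^ 3 * \<epsilon>"
    \<comment> \<open>Because the test element has trace 0, replacing \<open>y\<close> by
      \<open>y - 1\<close> does not change the trace of the product, and the entries of
      \<open>y - 1\<close> are small.\<close>
    have "trace ?M = 0" using trace[of i v] v by (auto simp: test_def field_embedding_0[OF sigma_embedding])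
    then have "\<sigma> i (qtr (qmult a b y v)) = (?A$1$1 - 1) * ?M$1$1 + ?A$1$2 * ?M$2$1 + ?A$2$1 * ?M$1$2 + (?A$2$2 - 1) * ?M$2$2"
      unfolding trace[symmetric] hom_mult by (simp add: trace2 mult2_component algebra_simps)
    also have "\<bar>\<dots>\<bar> \<le> \<bar>(?A$1$1 - 1) * ?M$1$1\<bar> + \<bar>?A$1$2 * ?M$2$1\<bar> + \<bar>?A$2$1 * ?M$1$2\<bar> + \<bar>(?A$2$2 - 1) * ?M$2$2\<bar>"
      by linarith
    also have "\<dots> \<le> ?e * \<bar>?M$1$1\<bar> + ?e * \<bar>?M$2$1\<bar> + ?e * \<bar>?M$1$2\<bar> + ?e * \<bar>?M$2$2\<bar>"
      unfolding abs_mult using ent[of i] by (intro add_mono mult_right_mono) auto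
    also have "\<dots> = ?e * (\<bar>?M$1$1\<bar> + \<bar>?M$1$2\<bar> + \<bar>?M$2$1\<bar> + \<bar>?M$2$2\<bar>)" by (simp add: algebra_simps)
    also have "\<dots> < ?e * m" using m_sum[OF v, of i] \<epsilon>(1) k(1) by (intro mult_strict_left_mono) auto
    also have "\<dots> = 1" by (rule \<epsilon>(2))
    finally show ?thesis .
  qed
  obtain y1 y2 y3 where y': "y = (1, y1, y2, y3)" using y0 by (cases y) auto
  have int: "algebraic_int y1" "algebraic_int y2" "algebraic_int y3" using y by (auto simp: Q1_iff y')
  have vanish: "w = 0" if w: "algebraic_int w" "\<And>i. \<bar>\<sigma> i w\<bar> < 1" for w
  proof (rule ccontr)
    assume "w \<noteq> 0"
    then have "1 \<le> (\<Prod>\<tau>\<in>embs. \<bar>\<tau> w\<bar>)" using norm_algebraic_int_ge_1[OF number_field totally_real w(1)] by blast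
    moreover have "(\<Prod>\<tau>\<in>embs. \<bar>\<tau> w\<bar>) < (\<Prod>\<tau>\<in>embs. 1)"
    \<comment> \<open>Strictness is witnessed at an arbitrary split embedding; there is one because
      index types are nonempty.\<close>
    proof (rule prod_mono_strict[where i = "\<sigma> undefined"])
      show "finite embs" by (rule finite_real_embeddings[OF number_field totally_real])
      show "0 \<le> \<bar>\<tau> w\<bar> \<and> \<bar>\<tau> w\<bar> \<le> 1" if "\<tau> \<in> embs" for \<tau> using True that w(2) by (auto simp: less_imp_le)
    qed (use sigma_embedding w(2) in auto)
    ultimately show False by simp
  qed
  have "qtr (qmult a b y v) = 0" if v: "v \<in> test" for v
  proof (rule vanish)
    show "\<bar>\<sigma> i (qtr (qmult a b y v))\<bar> < 1" for i by (rule tr_small[OF v])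
    show "algebraic_int (qtr (qmult a b y v))"
      using v int ab_int by (auto simp: test_def y' intro!: algebraic_int_mult)
  qed
  from this[of "(0, 1, 0, 0)"] this[of "(0, 0, 1, 0)"] this[of "(0, 0, 0, 1)"]
  have "y = qone" using nonzero by (simp add: test_def y' qone_def)
  then have "qmult a b (qmult a b (qconj q) y) q = qone" using qmult_qconj_Q1(2)[OF q(1)] by simp
  then show ?thesis
    unfolding y_def using qmult_qconj_Q1[OF q(1)] by (metis qmult_assoc qmult_qone)
qed

text \<open>Multiplying the bounds over all \<open>d\<close> real embeddings gives
  \<open>9 ^ (n * d)\<close> at most \<open>4 ^ d\<close> times the exponential of half the total
  displacement. Logarithms double everything: \<open>2 * ln 9 = 4 * ln 3\<close> is the main term
  and \<open>2 * d * ln 4\<close> the error.\<close>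

lemma displacement_Pn:
  assumes \<gamma>: "\<gamma> \<in> Pn n" "\<gamma> \<noteq> \<one>\<^bsub>G\<^esub>" and z: "z \<in> upper"
  shows "(4 * real n * real (degree_field TYPE('k)) * ln 3 - 2 * real (degree_field TYPE('k)) * ln 4) / sqrt (real CARD('r))
    \<le> upper_dist z (act \<gamma> z)"
proof -
  define d where "d = degree_field TYPE('k)"
  obtain x where x: "x \<in> Q1_cong a b (pow3_ideal n)" "\<gamma> = img x" using \<gamma>(1) by (auto simp: psl_image_img)
  have xQ: "x \<in> Q1 a b" using x(1) Q1_cong_subset by blast
  obtain x0 x1 x2 x3 where x': "x = (x0, x1, x2, x3)" by (cases x)
  have "x \<noteq> qone" using \<gamma>(2) x(2) img_qone by auto
  then have "x0 \<noteq> 1" using no_parabolic[OF xQ] x' by auto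
  obtain w where w: "algebraic_int w" "2 * (x0 - 1) = 9 ^ n * w"
    using trace_minus_2_congruence[OF ab_int x(1)[unfolded x']] by blast
  then have "w \<noteq> 0" using \<open>x0 \<noteq> 1\<close> by auto
  define l where "l i = hyp_dist (z $ i) (act \<gamma> z $ i)" for i
  have lpos: "l i \<ge> 0" for i
    using act_upper[OF img_in_G[OF xQ] z] z unfolding l_def x(2) by (intro hyp_dist_nonneg upper_component)
  \<comment> \<open>The bound for the conjugate of \<open>2 * (x0 - 1)\<close> at each place: the
    trace estimate where the algebra splits, and 4 where the definite norm form gives a conjugate of
    \<open>x0\<close> in the interval from -1 to 1.\<close>
  define B where "B \<tau> = (if \<tau> \<in> range \<sigma> then 4 * exp (l (the_inv \<sigma> \<tau>) / 2) else 4)" for \<tau>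
  have le: "9 ^ n * \<bar>\<tau> w\<bar> \<le> B \<tau>" if \<tau>: "\<tau> \<in> embs" for \<tau>
  proof -
    have e: "field_embedding \<tau>" using \<tau> by simp
    have "\<tau> (2 * (x0 - 1)) = \<tau> (9 ^ n * w)" by (simp only: w(2))
    then have eq: "2 * (\<tau> x0 - 1) = 9 ^ n * \<tau> w"
      by (simp add: field_embedding_mult[OF e] field_embedding_diff[OF e] field_embedding_numeral[OF e]
          field_embedding_power[OF e] field_embedding_1[OF e])
    have "\<bar>2 * (\<tau> x0 - 1)\<bar> \<le> B \<tau>"
    proof (cases "\<tau> \<in> range \<sigma>")
      case True
      then obtain i where i: "\<tau> = \<sigma> i" by blast
      have "trace (\<rho> i x) - 2 = 2 * (\<tau> x0 - 1)"
        by (simp add: trace x' i field_embedding_mult[OF sigma_embedding] field_embedding_numeral[OF sigma_embedding])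
      moreover have "\<bar>trace (\<rho> i x) - 2\<bar> \<le> 4 * exp (l i / 2)"
        using trace_minus_2_le[OF det_rho_Q1[OF xQ] upper_component[OF z]]
        by (simp add: l_def x(2) img_def act_psl)
      moreover have "B \<tau> = 4 * exp (l i / 2)" by (simp add: B_def i the_inv_f_f[OF inj_embeddings])
      ultimately show ?thesis by simp
    next
      case False
      have "(- \<tau> a) * (\<tau> x1)\<^sup>2 \<ge> 0" "(- \<tau> b) * (\<tau> x2)\<^sup>2 \<ge> 0" "(\<tau> a * \<tau> b) * (\<tau> x3)\<^sup>2 \<ge> 0"
        by (rule ramified_nonneg[OF \<tau> False])+
      then have "(\<tau> x0)\<^sup>2 \<le> 1" using ramified_norm[OF \<tau> xQ[unfolded x']] by linarith
      then have "\<bar>\<tau> x0\<bar> \<le> 1" by (simp add: abs_square_le_1)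
      then show ?thesis using False by (simp add: B_def)
    qed
    then show ?thesis unfolding eq by (simp add: abs_mult)
  qed
  note fin = finite_real_embeddings[OF number_field totally_real]
  have card: "card embs = d" unfolding d_def by (rule card_real_embeddings[OF number_field totally_real])
  have "(9 ^ n) ^ d * 1 \<le> (9 ^ n) ^ d * (\<Prod>\<tau>\<in>embs. \<bar>\<tau> w\<bar>)"
    using norm_algebraic_int_ge_1[OF number_field totally_real w(1) \<open>w \<noteq> 0\<close>] by (intro mult_left_mono) auto
  also have "\<dots> = (\<Prod>\<tau>\<in>embs. 9 ^ n * \<bar>\<tau> w\<bar>)" by (simp add: prod.distrib card)
  also have "\<dots> \<le> (\<Prod>\<tau>\<in>embs. B \<tau>)" using le by (intro prod_mono) auto
  also have "\<dots> = (\<Prod>\<tau>\<in>embs. 4 * (if \<tau> \<in> range \<sigma> then exp (l (the_inv \<sigma> \<tau>) / 2) else 1))"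
    by (intro prod.cong) (auto simp: B_def)
  also have "\<dots> = 4 ^ d * (\<Prod>\<tau>\<in>embs. if \<tau> \<in> range \<sigma> then exp (l (the_inv \<sigma> \<tau>) / 2) else 1)"
    by (simp add: prod.distrib card)
  also have "(\<Prod>\<tau>\<in>embs. if \<tau> \<in> range \<sigma> then exp (l (the_inv \<sigma> \<tau>) / 2) else 1) = (\<Prod>\<tau>\<in>range \<sigma>. exp (l (the_inv \<sigma> \<tau>) / 2))"
    using fin sigma_embedding by (intro prod.mono_neutral_cong_right) auto
  also have "\<dots> = (\<Prod>i\<in>UNIV. exp (l i / 2))"
    by (simp add: prod.reindex[OF inj_embeddings] the_inv_f_f[OF inj_embeddings])
  also have "\<dots> = exp ((\<Sum>i\<in>UNIV. l i) / 2)" by (simp add: exp_sum sum_divide_distrib)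
  finally have "(9 ^ n) ^ d \<le> 4 ^ d * exp ((\<Sum>i\<in>UNIV. l i) / 2)" by simp
  then have "ln ((9 ^ n) ^ d) \<le> ln (4 ^ d * exp ((\<Sum>i\<in>UNIV. l i) / 2))" by (subst ln_le_cancel_iff) auto
  then have "real d * (real n * ln 9) \<le> real d * ln 4 + (\<Sum>i\<in>UNIV. l i) / 2"
    by (simp add: ln_realpow ln_mult)
  moreover have "ln (9 :: real) = 2 * ln 3" using ln_realpow[of "3 :: real" 2] by simp
  ultimately have "4 * real n * real d * ln 3 - 2 * real d * ln 4 \<le> (\<Sum>i\<in>UNIV. l i)" by (simp add: algebra_simps)
  also have "\<dots> \<le> sqrt (real CARD('r)) * upper_dist z (act \<gamma> z)"
    unfolding l_def by (rule sum_hyp_dist_le_upper_dist)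
  finally show ?thesis unfolding d_def by (simp add: pos_divide_le_eq mult.commute)
qed

end

section \<open>Volumes of boxes\<close>

lemma vec_box_borel:
  assumes "S \<in> sets borel"
  shows "{z :: complex^'r::finite. \<forall>i. z $ i \<in> S} \<in> sets borel"
proof -
  have "{z :: complex^'r. \<forall>i. z $ i \<in> S} = (\<Inter>i. (\<lambda>z. z $ i) -` S)" by auto
  moreover have "(\<lambda>z :: complex^'r. z $ i) -` S \<in> sets borel" for i
    by (rule measurable_sets_borel[OF measurable_vec_nth assms])
  ultimately show ?thesis by (auto intro!: sets.finite_INT)
qed

lemma emeasure_upper_vol_vec_box:
  assumes S: "S \<in> sets borel"
  shows "emeasure upper_vol {z :: complex^'r::finite. \<forall>i. z $ i \<in> S} = emeasure hyp_meas S ^ CARD('r)"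
proof -
  interpret product_sigma_finite "\<lambda>_::'r. hyp_meas" by (rule product_sigma_finite_hyp_meas)
  have "emeasure upper_vol {z :: complex^'r. \<forall>i. z $ i \<in> S} =
      emeasure (PiM UNIV (\<lambda>_::'r. hyp_meas)) (vec_lambda -` {z. \<forall>i. z $ i \<in> S} \<inter> space (PiM UNIV (\<lambda>_::'r. hyp_meas)))"
    unfolding upper_vol_eq_distr by (rule emeasure_distr[OF measurable_vec_lambda_PiM(1) vec_box_borel[OF S]])
  also have "vec_lambda -` {z. \<forall>i. z $ i \<in> S} \<inter> space (PiM UNIV (\<lambda>_::'r. hyp_meas)) = PiE UNIV (\<lambda>_. S)"
    by (auto simp: space_PiM PiE_def Pi_def)
  also have "emeasure (PiM UNIV (\<lambda>_::'r. hyp_meas)) \<dots> = (\<Prod>i\<in>(UNIV :: 'r set). emeasure hyp_meas S)"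
    using S by (intro emeasure_PiM) auto
  finally show ?thesis by simp
qed

lemma emeasure_lborel_complex_box:
  assumes "x \<le> x'" "y \<le> y'"
  shows "emeasure lborel (box (Complex x y) (Complex x' y')) = ennreal ((x' - x) * (y' - y))"
  using assms by (simp add: emeasure_lborel_box_eq Basis_complex_def)

text \<open>The density is at least 1/4 at heights below 2, and the box has Euclidean area
  \<open>N\<close>.\<close>

lemma hyp_meas_box_ge:
  assumes "N \<ge> 0"
  shows "ennreal (N / 4) \<le> emeasure hyp_meas (box (Complex 0 1) (Complex N 2))"
proof -
  let ?S = "box (Complex 0 1) (Complex N 2)"
  have "ennreal (N / 4) = ennreal (1 / 4) * emeasure lborel ?S"
    using assms by (simp add: emeasure_lborel_complex_box ennreal_mult[symmetric])
  also have "\<dots> = (\<integral>\<^sup>+z. ennreal (1 / 4) * indicator ?S z \<partial>lborel)" by (simp add: nn_integral_cmult_indicator)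
  also have "\<dots> \<le> (\<integral>\<^sup>+z. hyp_density z * indicator ?S z \<partial>lborel)"
  proof (rule nn_integral_mono)
    fix z :: complex
    show "ennreal (1 / 4) * indicator ?S z \<le> hyp_density z * indicator ?S z"
    proof (cases "z \<in> ?S")
      case True
      then have z: "1 < Im z" "Im z < 2" by (auto simp: mem_box Basis_complex_def)
      then have "(Im z)\<^sup>2 \<le> 2\<^sup>2" by (intro power_mono) auto
      then have "1 / 4 \<le> 1 / (Im z)\<^sup>2" using z by (intro divide_left_mono) auto
      then show ?thesis using True z by (simp add: ennreal_leI)
    qed simp
  qed
  also have "\<dots> = emeasure hyp_meas ?S" unfolding hyp_meas_def by (intro emeasure_density[symmetric]) auto
  finally show ?thesis .
qed

text \<open>The density is at most \<open>k\<^sup>2\<close> above height \<open>1 / k\<close>, and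
  the enclosing rectangle has area \<open>2 * k\<^sup>2\<close>.\<close>

lemma hyp_meas_box_le:
  assumes "k \<ge> 1" "S \<in> sets borel" "\<And>z. z \<in> S \<Longrightarrow> 1 / k < Im z \<and> Im z < k \<and> \<bar>Re z\<bar> < k"
  shows "emeasure hyp_meas S \<le> ennreal (2 * k ^ 4)"
proof -
  let ?B = "box (Complex (- k) 0) (Complex k k)"
  have kp: "0 < 1 / k" using assms(1) by simp
  have "emeasure hyp_meas S = (\<integral>\<^sup>+z. hyp_density z * indicator S z \<partial>lborel)"
    unfolding hyp_meas_def using assms(2) by (intro emeasure_density) auto
  also have "\<dots> \<le> (\<integral>\<^sup>+z. ennreal (k\<^sup>2) * indicator ?B z \<partial>lborel)"
  proof (rule nn_integral_mono)
    fix z :: complex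
    show "hyp_density z * indicator S z \<le> ennreal (k\<^sup>2) * indicator ?B z"
    proof (cases "z \<in> S")
      case True
      then have z: "1 / k < Im z" "Im z < k" "\<bar>Re z\<bar> < k" using assms(3) by auto
      have pos: "0 < Im z" using kp z(1) by (rule less_trans)
      then have "z \<in> ?B" using z by (auto simp: mem_box Basis_complex_def)
      have "1 < Im z * k" using z(1) assms(1) by (simp add: field_simps)
      then have "1\<^sup>2 \<le> (Im z * k)\<^sup>2" by (intro power_mono) auto
      then have "1 / (Im z)\<^sup>2 \<le> k\<^sup>2" using pos by (simp add: divide_le_eq power_mult_distrib mult.commute)
      then show ?thesis using True \<open>z \<in> ?B\<close> pos by (simp add: ennreal_leI)
    qed simp
  qed
  also have "\<dots> = ennreal (k\<^sup>2) * emeasure lborel ?B" by (simp add: nn_integral_cmult_indicator)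
  also have "\<dots> = ennreal (2 * k ^ 4)"
    using assms(1) by (simp add: emeasure_lborel_complex_box ennreal_mult[symmetric] power2_eq_square power4_eq_xxxx)
  finally show ?thesis .
qed

section \<open>Counting cosets\<close>

text \<open>An upper bound for the index of \<open>D\<close> in \<open>H\<close>, stated through
  representatives of right cosets because these are what transports the compact box.\<close>

definition covers :: "'r::finite psl set \<Rightarrow> 'r psl set \<Rightarrow> nat \<Rightarrow> bool" where
  "covers H D m \<longleftrightarrow> (\<exists>R\<subseteq>H. finite R \<and> card R \<le> m \<and> (\<forall>g\<in>H. \<exists>r\<in>R. \<exists>d\<in>D. g = d \<otimes>\<^bsub>G\<^esub> r))"

text \<open>A function whose values separate the right cosets of \<open>D\<close> bounds their
  number; one representative is kept for each value.\<close>

lemma covers_by_key: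
  assumes H: "subgroup H G" and T: "f ` H \<subseteq> T" "finite T" "card T \<le> m"
    and key: "\<And>g h. g \<in> H \<Longrightarrow> h \<in> H \<Longrightarrow> f g = f h \<Longrightarrow> g \<otimes>\<^bsub>G\<^esub> inv\<^bsub>G\<^esub> h \<in> D"
  shows "covers H D m"
proof -
  interpret group G by (rule group_G)
  define R where "R = inv_into H f ` (f ` H)"
  have fin: "finite (f ` H)" using T finite_subset by blast
  have "card R \<le> card (f ` H)" unfolding R_def by (rule card_image_le[OF fin])
  also have "\<dots> \<le> card T" using T by (intro card_mono)
  finally have "card R \<le> m" using T(3) by simp
  moreover have "R \<subseteq> H" unfolding R_def by (auto intro: inv_into_into)
  moreover have "\<exists>r\<in>R. \<exists>d\<in>D. g = d \<otimes>\<^bsub>G\<^esub> r" if g: "g \<in> H" for g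
  proof -
    define r where "r = inv_into H f (f g)"
    have r: "r \<in> R" "r \<in> H" "f g = f r" using g by (auto simp: R_def r_def inv_into_into f_inv_into_f)
    have "g \<in> carrier G" "r \<in> carrier G" using in_G[OF H] g r by auto
    then have "g = (g \<otimes>\<^bsub>G\<^esub> inv\<^bsub>G\<^esub> r) \<otimes>\<^bsub>G\<^esub> r" by (simp add: m_assoc)
    then show ?thesis using key[OF g r(2,3)] r(1) by blast
  qed
  moreover have "finite R" unfolding R_def using fin by simp
  ultimately show ?thesis unfolding covers_def by (intro exI[of _ R] conjI ballI)
qed

lemma covers_trans:
  assumes H: "subgroup H G" and D: "subgroup D G" "D \<subseteq> H" and E: "E \<subseteq> carrier G"
    and "covers H D m" "covers D E n"
  shows "covers H E (n * m)"
proof -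
  interpret group G by (rule group_G)
  obtain R where R: "R \<subseteq> H" "finite R" "card R \<le> m" "\<And>g. g \<in> H \<Longrightarrow> \<exists>r\<in>R. \<exists>d\<in>D. g = d \<otimes>\<^bsub>G\<^esub> r"
    using assms(5) unfolding covers_def by blast
  obtain S where S: "S \<subseteq> D" "finite S" "card S \<le> n" "\<And>g. g \<in> D \<Longrightarrow> \<exists>r\<in>S. \<exists>d\<in>E. g = d \<otimes>\<^bsub>G\<^esub> r"
    using assms(6) unfolding covers_def by blast
  define Q where "Q = (\<lambda>(s, r). s \<otimes>\<^bsub>G\<^esub> r) ` (S \<times> R)"
  have "card Q \<le> card (S \<times> R)" unfolding Q_def using R S by (intro card_image_le) auto
  also have "\<dots> \<le> n * m" using R S by (simp add: card_cartesian_product mult_le_mono)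
  finally have "card Q \<le> n * m" .
  moreover have "Q \<subseteq> H" using R(1) S(1) D(2) subgroup.m_closed[OF H] by (auto simp: Q_def subset_iff)
  moreover have "\<exists>r\<in>Q. \<exists>d\<in>E. g = d \<otimes>\<^bsub>G\<^esub> r" if g: "g \<in> H" for g
  proof -
    obtain r d where rd: "r \<in> R" "d \<in> D" "g = d \<otimes>\<^bsub>G\<^esub> r" using R(4)[OF g] by blast
    obtain s e where se: "s \<in> S" "e \<in> E" "d = e \<otimes>\<^bsub>G\<^esub> s" using S(4)[OF rd(2)] by blast
    have "e \<in> carrier G" "s \<in> carrier G" "r \<in> carrier G"
      using E se(2) in_G[OF D(1)] S(1) se(1) in_G[OF H] R(1) rd(1) by auto
    then have "g = e \<otimes>\<^bsub>G\<^esub> (s \<otimes>\<^bsub>G\<^esub> r)" by (simp add: rd(3) se(3) m_assoc)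
    then show ?thesis using se rd by (force simp: Q_def)
  qed
  moreover have "finite Q" using R S by (simp add: Q_def)
  ultimately show ?thesis unfolding covers_def by (intro exI[of _ Q] conjI ballI)
qed

text \<open>If the \<open>H\<close>-translates of \<open>K\<close> fill the space, then the
  translates of \<open>K\<close> by the coset representatives form a set whose saturation under
  \<open>\<Delta>\<close> is everything. Its volume is at most the number of representatives times
  that of \<open>K\<close>.\<close>

lemma (in displaced) vol_le_of_covers:
  assumes H: "subgroup H G" and cov: "covers H \<Delta> m"
    and K: "K \<in> sets borel" "K \<subseteq> upper" "emeasure upper_vol K \<le> ennreal c" "c \<ge> 0"
    and HK: "\<And>z. z \<in> upper \<Longrightarrow> \<exists>g\<in>H. act g z \<in> K"
  shows "vol \<Delta> \<le> real m * c"
    "\<And>U k. U \<in> sets borel \<Longrightarrow> small U \<Longrightarrow> ennreal k \<le> emeasure upper_vol U \<Longrightarrow> k \<le> vol \<Delta>"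
proof -
  obtain R where R: "R \<subseteq> H" "finite R" "card R \<le> m" "\<And>g. g \<in> H \<Longrightarrow> \<exists>r\<in>R. \<exists>d\<in>\<Delta>. g = d \<otimes>\<^bsub>G\<^esub> r"
    using cov unfolding covers_def by blast
  have RG: "r \<in> carrier G" if "r \<in> R" for r using in_G[OF H] R(1) that by blast
  define B where "B = (\<Union>r\<in>R. act r ` K)"
  have Kr: "act r ` K \<in> sets borel" if "r \<in> R" for r using RG[OF that] K(2,1) by (rule act_image_borel)
  have "B \<in> sets borel" unfolding B_def using R(2) Kr by (intro sets.finite_UN) auto
  moreover have "B \<subseteq> upper" using act_upper RG K(2) by (auto simp: B_def)
  moreover have "upper \<subseteq> sat B"
  proof
    fix z :: "complex^'r" assume z: "z \<in> upper"
    obtain g where g: "g \<in> H" "act g z \<in> K" using HK[OF z] by blast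
    have gG: "g \<in> carrier G" using in_G[OF H g(1)] .
    have "inv\<^bsub>G\<^esub> g \<in> H" using subgroup.m_inv_closed[OF H g(1)] .
    \<comment> \<open>The inverse of \<open>g\<close> is decomposed, since \<open>z\<close> is
      recovered from \<open>act g z\<close> by that inverse.\<close>
    then obtain r d where rd: "r \<in> R" "d \<in> \<Delta>" "inv\<^bsub>G\<^esub> g = d \<otimes>\<^bsub>G\<^esub> r" using R(4) by blast
    have "z = act (inv\<^bsub>G\<^esub> g) (act g z)" using act_inv_act(1)[OF gG z] by simp
    also have "\<dots> = act d (act r (act g z))"
      unfolding rd(3) using act_mult[OF carrier[OF rd(2)] RG[OF rd(1)]] g(2) K(2) by blast
    finally have "z \<in> act d ` B" unfolding B_def using rd(1) g(2) by blast
    then show "z \<in> sat B" unfolding sat_def using rd(2) by blast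
  qed
  moreover have "emeasure upper_vol B \<le> ennreal (real m * c)"
  proof -
    have "emeasure upper_vol B \<le> (\<Sum>r\<in>R. emeasure upper_vol (act r ` K))"
      unfolding B_def using R(2) Kr by (intro emeasure_subadditive_finite) auto
    also have "\<dots> = (\<Sum>r\<in>R. emeasure upper_vol K)"
      using emeasure_upper_vol_act[OF RG K(2,1)] by simp
    also have "\<dots> = of_nat (card R) * emeasure upper_vol K" by simp
    also have "\<dots> \<le> of_nat m * ennreal c" using R(3) K(3) by (intro mult_mono) auto
    also have "\<dots> = ennreal (real m * c)" using K(4) by (simp add: ennreal_mult' ennreal_of_nat_eq_real_of_nat)
    finally show ?thesis .
  qed
  ultimately show "vol \<Delta> \<le> real m * c"
    "\<And>U k. U \<in> sets borel \<Longrightarrow> small U \<Longrightarrow> ennreal k \<le> emeasure upper_vol U \<Longrightarrow> k \<le> vol \<Delta>"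
    using vol_bounds[of B "real m * c"] K(4) by auto
qed

text \<open>In each factor heights exceed 1 and differ by at most 1, and real parts differ by at
  most \<open>N\<close>, so \<open>hyp_e\<close> is at most \<open>N\<^sup>2 + 1\<close>. The
  product distance is at most the sum over the factors.\<close>

lemma (in displaced) small_box:
  assumes N: "N \<ge> 0" and L: "real CARD('r) * arcosh (1 + (N\<^sup>2 + 1) / 2) < L"
  shows "small {z. \<forall>i. z $ i \<in> box (Complex 0 1) (Complex N 2)}"
  unfolding small_def
proof (intro conjI ballI subsetI)
  fix z :: "complex^'r" assume "z \<in> {z. \<forall>i. z $ i \<in> box (Complex 0 1) (Complex N 2)}"
  then have z: "0 < Re (z $ i)" "Re (z $ i) < N" "1 < Im (z $ i)" "Im (z $ i) < 2" for i
    by (auto simp: mem_box Basis_complex_def)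
  have pos: "0 < Im (z $ i)" for i using z(3)[of i] by linarith
  then show zu: "z \<in> upper" by (simp add: upper_def)
  fix w :: "complex^'r" assume "w \<in> {z. \<forall>i. z $ i \<in> box (Complex 0 1) (Complex N 2)}"
  then have w: "0 < Re (w $ i)" "Re (w $ i) < N" "1 < Im (w $ i)" "Im (w $ i) < 2" for i
    by (auto simp: mem_box Basis_complex_def)
  have posw: "0 < Im (w $ i)" for i using w(3)[of i] by linarith
  have "hyp_dist (z $ i) (w $ i) \<le> arcosh (1 + (N\<^sup>2 + 1) / 2)" for i
  proof -
    have "\<bar>Re (z $ i) - Re (w $ i)\<bar> \<le> N" "\<bar>Im (z $ i) - Im (w $ i)\<bar> \<le> 1" using z[of i] w[of i] by linarith+
    then have "(Re (z $ i) - Re (w $ i))\<^sup>2 \<le> N\<^sup>2" "(Im (z $ i) - Im (w $ i))\<^sup>2 \<le> 1"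
      using N by (simp_all add: abs_le_square_iff[symmetric] abs_square_le_1)
    then have "(cmod (z $ i - w $ i))\<^sup>2 \<le> N\<^sup>2 + 1" unfolding cmod_power2 by simp
    moreover have "1 * 1 \<le> Im (z $ i) * Im (w $ i)" using z(3)[of i] w(3)[of i] by (intro mult_mono) auto
    ultimately have "hyp_e (z $ i) (w $ i) \<le> (N\<^sup>2 + 1) / 1"
      unfolding hyp_e_def by (intro frac_le) auto
    then have "\<not> arcosh (1 + (N\<^sup>2 + 1) / 2) < arcosh (1 + hyp_e (z $ i) (w $ i) / 2)"
      using hyp_e_nonneg[OF pos posw, of i i] by (subst arcosh_less_iff_real) auto
    then show ?thesis unfolding hyp_dist_hyp_e by simp
  qed
  then have "(\<Sum>i\<in>UNIV. hyp_dist (z $ i) (w $ i)) \<le> (\<Sum>i\<in>(UNIV :: 'r set). arcosh (1 + (N\<^sup>2 + 1) / 2))"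
    by (intro sum_mono)
  moreover have "upper_dist z w \<le> (\<Sum>i\<in>UNIV. hyp_dist (z $ i) (w $ i))"
    unfolding upper_dist_L2 using hyp_dist_nonneg[OF pos posw] by (intro L2_set_le_sum) auto
  ultimately show "upper_dist z w < L" using L by simp
qed

lemma residue_function:
  assumes "number_field TYPE('k::field_char_0)"
  obtains res :: "'k::field_char_0 \<Rightarrow> 'k" and T where "finite T" "card T \<le> 3 ^ (n * degree_field TYPE('k))"
    "\<And>x. algebraic_int x \<Longrightarrow> res x \<in> T"
    "\<And>x y. algebraic_int x \<Longrightarrow> algebraic_int y \<Longrightarrow> res x = res y \<Longrightarrow> x - y \<in> pow3_ideal n"
proof -
  obtain T :: "'k set" where T: "finite T" "card T \<le> 3 ^ (n * degree_field TYPE('k))"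
    "\<And>x. algebraic_int x \<Longrightarrow> \<exists>t\<in>T. \<exists>y. algebraic_int y \<and> x - t = 3 ^ n * y"
    using residues_mod_power3[OF assms, of n] by metis
  have "\<exists>t. t \<in> T \<and> x - t \<in> pow3_ideal n" if "algebraic_int x" for x
    using T(3)[OF that] pow3_idealI by blast
  then obtain res where res: "\<And>x. algebraic_int x \<Longrightarrow> res x \<in> T \<and> x - res x \<in> pow3_ideal n" by metis
  show ?thesis
  proof (rule that[OF T(1,2)])
    show "res x \<in> T" if "algebraic_int x" for x using res[OF that] by simp
    show "x - y \<in> pow3_ideal n" if "algebraic_int x" "algebraic_int y" "res x = res y" for x y
      using pow3_ideal_diff[OF conjunct2[OF res[OF that(1)]] conjunct2[OF res[OF that(2)]]] that(3) by simp
  qed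
qed

section \<open>Index bounds for the congruence subgroups\<close>

context arithmetic_data
begin

text \<open>The key combines the coset of \<open>\<Gamma>'\<close> with the residues modulo 3 of all
  four coordinates. The resulting number is fixed once and for all and ends up in the additive
  constant of the systole bound.\<close>

lemma covers_Pn_1:
  assumes sub: "subgroup \<Gamma>' G" and fi: "finite_index \<Gamma>' P"
  shows "\<exists>m. covers P (\<Gamma>' \<inter> Pn 1) m"
proof -
  interpret group G by (rule group_G)
  obtain res :: "'k \<Rightarrow> 'k" and T where T: "finite T" "\<And>x. algebraic_int x \<Longrightarrow> res x \<in> T"
    "\<And>x y. algebraic_int x \<Longrightarrow> algebraic_int y \<Longrightarrow> res x = res y \<Longrightarrow> x - y \<in> pow3_ideal 1"
    using residue_function[OF number_field, of 1] by metis
  define C where "C = rcosets\<^bsub>G\<lparr>carrier := P\<rparr>\<^esub> \<Gamma>'"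
  have coset: "\<Gamma>' #>\<^bsub>G\<^esub> g \<in> C" if "g \<in> P" for g
    using that by (auto simp: C_def RCOSETS_def r_coset_def)
  have "finite C" using fi by (simp add: C_def finite_index_def)
  \<comment> \<open>An element of \<open>G\<close> may come from two opposite quaternions; one is
    chosen so that residues of coordinates make sense.\<close>
  define pre where "pre g = (SOME x. x \<in> Q1 a b \<and> img x = g)" for g
  have pre: "pre g \<in> Q1 a b" "img (pre g) = g" if "g \<in> P" for g
    using that someI_ex[of "\<lambda>x. x \<in> Q1 a b \<and> img x = g"] by (auto simp: pre_def psl_image_img)
  define key where "key g = (\<Gamma>' #>\<^bsub>G\<^esub> g, case pre g of (x0, x1, x2, x3) \<Rightarrow> (res x0, res x1, res x2, res x3))" for g
  have "covers P (\<Gamma>' \<inter> Pn 1) (card (C \<times> T \<times> T \<times> T \<times> T))"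
  proof (rule covers_by_key[OF subgroup_P _ _ order_refl])
    show "key ` P \<subseteq> C \<times> T \<times> T \<times> T \<times> T"
      using coset pre(1) T(2) by (fastforce simp: key_def Q1_iff split: prod.splits)
    show "finite (C \<times> T \<times> T \<times> T \<times> T)" using T(1) \<open>finite C\<close> by simp
    fix g h assume g: "g \<in> P" and h: "h \<in> P" and eq: "key g = key h"
    have gh: "g \<in> carrier G" "h \<in> carrier G" using in_G[OF subgroup_P] g h by auto
    have "g \<in> \<Gamma>' #>\<^bsub>G\<^esub> h"
    proof -
      have "g \<in> \<Gamma>' #>\<^bsub>G\<^esub> g" using rcos_self[OF gh(1) sub] .
      then show ?thesis using eq by (simp add: key_def)
    qed
    then obtain \<gamma> where \<gamma>: "\<gamma> \<in> \<Gamma>'" "g = \<gamma> \<otimes>\<^bsub>G\<^esub> h" by (auto simp: r_coset_def)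
    then have "g \<otimes>\<^bsub>G\<^esub> inv\<^bsub>G\<^esub> h = \<gamma>" using gh in_G[OF sub \<gamma>(1)] by (simp add: m_assoc)
    moreover have "g \<otimes>\<^bsub>G\<^esub> inv\<^bsub>G\<^esub> h \<in> Pn 1"
    proof -
      obtain x0 x1 x2 x3 where x: "pre g = (x0, x1, x2, x3)" by (cases "pre g")
      obtain y0 y1 y2 y3 where y: "pre h = (y0, y1, y2, y3)" by (cases "pre h")
      have int: "algebraic_int x0" "algebraic_int x1" "algebraic_int x2" "algebraic_int x3"
        "algebraic_int y0" "algebraic_int y1" "algebraic_int y2" "algebraic_int y3"
        using pre(1)[OF g] pre(1)[OF h] by (auto simp: Q1_iff x y)
      have "qmult a b (pre g) (qconj (pre h)) \<in> Q1_cong a b (pow3_ideal 1)"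
        using eq int by (intro quotient_in_Q1_cong[OF ab_int pre(1)[OF g] pre(1)[OF h] x y] T(3)) (auto simp: key_def x y)
      moreover have "g \<otimes>\<^bsub>G\<^esub> inv\<^bsub>G\<^esub> h = img (qmult a b (pre g) (qconj (pre h)))"
        using img_mult[OF pre(1)[OF g] qconj_in_Q1[OF pre(1)[OF h]]] img_inv[OF pre(1)[OF h]] pre(2)[OF g] pre(2)[OF h] by simp
      ultimately show ?thesis by (simp add: psl_image_img)
    qed
    ultimately show "g \<otimes>\<^bsub>G\<^esub> inv\<^bsub>G\<^esub> h \<in> \<Gamma>' \<inter> Pn 1" using \<gamma>(1) by simp
  qed
  then show ?thesis ..
qed

text \<open>Starting from level 1, three residues modulo \<open>3 ^ n\<close> determine a coset, the
  first coordinate following by \<open>first_coordinate_congruent\<close>. This is the exponent 3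
  that enters the growth rate of the volume.\<close>

lemma covers_Pn:
  assumes sub: "subgroup \<Gamma>' G"
  shows "covers (\<Gamma>' \<inter> Pn 1) (\<Gamma>' \<inter> Pn n) (3 ^ (3 * n * degree_field TYPE('k)))"
proof -
  interpret group G by (rule group_G)
  let ?d = "degree_field TYPE('k)"
  obtain res :: "'k \<Rightarrow> 'k" and T where T: "finite T" "card T \<le> 3 ^ (n * ?d)" "\<And>x. algebraic_int x \<Longrightarrow> res x \<in> T"
    "\<And>x y. algebraic_int x \<Longrightarrow> algebraic_int y \<Longrightarrow> res x = res y \<Longrightarrow> x - y \<in> pow3_ideal n"
    using residue_function[OF number_field, of n] by metis
  \<comment> \<open>The lift is taken congruent to 1 modulo 3, which fixes the sign and makes
    \<open>first_coordinate_congruent\<close> applicable.\<close>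
  define pre where "pre g = (SOME x. x \<in> Q1_cong a b (pow3_ideal 1) \<and> img x = g)" for g
  have pre: "pre g \<in> Q1_cong a b (pow3_ideal 1)" "img (pre g) = g" if "g \<in> Pn 1" for g
    using that someI_ex[of "\<lambda>x. x \<in> Q1_cong a b (pow3_ideal 1) \<and> img x = g"] by (auto simp: pre_def psl_image_img)
  define key where "key g = (case pre g of (x0, x1, x2, x3) \<Rightarrow> (res x1, res x2, res x3))" for g
  show ?thesis
  proof (rule covers_by_key[OF group.subgroups_Inter_pair[OF group_G sub subgroup_Pn]])
    show "key ` (\<Gamma>' \<inter> Pn 1) \<subseteq> T \<times> T \<times> T"
      using pre(1) T(3) by (fastforce simp: key_def Q1_cong_iff Q1_iff split: prod.splits)
    show "finite (T \<times> T \<times> T)" using T(1) by simp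
    have "card (T \<times> T \<times> T) = card T ^ 3" by (simp add: card_cartesian_product power3_eq_cube mult.assoc)
    also have "\<dots> \<le> (3 ^ (n * ?d)) ^ 3" using T(2) by (intro power_mono) auto
    also have "\<dots> = 3 ^ (3 * n * ?d)" by (simp add: power_mult[symmetric] mult_ac)
    finally show "card (T \<times> T \<times> T) \<le> 3 ^ (3 * n * ?d)" .
    fix g h assume g: "g \<in> \<Gamma>' \<inter> Pn 1" and h: "h \<in> \<Gamma>' \<inter> Pn 1" and eq: "key g = key h"
    have g1: "g \<in> Pn 1" and h1: "h \<in> Pn 1" using g h by auto
    obtain x0 x1 x2 x3 where x: "pre g = (x0, x1, x2, x3)" by (cases "pre g")
    obtain y0 y1 y2 y3 where y: "pre h = (y0, y1, y2, y3)" by (cases "pre h")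
    have Q: "pre g \<in> Q1 a b" "pre h \<in> Q1 a b" using pre(1)[OF g1] pre(1)[OF h1] Q1_cong_subset by blast+
    have int: "algebraic_int x1" "algebraic_int x2" "algebraic_int x3"
      "algebraic_int y1" "algebraic_int y2" "algebraic_int y3"
      using Q by (auto simp: Q1_iff x y)
    have d: "x1 - y1 \<in> pow3_ideal n" "x2 - y2 \<in> pow3_ideal n" "x3 - y3 \<in> pow3_ideal n"
      using eq int by (auto simp: key_def x y intro!: T(4))
    have "x0 - y0 \<in> pow3_ideal n"
      by (rule first_coordinate_congruent[OF ab_int pre(1)[OF g1, unfolded x] pre(1)[OF h1, unfolded y] d])
    then have "qmult a b (pre g) (qconj (pre h)) \<in> Q1_cong a b (pow3_ideal n)"
      using d by (intro quotient_in_Q1_cong[OF ab_int Q x y])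
    moreover have "g \<otimes>\<^bsub>G\<^esub> inv\<^bsub>G\<^esub> h = img (qmult a b (pre g) (qconj (pre h)))"
      using img_mult[OF Q(1) qconj_in_Q1[OF Q(2)]] img_inv[OF Q(2)] pre(2)[OF g1] pre(2)[OF h1] by simp
    ultimately have "g \<otimes>\<^bsub>G\<^esub> inv\<^bsub>G\<^esub> h \<in> Pn n" by (simp add: psl_image_img)
    moreover have "g \<otimes>\<^bsub>G\<^esub> inv\<^bsub>G\<^esub> h \<in> \<Gamma>'"
      using g h by (intro subgroup.m_closed[OF sub] subgroup.m_inv_closed[OF sub]) auto
    ultimately show "g \<otimes>\<^bsub>G\<^esub> inv\<^bsub>G\<^esub> h \<in> \<Gamma>' \<inter> Pn n" by simp
  qed
qed

end

theorem theorem1p6: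
  fixes a b :: "'k::field_char_0"
    and \<sigma> :: "'r::finite \<Rightarrow> 'k \<Rightarrow> real"
    and \<rho> :: "'r \<Rightarrow> 'k quat \<Rightarrow> real^2^2"
    and \<Gamma> :: "'r psl set"
  assumes "arithmetic_data a b \<sigma> \<rho>"
    and "closed_arithmetic_manifold a b \<rho> \<Gamma>"
  shows "\<exists>(\<Delta> :: nat \<Rightarrow> 'r psl set) (c :: real).
           (\<forall>i. congruence_covering a b \<rho> \<Gamma> (\<Delta> i)) \<and>
           filterlim (\<lambda>i. vol (\<Delta> i)) at_top sequentially \<and>
           (\<forall>i. sys1 (\<Delta> i) \<ge> ereal (4 / (3 * sqrt (real CARD('r))) * ln (vol (\<Delta> i)) - c))"
proof -
  interpret arithmetic_data a b \<sigma> \<rho> by fact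
  define d where "d = real (degree_field TYPE('k))"
  define s where "s = sqrt (real CARD('r))"
  have s: "s > 0" by (simp add: s_def)
  \<comment> \<open>There is at least one split embedding, so the degree is positive and
    \<open>L\<close> grows with \<open>n\<close>.\<close>
  have "embs \<noteq> {}" using sigma_embedding by blast
  then have "card embs > 0"
    using finite_real_embeddings[OF number_field totally_real] by (simp add: card_gt_0_iff)
  then have d: "d \<ge> 1" using card_real_embeddings[OF number_field totally_real] by (simp add: d_def)
  define L where "L n = (4 * real n * d * ln 3 - 2 * d * ln 4) / s" for n
  define \<Gamma>' where "\<Gamma>' = \<Gamma> \<inter> P"
  have sub: "subgroup \<Gamma>' G" and fi: "finite_index \<Gamma>' \<Gamma>" "finite_index \<Gamma>' P"
    using assms(2) group.subgroups_Inter_pair[OF group_G _ subgroup_P]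
    unfolding closed_arithmetic_manifold_def discrete_subgroup_def commensurable_def \<Gamma>'_def by auto
  have subn: "subgroup (\<Gamma>' \<inter> Pn n) G" for n by (rule group.subgroups_Inter_pair[OF group_G sub subgroup_Pn])
  \<comment> \<open>This comparison makes the displacement bound positive from level
    \<open>n = 1\<close> on.\<close>
  have ln34: "ln (4 :: real) < 2 * ln 3"
  proof -
    have "ln (4 :: real) < ln 9" by simp
    moreover have "ln (9 :: real) = 2 * ln 3" using ln_realpow[of "3 :: real" 2] by simp
    ultimately show ?thesis by linarith
  qed
  have Lpos: "L (Suc i) > 0" for i
  proof -
    have "d * ln 4 < d * (2 * ln 3)" using ln34 d by (intro mult_strict_left_mono) auto
    moreover have "d * ln 3 * 1 \<le> d * ln 3 * real (Suc i)" using d by (intro mult_left_mono) auto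
    ultimately have "0 < 4 * real (Suc i) * d * ln 3 - 2 * d * ln 4" by (simp add: algebra_simps)
    then show ?thesis using s by (simp add: L_def)
  qed
  have disp: "displaced (\<Gamma>' \<inter> Pn (Suc i)) (L (Suc i))" for i
  proof (rule displaced.intro)
    show "subgroup (\<Gamma>' \<inter> Pn (Suc i)) G" by (rule subn)
    show "0 < L (Suc i)" by (rule Lpos)
    show "L (Suc i) \<le> upper_dist z (act \<gamma> z)"
      if "\<gamma> \<in> \<Gamma>' \<inter> Pn (Suc i)" "\<gamma> \<noteq> \<one>\<^bsub>G\<^esub>" "z \<in> upper" for \<gamma> z
      using displacement_Pn[of \<gamma> "Suc i" z] that by (simp add: L_def d_def s_def)
  qed
  obtain m where m: "covers P (\<Gamma>' \<inter> Pn 1) m" using covers_Pn_1[OF sub fi(2)] by blast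
  have sub1: "\<Gamma>' \<inter> Pn 1 \<subseteq> P" by (auto simp: \<Gamma>'_def)
  have cov: "covers P (\<Gamma>' \<inter> Pn n) (3 ^ (3 * n * degree_field TYPE('k)) * m)" for n
    by (rule covers_trans[OF subgroup_P subn sub1 subgroup.subset[OF subn] m covers_Pn[OF sub]])
  obtain k :: real where k: "k \<ge> 1"
    "\<And>z. z \<in> upper \<Longrightarrow> \<exists>\<gamma>\<in>P. \<forall>i. 1 / k < Im (act \<gamma> z $ i) \<and> Im (act \<gamma> z $ i) < k \<and> \<bar>Re (act \<gamma> z $ i)\<bar> < k"
    using compact_exhaustion[OF subgroup_P cocompact] by blast
  define S where "S = {z. 1 / k < Im z} \<inter> {z. Im z < k} \<inter> {z. \<bar>Re z\<bar> < k}"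
  have S: "S \<in> sets borel"
    unfolding S_def by (intro borel_open open_Int open_Collect_less continuous_intros)
  define K where "K = {z :: complex^'r. \<forall>i. z $ i \<in> S}"
  define c where "c = (2 * k ^ 4) ^ CARD('r)"
  have c: "c \<ge> 0" using k(1) by (simp add: c_def)
  have Kup: "K \<subseteq> upper"
  proof
    fix z assume "z \<in> K"
    then have *: "1 / k < Im (z $ i)" for i by (simp add: K_def S_def)
    have "0 < 1 / k" using k(1) by simp
    then have "0 < Im (z $ i)" for i using *[of i] by (rule less_trans)
    then show "z \<in> upper" by (simp add: upper_def)
  qed
  have "emeasure hyp_meas S \<le> ennreal (2 * k ^ 4)" by (rule hyp_meas_box_le[OF k(1) S]) (auto simp: S_def)
  then have "emeasure hyp_meas S ^ CARD('r) \<le> ennreal (2 * k ^ 4) ^ CARD('r)" by (intro power_mono) auto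
  then have K: "emeasure upper_vol K \<le> ennreal c"
    unfolding K_def emeasure_upper_vol_vec_box[OF S] c_def using k(1) by (simp add: ennreal_power)
  have PK: "\<exists>g\<in>P. act g z \<in> K" if "z \<in> upper" for z using k(2)[OF that] by (simp add: K_def S_def)
  \<comment> \<open>Levels start at 1, since \<open>L 0\<close> is negative.\<close>
  define \<Delta> where "\<Delta> i = \<Gamma>' \<inter> Pn (Suc i)" for i
  have disp': "displaced (\<Delta> i) (L (Suc i))" for i using disp by (simp add: \<Delta>_def)
  have cov': "covers P (\<Delta> i) (3 ^ (3 * Suc i * degree_field TYPE('k)) * m)" for i
    unfolding \<Delta>_def by (rule cov)
  have Kb: "K \<in> sets borel" unfolding K_def by (rule vec_box_borel[OF S])
  have vol_le: "vol (\<Delta> i) \<le> real (3 ^ (3 * Suc i * degree_field TYPE('k)) * m) * c" for i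
    by (rule displaced.vol_le_of_covers(1)[OF disp' subgroup_P cov' Kb Kup K c]) (rule PK)
  have vol_ge: "x \<le> vol (\<Delta> i)"
    if U: "U \<in> sets borel" "displaced.small (L (Suc i)) U" "ennreal x \<le> emeasure upper_vol U"
    for U :: "(complex^'r) set" and x i
  proof (rule displaced.vol_le_of_covers(2)[OF disp' subgroup_P cov' Kb Kup K c])
    show "\<exists>g\<in>P. act g z \<in> K" if "z \<in> upper" for z by (rule PK[OF that])
  qed (rule U)+
  \<comment> \<open>At least 1, so that \<open>ln V\<close> is nonnegative and also bounds the case
    of a vanishing logarithm.\<close>
  define V where "V = max 1 (real m * c)"
  have V: "V \<ge> 1" by (simp add: V_def)
  have ln_vol: "ln (vol (\<Delta> i)) \<le> ln V + 3 * real (Suc i) * d * ln 3" for i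
  proof (cases "vol (\<Delta> i) > 0")
    case True
    have "vol (\<Delta> i) \<le> 3 ^ (3 * Suc i * degree_field TYPE('k)) * (real m * c)" using vol_le[of i] by (simp add: mult.assoc)
    also have "\<dots> \<le> 3 ^ (3 * Suc i * degree_field TYPE('k)) * V" unfolding V_def by (intro mult_left_mono) auto
    finally have "ln (vol (\<Delta> i)) \<le> ln (3 ^ (3 * Suc i * degree_field TYPE('k)) * V)" using True V by (subst ln_le_cancel_iff) auto
    also have "\<dots> = real (3 * Suc i * degree_field TYPE('k)) * ln 3 + ln V"
      using V by (subst ln_mult) (simp_all only: ln_realpow, auto)
    finally show ?thesis by (simp add: d_def algebra_simps)
  next
    case False
    moreover have "vol (\<Delta> i) \<ge> 0" by (simp add: vol_def)
    \<comment> \<open>The value of \<open>ln\<close> at 0 is 0 by convention, so this case obeys the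
      bound as well.\<close>
    ultimately have "ln (vol (\<Delta> i)) = 0" by simp
    then show ?thesis using V d by simp
  qed
  \<comment> \<open>The factor \<open>4 / (3 * s)\<close> turns the growth
    \<open>3 * n * d * ln 3\<close> of the logarithmic volume into the main term of
    \<open>L n\<close>; \<open>c0\<close> collects the volume constant and the error term of
    \<open>L\<close>.\<close>
  define c0 where "c0 = 4 / (3 * s) * ln V + 2 * d * ln 4 / s"
  have "sys1 (\<Delta> i) \<ge> ereal (4 / (3 * s) * ln (vol (\<Delta> i)) - c0)" for i
  proof -
    have "4 / (3 * s) * ln (vol (\<Delta> i)) \<le> 4 / (3 * s) * (ln V + 3 * real (Suc i) * d * ln 3)"
      using ln_vol s by (intro mult_left_mono) auto
    also have "\<dots> = c0 + L (Suc i)"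
      using s by (simp add: c0_def L_def field_simps)
    finally have "ereal (4 / (3 * s) * ln (vol (\<Delta> i)) - c0) \<le> ereal (L (Suc i))" by simp
    also have "\<dots> \<le> sys1 (\<Delta> i)" by (rule displaced.sys1_ge[OF disp'])
    finally show ?thesis .
  qed
  moreover have "filterlim (\<lambda>i. vol (\<Delta> i)) at_top sequentially"
    unfolding filterlim_at_top
  proof
    fix Z :: real
    \<comment> \<open>With \<open>N\<close> at least 4, powers of \<open>N / 4\<close> do not fall
      below \<open>N / 4\<close>, so the box volume exceeds \<open>Z\<close> for any number of
      factors.\<close>
    define N where "N = max 4 (4 * Z)"
    have N: "N \<ge> 4" "Z \<le> N / 4" by (auto simp: N_def)
    define M where "M = real CARD('r) * arcosh (1 + (N\<^sup>2 + 1) / 2)"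
    have dl: "d * ln 3 > 0" using d by simp
    \<comment> \<open>From this level on \<open>L\<close> exceeds \<open>M\<close>, the diameter
      bound of the box of width \<open>N\<close>, which therefore embeds in the quotient.\<close>
    obtain i0 :: nat where i0: "(M * s + 2 * d * ln 4) / (4 * (d * ln 3)) < real i0" using reals_Archimedean2 by blast
    have "Z \<le> vol (\<Delta> i)" if "i \<ge> i0" for i
    proof -
      have "(M * s + 2 * d * ln 4) / (4 * (d * ln 3)) < real (Suc i)" using i0 that by simp
      then have "M * s + 2 * d * ln 4 < real (Suc i) * (4 * (d * ln 3))" using dl by (subst (asm) pos_divide_less_eq) auto
      then have "M * s < 4 * real (Suc i) * d * ln 3 - 2 * d * ln 4" by (simp add: algebra_simps)
      then have "M < L (Suc i)" unfolding L_def using s by (simp add: pos_less_divide_eq)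
      then have sm: "displaced.small (L (Suc i)) {z :: complex^'r. \<forall>j. z $ j \<in> box (Complex 0 1) (Complex N 2)}"
        using N(1) unfolding M_def by (intro displaced.small_box[OF disp']) auto
      have "ennreal (N / 4) ^ CARD('r) \<le> emeasure hyp_meas (box (Complex 0 1) (Complex N 2)) ^ CARD('r)"
        using N(1) by (intro power_mono hyp_meas_box_ge) auto
      then have "ennreal ((N / 4) ^ CARD('r)) \<le> emeasure upper_vol {z :: complex^'r. \<forall>j. z $ j \<in> box (Complex 0 1) (Complex N 2)}"
        using N(1) by (subst emeasure_upper_vol_vec_box) (simp_all add: ennreal_power)
      then have "(N / 4) ^ CARD('r) \<le> vol (\<Delta> i)" by (intro vol_ge[OF _ sm] vec_box_borel) auto
      moreover have "N / 4 \<le> (N / 4) ^ CARD('r)" using N(1) by (intro self_le_power) auto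
      ultimately show ?thesis using N(2) by linarith
    qed
    then show "\<forall>\<^sub>F i in sequentially. Z \<le> vol (\<Delta> i)" unfolding eventually_sequentially by blast
  qed
  moreover have "congruence_covering a b \<rho> \<Gamma> (\<Delta> i)" for i
    unfolding congruence_covering_def \<Delta>_def
    using sub fi(1) ideal_pow3_ideal pow3_ideal_nonzero
    by (intro exI[of _ \<Gamma>'] exI[of _ "pow3_ideal (Suc i)"]) (auto simp: \<Gamma>'_def)
  ultimately show ?thesis unfolding s_def by blast
qed

end
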